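(* Let $K$ be a field and let $f\colon A\to B$ be a morphism of $K$-coalgebras. If $H^3_c(f)=0$, then every $2$-cocycle in the deformation complex $C^*_c(f)$ is integrable; that is, for every $\omega\in C^2_c(f)$ with $d_c\omega=0$ there exists a deformation $\Omega_t=\sum_{n=0}^\infty\omega_nt^n$ of $f$ with $\omega_1=\omega$.
   Context: Fix a ground field $K$; $\otimes$ and $\mathrm{Hom}$ are over $K$. A $K$-coalgebra is a pair $(A,\Delta_A)$ with $A$ a $K$-vector space and $\Delta_A\colon A\to A\otimes A$ a $K$-linear map that is coassociative: $(\mathrm{Id}\otimes\Delta_A)\Delta_A=(\Delta_A\otimes\mathrm{Id})\Delta_A$ (no counit is required). A morphism $f\colon A\to B$ of coalgebras is a linear map with $\Delta_B\circ f=(f\otimes f)\circ\Delta_A$. Hochschild coalgebra cochains. For a coalgebra $A$ and an $A$-bicomodule $M$ with structure maps $\psi_l\colon M\to A\otimes M$ and $\psi_r\colon M\to M\otimes A$, set $C^n_c(M,A)=\mathrm{Hom}_K(M,A^{\otimes n})$ for $n\ge1$, $C^0_c(M,A)=0$, with differential $\delta_c\colon C^n_c(M,A)\to C^{n+1}_c(M,A)$, $$\delta_c\sigma=(\mathrm{Id}_A\otimes\sigma)\circ\psi_l+\sum_{i=1}^n(-1)^i(\mathrm{Id}_{A^{\otimes(i-1)}}\otimes\Delta_A\otimes\mathrm{Id}_{A^{\otimes(n-i)}})\circ\sigma+(-1)^{n+1}(\sigma\otimes\mathrm{Id}_A)\circ\psi_r .$$ A coalgebra $A$ is a bicomodule over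 itself with $\psi_l=\psi_r=\Delta_A$. Given a coalgebra morphism $f\colon A\to B$, $A$ is a $B$-bicomodule via $\psi_l=(f\otimes\mathrm{Id}_A)\circ\Delta_A$ and $\psi_r=(\mathrm{Id}_A\otimes f)\circ\Delta_A$; $C^*_c(A,B)$ refers to this structure. Deformation complex of $f$. For $n\ge1$, $C^n_c(f)=C^n_c(A,A)\times C^n_c(B,B)\times C^{n-1}_c(A,B)$, with differential $d_c\colon C^n_c(f)\to C^{n+1}_c(f)$, $$d_c(\xi;\pi;\varphi)=\big(\delta_c\xi;\ \delta_c\pi;\ \pi\circ f-f^{\otimes n}\circ\xi-\delta_c\varphi\big).$$ One has $d_cd_c=0$; the cohomology of $(C^*_c(f),d_c)$ is denoted $H^*_c(f)$. Deformations. A deformation of a coalgebra $(X,\Delta_X)$ is a formal power series $\Delta_{X,t}=\sum_{n\ge0}\Delta_{X,n}t^n$ with $\Delta_{X,n}\in\mathrm{Hom}_K(X,X\otimes X)$, $\Delta_{X,0}=\Delta_X$, that is coassociative as a power series: $(\mathrm{Id}\otimes\Delta_{X,t})\Delta_{X,t}=(\Delta_{X,t}\otimes\mathrm{Id})\Delta_{X,t}$ (i.e. coefficientwise in $t$). A deformation of $f$ is a formal power series $\Omega_t=\sum_{n\ge0}\omega_nt^n$ with $\omega_n=(\Delta_{A,n};\Delta_{B,n};f_n)\in C^2_c(f)$ such that $\Delta_{A,t}=\sum_n\Delta_{A,n}t^n$ is a deformation of $A$, $\Delta_{B,t}=\sum_n\Delta_{B,n}t^n$ is a deformation of $B$, $f_0=f$,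 and $F_t=\sum_nf_nt^n$ satisfies $\Delta_{B,t}\circ F_t=(F_t\otimes F_t)\circ\Delta_{A,t}$ coefficientwise in $t$. The coefficient $\omega_1$ is called the infinitesimal of $\Omega_t$. A $2$-cocycle $\omega$ of $C^*_c(f)$ is called integrable if it is the infinitesimal of some deformation of $f$. *)

theory Defs
  imports Complex_Main "HOL-Library.Function_Algebras" "HOL-Library.Product_Plus"
begin

section \<open>Tensor products over a field\<close>

text \<open>
  A \<open>K\<close>-vector space is an additive group type with a scalar multiplication \<open>s\<close> such that
  \<open>vector_space s\<close>.  The tensor product of \<open>X\<^sub>1, \<dots>, X\<^sub>n\<close> is realised inside the dual of
  the space of \<open>n\<close>-linear forms: \<open>x\<^sub>1 \<otimes> \<dots> \<otimes> x\<^sub>n\<close> is evaluation of \<open>n\<close>-linear forms at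
  \<open>(x\<^sub>1, \<dots>, x\<^sub>n)\<close>, and the tensor product is the span of these elements.  (As HOL
  functions are total, a tensor is given the value 0 on functions that are not \<open>n\<close>-linear.)
  The lemmas \<open>tpow_universal\<close>, \<open>tpow_unique\<close>, \<open>tprod_universal\<close> and \<open>tprod_unique\<close> below
  state the universal property of the tensor product for this construction.
\<close>

type_synonym ('w, 'k) tensor = "('w \<Rightarrow> 'k) \<Rightarrow> 'k"

definition tscale :: "'k::field \<Rightarrow> ('w, 'k) tensor \<Rightarrow> ('w, 'k) tensor" where
  "tscale c t = (\<lambda>\<phi>. c * t \<phi>)"

definition eval_at :: "(('w \<Rightarrow> 'k::field) \<Rightarrow> bool) \<Rightarrow> 'w \<Rightarrow> ('w, 'k) tensor" where
  "eval_at P w = (\<lambda>\<phi>. if P \<phi> then \<phi> w else 0)"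

definition multilinear ::
  "('k::field \<Rightarrow> 'x::ab_group_add \<Rightarrow> 'x) \<Rightarrow> ('k \<Rightarrow> 'y::ab_group_add \<Rightarrow> 'y) \<Rightarrow> nat \<Rightarrow>
   ('x list \<Rightarrow> 'y) \<Rightarrow> bool" where
  "multilinear sX sY n g \<longleftrightarrow>
     (\<forall>u v. length u + 1 + length v = n \<longrightarrow> Vector_Spaces.linear sX sY (\<lambda>x. g (u @ x # v)))"

text \<open>\<open>tpure sX [x\<^sub>1, \<dots>, x\<^sub>n]\<close> is \<open>x\<^sub>1 \<otimes> \<dots> \<otimes> x\<^sub>n\<close>, and \<open>tpow sX n\<close> is \<open>X\<^sup>\<otimes>\<^sup>n\<close>; in
  particular \<open>X \<otimes> X\<close> is \<open>tpow sX 2\<close>.\<close>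

definition tpure :: "('k::field \<Rightarrow> 'x::ab_group_add \<Rightarrow> 'x) \<Rightarrow> 'x list \<Rightarrow> ('x list, 'k) tensor" where
  "tpure sX w = eval_at (multilinear sX (*) (length w)) w"

definition tpow :: "('k::field \<Rightarrow> 'x::ab_group_add \<Rightarrow> 'x) \<Rightarrow> nat \<Rightarrow> ('x list, 'k) tensor set" where
  "tpow sX n = module.span tscale (tpure sX ` {w. length w = n})"

definition bilin ::
  "('k::field \<Rightarrow> 'x::ab_group_add \<Rightarrow> 'x) \<Rightarrow> ('k \<Rightarrow> 'y::ab_group_add \<Rightarrow> 'y) \<Rightarrow>
   ('k \<Rightarrow> 'z::ab_group_add \<Rightarrow> 'z) \<Rightarrow> ('x \<times> 'y \<Rightarrow> 'z) \<Rightarrow> bool" where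
  "bilin sX sY sZ g \<longleftrightarrow>
     (\<forall>y. Vector_Spaces.linear sX sZ (\<lambda>x. g (x, y))) \<and>
     (\<forall>x. Vector_Spaces.linear sY sZ (\<lambda>y. g (x, y)))"

text \<open>\<open>tpair sX sY (x, y)\<close> is \<open>x \<otimes> y\<close>, and \<open>tprod sX sY\<close> is \<open>X \<otimes> Y\<close>, for possibly
  different spaces \<open>X\<close> and \<open>Y\<close>.\<close>

definition tpair ::
  "('k::field \<Rightarrow> 'x::ab_group_add \<Rightarrow> 'x) \<Rightarrow> ('k \<Rightarrow> 'y::ab_group_add \<Rightarrow> 'y) \<Rightarrow>
   'x \<times> 'y \<Rightarrow> ('x \<times> 'y, 'k) tensor" where
  "tpair sX sY = eval_at (bilin sX sY (*))"

definition tprod ::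
  "('k::field \<Rightarrow> 'x::ab_group_add \<Rightarrow> 'x) \<Rightarrow> ('k \<Rightarrow> 'y::ab_group_add \<Rightarrow> 'y) \<Rightarrow>
   ('x \<times> 'y, 'k) tensor set" where
  "tprod sX sY = module.span tscale (range (tpair sX sY))"

text \<open>\<open>tlift g\<close> is the linear map induced by a multilinear map \<open>g\<close> with values in a
  tensor product; see \<open>tlift_tpure\<close> and \<open>tlift_tpair\<close>.\<close>

definition tlift :: "('w \<Rightarrow> ('v, 'k) tensor) \<Rightarrow> ('w, 'k) tensor \<Rightarrow> ('v, 'k) tensor" where
  "tlift g t = (\<lambda>\<phi>. t (\<lambda>w. g w \<phi>))"

subsection \<open>The universal property\<close>

lemma vector_space_tscale: "vector_space tscale"
  by unfold_locales (auto simp: tscale_def fun_eq_iff algebra_simps)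

lemma vector_space_field: "vector_space ((*) :: 'k::field \<Rightarrow> 'k \<Rightarrow> 'k)"
  by unfold_locales (auto simp: algebra_simps)

lemma linear_tlift: "Vector_Spaces.linear tscale tscale (tlift g)"
  by (auto simp: Vector_Spaces.linear_iff vector_space_tscale tlift_def tscale_def fun_eq_iff)

lemma linear_eval: "Vector_Spaces.linear tscale (*) (\<lambda>t. t \<phi>)"
  using vector_space_tscale vector_space_field
  by (auto simp: Vector_Spaces.linear_iff tscale_def)

lemma linear_comp:
  assumes "Vector_Spaces.linear s1 s2 f" and "Vector_Spaces.linear s2 s3 g"
  shows "Vector_Spaces.linear s1 s3 (\<lambda>x. g (f x))"
  using assms by (auto simp: Vector_Spaces.linear_iff)

lemma tlift_tpure:
  assumes "multilinear sX tscale (length w) g"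
  shows "tlift g (tpure sX w) = g w"
proof -
  have "multilinear sX (*) (length w) (\<lambda>w. g w \<phi>)" for \<phi>
    using assms unfolding multilinear_def
    by (auto intro: linear_comp[OF _ linear_eval[of \<phi>], where f = "\<lambda>x. g (_ @ x # _)"])
  then show ?thesis by (simp add: tlift_def tpure_def eval_at_def)
qed

lemma tlift_tpair:
  assumes "bilin sX sY tscale g"
  shows "tlift g (tpair sX sY p) = g p"
proof -
  have "bilin sX sY (*) (\<lambda>w. g w \<phi>)" for \<phi>
    using assms unfolding bilin_def
    by (auto intro: linear_comp[OF _ linear_eval[of \<phi>], where f = "\<lambda>x. g (x, _)"]
      linear_comp[OF _ linear_eval[of \<phi>], where f = "\<lambda>y. g (_, y)"])
  then show ?thesis by (simp add: tlift_def tpair_def eval_at_def)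
qed

lemma functionals_separate:
  fixes sW :: "'k::field \<Rightarrow> 'y::ab_group_add \<Rightarrow> 'y"
  assumes "vector_space sW"
    and eq: "\<And>l. Vector_Spaces.linear sW (*) l \<Longrightarrow> l x = l y"
  shows "x = y"
proof (rule ccontr)
  assume ne: "x \<noteq> y"
  interpret vector_space_pair sW "(*) :: 'k \<Rightarrow> 'k \<Rightarrow> 'k"
    using assms(1) vector_space_field by (simp add: vector_space_pair_def)
  have "vs1.independent {x - y}" using ne by simp
  from linear_independent_extend[OF this, of "\<lambda>_. 1"] obtain l
    where l: "Vector_Spaces.linear sW (*) l" and l1: "l (x - y) = 1" by auto
  have "l x - l y = 1"
    using l1 l by (metis linear_iff_module_hom module_hom.diff)
  then show False using eq[OF l] by simp
qed

lemma eval_at_universal: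
  fixes sW :: "'k::field \<Rightarrow> 'y::ab_group_add \<Rightarrow> 'y" and g :: "'w \<Rightarrow> 'y"
  assumes sW: "vector_space sW"
    and P: "\<And>l. Vector_Spaces.linear sW (*) l \<Longrightarrow> P (\<lambda>w. l (g w))"
  shows "\<exists>h. Vector_Spaces.linear tscale sW h \<and> (\<forall>w. h (eval_at P w) = g w)"
proof -
  interpret T: vector_space_pair "tscale :: 'k \<Rightarrow> ('w, 'k) tensor \<Rightarrow> _" sW
    using sW vector_space_tscale by (simp add: vector_space_pair_def)
  obtain B where B: "B \<subseteq> range (eval_at P)" "T.vs1.independent B"
      "range (eval_at P) \<subseteq> T.vs1.span B"
    using T.vs1.maximal_independent_subset[of "range (eval_at P)"] by blast
  obtain r where r: "\<And>b. b \<in> B \<Longrightarrow> eval_at P (r b) = b"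
    using B(1) by (metis (no_types) f_inv_into_f subsetD)
  obtain h where h: "Vector_Spaces.linear tscale sW h" "\<And>b. b \<in> B \<Longrightarrow> h b = g (r b)"
    using T.linear_independent_extend[OF B(2), of "\<lambda>b. g (r b)"] by blast
  have "h (eval_at P w) = g w" for w
  proof (rule functionals_separate[OF sW])
    fix l assume l: "Vector_Spaces.linear sW (*) l"
    have lin1: "Vector_Spaces.linear tscale (*) (\<lambda>t. l (h t))"
      by (rule linear_comp[OF h(1) l])
    have lin2: "Vector_Spaces.linear tscale (*) (\<lambda>t. t (\<lambda>w. l (g w)))"
      by (rule linear_eval)
    have ev: "eval_at P w (\<lambda>w. l (g w)) = l (g w)" for w
      using P[OF l] by (simp add: eval_at_def)
    interpret V: vector_space_pair "tscale :: 'k \<Rightarrow> ('w, 'k) tensor \<Rightarrow> _" "(*) :: 'k \<Rightarrow> 'k \<Rightarrow> 'k"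
      using vector_space_field vector_space_tscale by (simp add: vector_space_pair_def)
    have "l (h (eval_at P w)) = eval_at P w (\<lambda>w. l (g w))"
    proof (rule V.linear_eq_on[OF lin1 lin2])
      show "eval_at P w \<in> T.vs1.span B" using B(3) by blast
      show "l (h b) = b (\<lambda>w. l (g w))" if "b \<in> B" for b
        using h(2)[OF that] r[OF that] ev[of "r b"] by simp
    qed
    then show "l (h (eval_at P w)) = l (g w)" by (simp add: ev)
  qed
  then show ?thesis using h(1) by blast
qed

lemma tpow_universal:
  assumes "vector_space sY" and "multilinear sX sY n g"
  shows "\<exists>h. Vector_Spaces.linear tscale sY h \<and> (\<forall>w. length w = n \<longrightarrow> h (tpure sX w) = g w)"
proof -
  have "multilinear sX (*) n (\<lambda>w. l (g w))" if "Vector_Spaces.linear sY (*) l" for l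
    using assms(2) that by (auto simp: multilinear_def intro!: linear_comp[OF _ that])
  from eval_at_universal[OF assms(1), of "multilinear sX (*) n" g, OF this]
  show ?thesis by (auto simp: tpure_def)
qed

lemma tpow_unique:
  fixes h h' :: "('x::ab_group_add list, 'k::field) tensor \<Rightarrow> 'z::ab_group_add"
  assumes "Vector_Spaces.linear tscale sY h" and "Vector_Spaces.linear tscale sY h'"
    and "\<And>w. length w = n \<Longrightarrow> h (tpure sX w) = h' (tpure sX w)" and "t \<in> tpow sX n"
  shows "h t = h' t"
proof -
  interpret vector_space_pair "tscale :: 'k \<Rightarrow> ('x list, 'k) tensor \<Rightarrow> _" sY
    using assms(1) by (simp add: vector_space_pair_def Vector_Spaces.linear_iff vector_space_tscale)
  show ?thesis
    by (rule linear_eq_on[OF assms(1,2) assms(4)[unfolded tpow_def]]) (auto simp: assms(3))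
qed

lemma tprod_universal:
  assumes "vector_space sZ" and "bilin sX sY sZ g"
  shows "\<exists>h. Vector_Spaces.linear tscale sZ h \<and> (\<forall>p. h (tpair sX sY p) = g p)"
proof -
  have "bilin sX sY (*) (\<lambda>w. l (g w))" if "Vector_Spaces.linear sZ (*) l" for l
    using assms(2) that by (auto simp: bilin_def intro!: linear_comp[OF _ that])
  from eval_at_universal[OF assms(1), of "bilin sX sY (*)" g, OF this]
  show ?thesis by (simp add: tpair_def)
qed

lemma tprod_unique:
  fixes h h' :: "('x::ab_group_add \<times> 'y::ab_group_add, 'k::field) tensor \<Rightarrow> 'z::ab_group_add"
  assumes "Vector_Spaces.linear tscale sZ h" and "Vector_Spaces.linear tscale sZ h'"
    and "\<And>p. h (tpair sX sY p) = h' (tpair sX sY p)" and "t \<in> tprod sX sY"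
  shows "h t = h' t"
proof -
  interpret vector_space_pair "tscale :: 'k \<Rightarrow> ('x \<times> 'y, 'k) tensor \<Rightarrow> _" sZ
    using assms(1) by (simp add: vector_space_pair_def Vector_Spaces.linear_iff vector_space_tscale)
  show ?thesis
    by (rule linear_eq_on[OF assms(1,2) assms(4)[unfolded tprod_def]]) (auto simp: assms(3))
qed

subsection \<open>Tensor products of linear maps\<close>

text \<open>\<open>f\<^sub>1 \<otimes> \<dots> \<otimes> f\<^sub>n : X\<^sup>\<otimes>\<^sup>n \<rightarrow> Y\<^sup>\<otimes>\<^sup>n\<close> for a list \<open>[f\<^sub>1, \<dots>, f\<^sub>n]\<close> of linear maps \<open>X \<rightarrow> Y\<close>.\<close>

definition tmaps ::
  "('k::field \<Rightarrow> 'y::ab_group_add \<Rightarrow> 'y) \<Rightarrow> ('x \<Rightarrow> 'y) list \<Rightarrow>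
   ('x list, 'k) tensor \<Rightarrow> ('y list, 'k) tensor" where
  "tmaps sY fs = tlift (\<lambda>w. tpure sY (map2 (\<lambda>f x. f x) fs w))"

text \<open>\<open>ins_map sX i D\<close> is \<open>Id\<^sup>\<otimes>\<^sup>(\<^sup>i\<^sup>-\<^sup>1\<^sup>) \<otimes> D \<otimes> Id\<^sup>\<otimes>\<^sup>(\<^sup>n\<^sup>-\<^sup>i\<^sup>)\<close> on \<open>X\<^sup>\<otimes>\<^sup>n\<close>, for \<open>1 \<le> i \<le> n\<close> and \<open>D : X \<rightarrow> X \<otimes> X\<close>:
  in \<open>x\<^sub>1 \<otimes> \<dots> \<otimes> x\<^sub>n\<close> it replaces the factor \<open>x\<^sub>i\<close> by the tensor \<open>D x\<^sub>i\<close>.  The inner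
  \<open>tlift\<close> is \<open>v \<mapsto> x\<^sub>1 \<otimes> \<dots> \<otimes> x\<^sub>i\<^sub>-\<^sub>1 \<otimes> v \<otimes> x\<^sub>i\<^sub>+\<^sub>1 \<otimes> \<dots> \<otimes> x\<^sub>n\<close>.\<close>

definition ins_map ::
  "('k::field \<Rightarrow> 'x::ab_group_add \<Rightarrow> 'x) \<Rightarrow> nat \<Rightarrow> ('x \<Rightarrow> ('x list, 'k) tensor) \<Rightarrow>
   ('x list, 'k) tensor \<Rightarrow> ('x list, 'k) tensor" where
  "ins_map sX i D =
     tlift (\<lambda>w. tlift (\<lambda>v. tpure sX (take (i - 1) w @ v @ drop i w)) (D (w ! (i - 1))))"

text \<open>\<open>Id\<^sub>X \<otimes> \<sigma> : X \<otimes> M \<rightarrow> X\<^sup>\<otimes>\<^sup>n\<^sup>+\<^sup>1\<close> and \<open>\<sigma> \<otimes> Id\<^sub>X : M \<otimes> X \<rightarrow> X\<^sup>\<otimes>\<^sup>n\<^sup>+\<^sup>1\<close> for \<open>\<sigma> : M \<rightarrow> X\<^sup>\<otimes>\<^sup>n\<close>.\<close>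

definition id_tensor ::
  "('k::field \<Rightarrow> 'x::ab_group_add \<Rightarrow> 'x) \<Rightarrow> ('m \<Rightarrow> ('x list, 'k) tensor) \<Rightarrow>
   ('x \<times> 'm, 'k) tensor \<Rightarrow> ('x list, 'k) tensor" where
  "id_tensor sX \<sigma> = tlift (\<lambda>(x, m). tlift (\<lambda>v. tpure sX (x # v)) (\<sigma> m))"

definition tensor_id ::
  "('k::field \<Rightarrow> 'x::ab_group_add \<Rightarrow> 'x) \<Rightarrow> ('m \<Rightarrow> ('x list, 'k) tensor) \<Rightarrow>
   ('m \<times> 'x, 'k) tensor \<Rightarrow> ('x list, 'k) tensor" where
  "tensor_id sX \<sigma> = tlift (\<lambda>(m, x). tlift (\<lambda>v. tpure sX (v @ [x])) (\<sigma> m))"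

text \<open>\<open>g \<otimes> h : X \<otimes> Y \<rightarrow> X' \<otimes> Y'\<close>\<close>

definition pair_map ::
  "('k::field \<Rightarrow> 'x1::ab_group_add \<Rightarrow> 'x1) \<Rightarrow> ('k \<Rightarrow> 'y1::ab_group_add \<Rightarrow> 'y1) \<Rightarrow>
   ('x \<Rightarrow> 'x1) \<Rightarrow> ('y \<Rightarrow> 'y1) \<Rightarrow> ('x \<times> 'y, 'k) tensor \<Rightarrow> ('x1 \<times> 'y1, 'k) tensor" where
  "pair_map sX' sY' g h = tlift (\<lambda>(x, y). tpair sX' sY' (g x, h y))"

text \<open>The canonical identification of \<open>tpow sX 2\<close> with \<open>tprod sX sX\<close>.\<close>

definition as_pair ::
  "('k::field \<Rightarrow> 'x::ab_group_add \<Rightarrow> 'x) \<Rightarrow> ('x list, 'k) tensor \<Rightarrow> ('x \<times> 'x, 'k) tensor" where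
  "as_pair sX = tlift (\<lambda>w. tpair sX sX (w ! 0, w ! 1))"

text \<open>The canonical identification of \<open>X\<close> with \<open>X\<^sup>\<otimes>\<^sup>1\<close>.\<close>

definition as_tensor :: "('k::field \<Rightarrow> 'x::ab_group_add \<Rightarrow> 'x) \<Rightarrow> 'x \<Rightarrow> ('x list, 'k) tensor" where
  "as_tensor sX x = tpure sX [x]"

text \<open>\<open>Hom(M, X\<^sup>\<otimes>\<^sup>n)\<close>\<close>

definition Hom_tpow ::
  "('k::field \<Rightarrow> 'm::ab_group_add \<Rightarrow> 'm) \<Rightarrow> ('k \<Rightarrow> 'x::ab_group_add \<Rightarrow> 'x) \<Rightarrow> nat \<Rightarrow>
   ('m \<Rightarrow> ('x list, 'k) tensor) set" where
  "Hom_tpow sM sX n = {\<sigma>. Vector_Spaces.linear sM tscale \<sigma> \<and> range \<sigma> \<subseteq> tpow sX n}"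

subsection \<open>Values on pure tensors\<close>

text \<open>For linear \<open>f\<^sub>i\<close>, \<open>g\<close>, \<open>h\<close>, \<open>D\<close> and \<open>\<sigma>\<close>, the maps defined above have the expected
  values on pure tensors.\<close>

lemma multilinear_tpure:
  assumes "vector_space sX"
  shows "multilinear sX tscale n (tpure sX)"
  using assms vector_space_tscale
  by (auto simp: multilinear_def Vector_Spaces.linear_iff tpure_def eval_at_def tscale_def fun_eq_iff)

lemma bilin_tpair:
  assumes "vector_space sX" "vector_space sY"
  shows "bilin sX sY tscale (tpair sX sY)"
  using assms vector_space_tscale
  by (auto simp: bilin_def Vector_Spaces.linear_iff tpair_def eval_at_def tscale_def fun_eq_iff)

lemma linear_ctx:
  assumes "vector_space sX" "length p + 1 + length q = n" "Vector_Spaces.linear sZ sX f"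
  shows "Vector_Spaces.linear sZ tscale (\<lambda>x. tpure sX (p @ f x # q))"
  using multilinear_tpure[OF assms(1), of n] assms(2,3)
  by (auto simp: multilinear_def intro: linear_comp[where g = "\<lambda>x. tpure sX (p @ x # q)"])

lemma linear_id': "vector_space sX \<Longrightarrow> Vector_Spaces.linear sX sX (\<lambda>x. x)"
  by (auto simp: Vector_Spaces.linear_iff)

lemma multilinear_ctx:
  fixes sX :: "'k::field \<Rightarrow> 'x::ab_group_add \<Rightarrow> 'x"
  assumes "vector_space sX"
  shows "multilinear sX tscale n (\<lambda>v. tpure sX (p @ v @ q))"
  unfolding multilinear_def
proof (intro allI impI)
  fix u v :: "'x list"
  show "Vector_Spaces.linear sX tscale (\<lambda>x. tpure sX (p @ (u @ x # v) @ q))"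
    using linear_ctx[OF assms refl linear_id'[OF assms], of "p @ u" "v @ q"] by simp
qed

lemma linear_param:
  fixes sZ :: "'k::field \<Rightarrow> 'z::ab_group_add \<Rightarrow> 'z" and sX :: "'k::field \<Rightarrow> 'x::ab_group_add \<Rightarrow> 'x"
  assumes sZ: "vector_space sZ" and t: "t \<in> tpow sX m"
    and ml: "\<And>x. multilinear sX tscale m (g x)"
    and lin: "\<And>w. length w = m \<Longrightarrow> Vector_Spaces.linear sZ tscale (\<lambda>x. g x w)"
  shows "Vector_Spaces.linear sZ tscale (\<lambda>x. tlift (g x) t)"
proof -
  interpret T: vector_space "tscale :: 'k \<Rightarrow> ('x list, 'k) tensor \<Rightarrow> _" by (rule vector_space_tscale)
  show ?thesis
    using t[unfolded tpow_def]
  proof (induction rule: T.span_induct_alt)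
    case base
    show ?case unfolding Vector_Spaces.linear_iff
      by (intro conjI sZ vector_space_tscale) (auto simp: tlift_def tscale_def fun_eq_iff)
  next
    case (step c y t)
    then obtain w where w: "length w = m" "y = tpure sX w" by auto
    have *: "tlift (g x) (tscale c y + t) = tscale c (g x w) + tlift (g x) t" for x
      using tlift_tpure[of sX w "g x"] w ml[of x] linear_tlift[of "g x"]
      by (simp add: Vector_Spaces.linear_iff)
    show ?case unfolding * using step.IH lin[OF w(1)]
      by (simp add: Vector_Spaces.linear_iff vector_space_tscale) (simp add: tscale_def fun_eq_iff algebra_simps)
  qed
qed

lemma tmaps_tpure:
  fixes sX :: "'k::field \<Rightarrow> 'x::ab_group_add \<Rightarrow> 'x"
  assumes "vector_space sX" "vector_space sY" "\<forall>f\<in>set fs. Vector_Spaces.linear sX sY f" "length fs = length w"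
  shows "tmaps sY fs (tpure sX w) = tpure sY (map2 (\<lambda>f x. f x) fs w)"
  unfolding tmaps_def
proof (rule tlift_tpure, unfold multilinear_def, intro allI impI)
  fix u v :: "'x list" assume l: "length u + 1 + length v = length w"
  have fs: "fs = take (length u) fs @ fs ! length u # drop (Suc (length u)) fs"
    using l assms(4) by (intro id_take_nth_drop) auto
  have e: "map2 (\<lambda>f x. f x) fs (u @ x # v) =
    map2 (\<lambda>f x. f x) (take (length u) fs) u @
      (fs ! length u) x # map2 (\<lambda>f x. f x) (drop (Suc (length u)) fs) v" for x
    using l assms(4) by (subst fs) simp
  have "Vector_Spaces.linear sX sY (fs ! length u)" using assms(3,4) l by auto
  then show "Vector_Spaces.linear sX tscale (\<lambda>x. tpure sY (map2 (\<lambda>f x. f x) fs (u @ x # v)))"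
    unfolding e by (rule linear_ctx[OF assms(2) refl])
qed

lemma ins_map_tpure:
  fixes sX :: "'k::field \<Rightarrow> 'x::ab_group_add \<Rightarrow> 'x"
  assumes X: "vector_space sX" and D: "D \<in> Hom_tpow sX sX 2" and i: "1 \<le> i" "i \<le> length w"
  shows "ins_map sX i D (tpure sX w) =
    tlift (\<lambda>v. tpure sX (take (i - 1) w @ v @ drop i w)) (D (w ! (i - 1)))"
  unfolding ins_map_def
proof (rule tlift_tpure, unfold multilinear_def, intro allI impI)
  fix u v :: "'x list" assume l: "length u + 1 + length v = length w"
  have D1: "Vector_Spaces.linear sX tscale D" and D2: "D x \<in> tpow sX 2" for x
    using D by (auto simp: Hom_tpow_def)
  let ?F = "\<lambda>w. tlift (\<lambda>v. tpure sX (take (i - 1) w @ v @ drop i w)) (D (w ! (i - 1)))"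
  consider "length u = i - 1" | "length u < i - 1" | "i \<le> length u" using i by linarith
  then show "Vector_Spaces.linear sX tscale (\<lambda>x. ?F (u @ x # v))"
  proof cases
    case 1
    then have "?F (u @ x # v) = tlift (\<lambda>v'. tpure sX (u @ v' @ v)) (D x)" for x
      using i by (simp add: nth_append)
    then show ?thesis by (simp add: linear_comp[OF D1 linear_tlift])
  next
    case 2
    define j where "j = i - 1 - length u - 1"
    have e: "take (i - 1) (u @ x # v) = u @ x # take j v" "drop i (u @ x # v) = drop (Suc j) v"
      "(u @ x # v) ! (i - 1) = v ! j" for x
      using 2 i by (auto simp: j_def take_Cons' drop_Cons' nth_append Suc_diff_Suc)
    show ?thesis unfolding e
    proof (rule linear_param[OF X D2])
      show "multilinear sX tscale 2 (\<lambda>va. tpure sX ((u @ x # take j v) @ va @ drop (Suc j) v))" for x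
        by (rule multilinear_ctx[OF X])
      show "Vector_Spaces.linear sX tscale (\<lambda>x. tpure sX ((u @ x # take j v) @ w @ drop (Suc j) v))" for w
        using linear_ctx[OF X refl linear_id'[OF X], of u "take j v @ w @ drop (Suc j) v"] by simp
    qed
  next
    case 3
    have e: "take (i - 1) (u @ x # v) = take (i - 1) u" "drop i (u @ x # v) = drop i u @ x # v"
      "(u @ x # v) ! (i - 1) = u ! (i - 1)" for x
      using 3 i by (auto simp: nth_append)
    show ?thesis unfolding e
    proof (rule linear_param[OF X D2])
      show "multilinear sX tscale 2 (\<lambda>va. tpure sX (take (i-1) u @ va @ drop i u @ x # v))" for x
        by (rule multilinear_ctx[OF X])
      show "Vector_Spaces.linear sX tscale (\<lambda>x. tpure sX (take (i-1) u @ w @ drop i u @ x # v))" for w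
        using linear_ctx[OF X refl linear_id'[OF X], of "take (i-1) u @ w @ drop i u" v] by simp
    qed
  qed
qed

lemma id_tensor_tpair:
  assumes X: "vector_space sX" and M: "vector_space sM" and s: "\<sigma> \<in> Hom_tpow sM sX n"
  shows "id_tensor sX \<sigma> (tpair sX sM (x, m)) = tlift (\<lambda>v. tpure sX (x # v)) (\<sigma> m)"
proof -
  have "bilin sX sM tscale (\<lambda>(x, m). tlift (\<lambda>v. tpure sX (x # v)) (\<sigma> m))"
    unfolding bilin_def
  proof (intro conjI allI; simp)
    show "Vector_Spaces.linear sX tscale (\<lambda>x. tlift (\<lambda>v. tpure sX (x # v)) (\<sigma> y))" for y
    proof (rule linear_param[OF X])
      show "\<sigma> y \<in> tpow sX n" using s by (auto simp: Hom_tpow_def)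
      show "multilinear sX tscale n (\<lambda>v. tpure sX (x # v))" for x
        using multilinear_ctx[OF X, of n "[x]" "[]"] by simp
      show "Vector_Spaces.linear sX tscale (\<lambda>x. tpure sX (x # w))" for w
        using linear_ctx[OF X refl linear_id'[OF X], of "[]" w] by simp
    qed
    show "Vector_Spaces.linear sM tscale (\<lambda>y. tlift (\<lambda>v. tpure sX (x # v)) (\<sigma> y))" for x
      using s by (auto simp: Hom_tpow_def intro: linear_comp[OF _ linear_tlift])
  qed
  then show ?thesis unfolding id_tensor_def by (subst tlift_tpair) auto
qed

lemma tensor_id_tpair:
  assumes X: "vector_space sX" and M: "vector_space sM" and s: "\<sigma> \<in> Hom_tpow sM sX n"
  shows "tensor_id sX \<sigma> (tpair sM sX (m, x)) = tlift (\<lambda>v. tpure sX (v @ [x])) (\<sigma> m)"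
proof -
  have "bilin sM sX tscale (\<lambda>(m, x). tlift (\<lambda>v. tpure sX (v @ [x])) (\<sigma> m))"
    unfolding bilin_def
  proof (intro conjI allI; simp)
    show "Vector_Spaces.linear sX tscale (\<lambda>x. tlift (\<lambda>v. tpure sX (v @ [x])) (\<sigma> y))" for y
    proof (rule linear_param[OF X])
      show "\<sigma> y \<in> tpow sX n" using s by (auto simp: Hom_tpow_def)
      show "multilinear sX tscale n (\<lambda>v. tpure sX (v @ [x]))" for x
        using multilinear_ctx[OF X, of n "[]" "[x]"] by simp
      show "Vector_Spaces.linear sX tscale (\<lambda>x. tpure sX (w @ [x]))" for w
        using linear_ctx[OF X refl linear_id'[OF X], of w "[]"] by simp
    qed
    show "Vector_Spaces.linear sM tscale (\<lambda>y. tlift (\<lambda>v. tpure sX (v @ [x])) (\<sigma> y))" for x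
      using s by (auto simp: Hom_tpow_def intro: linear_comp[OF _ linear_tlift])
  qed
  then show ?thesis unfolding tensor_id_def by (subst tlift_tpair) auto
qed

lemma as_pair_tpure:
  assumes "vector_space sX"
  shows "as_pair sX (tpure sX [x, y]) = tpair sX sX (x, y)"
proof -
  have "multilinear sX tscale (length [x,y]) (\<lambda>w. tpair sX sX (w ! 0, w ! 1))"
    unfolding multilinear_def
  proof (intro allI impI)
    fix u v :: "'b list" assume "length u + 1 + length v = length [x,y]"
    then consider a where "u = []" "v = [a]" | a where "u = [a]" "v = []"
      by (cases u; cases v) auto
    then show "Vector_Spaces.linear sX tscale (\<lambda>x. tpair sX sX ((u @ x # v) ! 0, (u @ x # v) ! 1))"
      using bilin_tpair[OF assms assms] by cases (auto simp: bilin_def)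
  qed
  then show ?thesis unfolding as_pair_def by (subst tlift_tpure) auto
qed

lemma pair_map_tpair:
  assumes "vector_space sX'" and "vector_space sY'"
    and "Vector_Spaces.linear sX sX' g" and "Vector_Spaces.linear sY sY' h"
  shows "pair_map sX' sY' g h (tpair sX sY (x, y)) = tpair sX' sY' (g x, h y)"
proof -
  have "Vector_Spaces.linear sX tscale (\<lambda>x. tpair sX' sY' (g x, b))"
    and "Vector_Spaces.linear sY tscale (\<lambda>y. tpair sX' sY' (a, h y))" for a b
    using bilin_tpair[OF assms(1,2)]
    by (auto simp: bilin_def intro: linear_comp[OF assms(3), where g = "\<lambda>x. tpair sX' sY' (x, b)"]
      linear_comp[OF assms(4), where g = "\<lambda>y. tpair sX' sY' (a, y)"])
  then have "bilin sX sY tscale (\<lambda>(x, y). tpair sX' sY' (g x, h y))"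
    by (auto simp: bilin_def)
  then show ?thesis unfolding pair_map_def by (subst tlift_tpair) auto
qed

section \<open>Coalgebras and their cochains\<close>

definition coalgebra ::
  "('k::field \<Rightarrow> 'x::ab_group_add \<Rightarrow> 'x) \<Rightarrow> ('x \<Rightarrow> ('x list, 'k) tensor) \<Rightarrow> bool" where
  "coalgebra sX \<Delta> \<longleftrightarrow> vector_space sX \<and> \<Delta> \<in> Hom_tpow sX sX 2 \<and>
     ins_map sX 2 \<Delta> \<circ> \<Delta> = ins_map sX 1 \<Delta> \<circ> \<Delta>"

definition coalgebra_morphism ::
  "('k::field \<Rightarrow> 'x::ab_group_add \<Rightarrow> 'x) \<Rightarrow> ('x \<Rightarrow> ('x list, 'k) tensor) \<Rightarrow>
   ('k \<Rightarrow> 'y::ab_group_add \<Rightarrow> 'y) \<Rightarrow> ('y \<Rightarrow> ('y list, 'k) tensor) \<Rightarrow> ('x \<Rightarrow> 'y) \<Rightarrow> bool" where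
  "coalgebra_morphism sX \<Delta>X sY \<Delta>Y f \<longleftrightarrow>
     Vector_Spaces.linear sX sY f \<and> \<Delta>Y \<circ> f = tmaps sY [f, f] \<circ> \<Delta>X"

definition cochains ::
  "('k::field \<Rightarrow> 'm::ab_group_add \<Rightarrow> 'm) \<Rightarrow> ('k \<Rightarrow> 'x::ab_group_add \<Rightarrow> 'x) \<Rightarrow> nat \<Rightarrow>
   ('m \<Rightarrow> ('x list, 'k) tensor) set" where
  "cochains sM sX n = (if n = 0 then {0} else Hom_tpow sM sX n)"

text \<open>The Hochschild differential \<open>C\<^sup>n(M, X) \<rightarrow> C\<^sup>n\<^sup>+\<^sup>1(M, X)\<close> for an \<open>X\<close>-bicomodule \<open>M\<close> with
  structure maps \<open>\<psi>l : M \<rightarrow> X \<otimes> M\<close> and \<open>\<psi>r : M \<rightarrow> M \<otimes> X\<close>.\<close>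

definition hoch_diff ::
  "('k::field \<Rightarrow> 'x::ab_group_add \<Rightarrow> 'x) \<Rightarrow> ('x \<Rightarrow> ('x list, 'k) tensor) \<Rightarrow>
   ('m \<Rightarrow> ('x \<times> 'm, 'k) tensor) \<Rightarrow> ('m \<Rightarrow> ('m \<times> 'x, 'k) tensor) \<Rightarrow> nat \<Rightarrow>
   ('m \<Rightarrow> ('x list, 'k) tensor) \<Rightarrow> ('m \<Rightarrow> ('x list, 'k) tensor)" where
  "hoch_diff sX \<Delta> \<psi>l \<psi>r n \<sigma> = (\<lambda>m.
     id_tensor sX \<sigma> (\<psi>l m)
     + (\<Sum>i = 1..n. tscale ((-1) ^ i) (ins_map sX i \<Delta> (\<sigma> m)))
     + tscale ((-1) ^ (n + 1)) (tensor_id sX \<sigma> (\<psi>r m)))"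

definition self_diff ::
  "('k::field \<Rightarrow> 'x::ab_group_add \<Rightarrow> 'x) \<Rightarrow> ('x \<Rightarrow> ('x list, 'k) tensor) \<Rightarrow> nat \<Rightarrow>
   ('x \<Rightarrow> ('x list, 'k) tensor) \<Rightarrow> ('x \<Rightarrow> ('x list, 'k) tensor)" where
  "self_diff sX \<Delta> = hoch_diff sX \<Delta> (as_pair sX \<circ> \<Delta>) (as_pair sX \<circ> \<Delta>)"

text \<open>The differential of \<open>C\<^sup>*(X, Y)\<close>, with \<open>X\<close> a \<open>Y\<close>-bicomodule via \<open>f : X \<rightarrow> Y\<close>.\<close>

definition morph_diff ::
  "('k::field \<Rightarrow> 'x::ab_group_add \<Rightarrow> 'x) \<Rightarrow> ('x \<Rightarrow> ('x list, 'k) tensor) \<Rightarrow>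
   ('k \<Rightarrow> 'y::ab_group_add \<Rightarrow> 'y) \<Rightarrow> ('y \<Rightarrow> ('y list, 'k) tensor) \<Rightarrow> ('x \<Rightarrow> 'y) \<Rightarrow> nat \<Rightarrow>
   ('x \<Rightarrow> ('y list, 'k) tensor) \<Rightarrow> ('x \<Rightarrow> ('y list, 'k) tensor)" where
  "morph_diff sX \<Delta>X sY \<Delta>Y f =
     hoch_diff sY \<Delta>Y (pair_map sY sX f id \<circ> as_pair sX \<circ> \<Delta>X)
                     (pair_map sX sY id f \<circ> as_pair sX \<circ> \<Delta>X)"

section \<open>The deformation complex of a morphism\<close>

type_synonym ('a, 'b, 'k) cochain =
  "('a \<Rightarrow> ('a list, 'k) tensor) \<times> ('b \<Rightarrow> ('b list, 'k) tensor) \<times> ('a \<Rightarrow> ('b list, 'k) tensor)"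

definition def_cochains ::
  "('k::field \<Rightarrow> 'a::ab_group_add \<Rightarrow> 'a) \<Rightarrow> ('k \<Rightarrow> 'b::ab_group_add \<Rightarrow> 'b) \<Rightarrow> nat \<Rightarrow>
   ('a, 'b, 'k) cochain set" where
  "def_cochains sA sB n = cochains sA sA n \<times> cochains sB sB n \<times> cochains sA sB (n - 1)"

definition def_diff ::
  "('k::field \<Rightarrow> 'a::ab_group_add \<Rightarrow> 'a) \<Rightarrow> ('a \<Rightarrow> ('a list, 'k) tensor) \<Rightarrow>
   ('k \<Rightarrow> 'b::ab_group_add \<Rightarrow> 'b) \<Rightarrow> ('b \<Rightarrow> ('b list, 'k) tensor) \<Rightarrow> ('a \<Rightarrow> 'b) \<Rightarrow> nat \<Rightarrow>
   ('a, 'b, 'k) cochain \<Rightarrow> ('a, 'b, 'k) cochain" where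
  "def_diff sA \<Delta>A sB \<Delta>B f n = (\<lambda>(\<xi>, \<pi>, \<phi>).
     (self_diff sA \<Delta>A n \<xi>,
      self_diff sB \<Delta>B n \<pi>,
      (\<pi> \<circ> f) - (tmaps sB (replicate n f) \<circ> \<xi>) - morph_diff sA \<Delta>A sB \<Delta>B f (n - 1) \<phi>))"

definition def_cocycles ::
  "('k::field \<Rightarrow> 'a::ab_group_add \<Rightarrow> 'a) \<Rightarrow> ('a \<Rightarrow> ('a list, 'k) tensor) \<Rightarrow>
   ('k \<Rightarrow> 'b::ab_group_add \<Rightarrow> 'b) \<Rightarrow> ('b \<Rightarrow> ('b list, 'k) tensor) \<Rightarrow> ('a \<Rightarrow> 'b) \<Rightarrow> nat \<Rightarrow>
   ('a, 'b, 'k) cochain set" where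
  "def_cocycles sA \<Delta>A sB \<Delta>B f n =
     {\<omega> \<in> def_cochains sA sB n. def_diff sA \<Delta>A sB \<Delta>B f n \<omega> = 0}"

text \<open>The complex starts in degree 1.\<close>

definition def_coboundaries ::
  "('k::field \<Rightarrow> 'a::ab_group_add \<Rightarrow> 'a) \<Rightarrow> ('a \<Rightarrow> ('a list, 'k) tensor) \<Rightarrow>
   ('k \<Rightarrow> 'b::ab_group_add \<Rightarrow> 'b) \<Rightarrow> ('b \<Rightarrow> ('b list, 'k) tensor) \<Rightarrow> ('a \<Rightarrow> 'b) \<Rightarrow> nat \<Rightarrow>
   ('a, 'b, 'k) cochain set" where
  "def_coboundaries sA \<Delta>A sB \<Delta>B f n =
     (if n \<le> 1 then {0} else def_diff sA \<Delta>A sB \<Delta>B f (n - 1) ` def_cochains sA sB (n - 1))"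

text \<open>\<open>H\<^sup>n(f)\<close> as the set of cosets of the coboundaries in the cocycles; its zero element is
  the coset of the coboundaries themselves.\<close>

definition def_cohomology ::
  "('k::field \<Rightarrow> 'a::ab_group_add \<Rightarrow> 'a) \<Rightarrow> ('a \<Rightarrow> ('a list, 'k) tensor) \<Rightarrow>
   ('k \<Rightarrow> 'b::ab_group_add \<Rightarrow> 'b) \<Rightarrow> ('b \<Rightarrow> ('b list, 'k) tensor) \<Rightarrow> ('a \<Rightarrow> 'b) \<Rightarrow> nat \<Rightarrow>
   ('a, 'b, 'k) cochain set set" where
  "def_cohomology sA \<Delta>A sB \<Delta>B f n =
     (\<lambda>z. (+) z ` def_coboundaries sA \<Delta>A sB \<Delta>B f n) ` def_cocycles sA \<Delta>A sB \<Delta>B f n"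

section \<open>Deformations\<close>

text \<open>Formal power series are given by their sequences of coefficients.\<close>

definition coalgebra_deformation ::
  "('k::field \<Rightarrow> 'x::ab_group_add \<Rightarrow> 'x) \<Rightarrow> ('x \<Rightarrow> ('x list, 'k) tensor) \<Rightarrow>
   (nat \<Rightarrow> 'x \<Rightarrow> ('x list, 'k) tensor) \<Rightarrow> bool" where
  "coalgebra_deformation sX \<Delta> D \<longleftrightarrow>
     (\<forall>n. D n \<in> Hom_tpow sX sX 2) \<and> D 0 = \<Delta> \<and>
     (\<forall>n. (\<Sum>i\<le>n. ins_map sX 2 (D i) \<circ> D (n - i)) = (\<Sum>i\<le>n. ins_map sX 1 (D i) \<circ> D (n - i)))"

text \<open>In the coefficient \<open>\<omega>\<^sub>n = (\<Delta>\<^sub>A\<^sub>,\<^sub>n; \<Delta>\<^sub>B\<^sub>,\<^sub>n; f\<^sub>n)\<close> the linear map \<open>f\<^sub>n : A \<rightarrow> B\<close> is regarded as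
  an element of \<open>Hom(A, B\<^sup>\<otimes>\<^sup>1)\<close>.\<close>

definition morphism_deformation ::
  "('k::field \<Rightarrow> 'a::ab_group_add \<Rightarrow> 'a) \<Rightarrow> ('a \<Rightarrow> ('a list, 'k) tensor) \<Rightarrow>
   ('k \<Rightarrow> 'b::ab_group_add \<Rightarrow> 'b) \<Rightarrow> ('b \<Rightarrow> ('b list, 'k) tensor) \<Rightarrow> ('a \<Rightarrow> 'b) \<Rightarrow>
   (nat \<Rightarrow> ('a, 'b, 'k) cochain) \<Rightarrow> bool" where
  "morphism_deformation sA \<Delta>A sB \<Delta>B f \<Omega> \<longleftrightarrow>
     (\<forall>n. \<Omega> n \<in> def_cochains sA sB 2) \<and>
     (\<exists>DA DB F.
        (\<forall>n. \<Omega> n = (DA n, DB n, as_tensor sB \<circ> F n)) \<and>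
        coalgebra_deformation sA \<Delta>A DA \<and>
        coalgebra_deformation sB \<Delta>B DB \<and>
        (\<forall>n. Vector_Spaces.linear sA sB (F n)) \<and> F 0 = f \<and>
        (\<forall>n. (\<Sum>i\<le>n. DB i \<circ> F (n - i)) =
             (\<Sum>(i, j, k) \<in> {(i, j, k). i + j + k = n}. tmaps sB [F i, F j] \<circ> DA k)))"

definition integrable ::
  "('k::field \<Rightarrow> 'a::ab_group_add \<Rightarrow> 'a) \<Rightarrow> ('a \<Rightarrow> ('a list, 'k) tensor) \<Rightarrow>
   ('k \<Rightarrow> 'b::ab_group_add \<Rightarrow> 'b) \<Rightarrow> ('b \<Rightarrow> ('b list, 'k) tensor) \<Rightarrow> ('a \<Rightarrow> 'b) \<Rightarrow>
   ('a, 'b, 'k) cochain \<Rightarrow> bool" where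
  "integrable sA \<Delta>A sB \<Delta>B f \<omega> \<longleftrightarrow>
     (\<exists>\<Omega>. morphism_deformation sA \<Delta>A sB \<Delta>B f \<Omega> \<and> \<Omega> 1 = \<omega>)"

end

theory Submission
  imports Defs
begin

text \<open>
  Extend the cocycle coefficient by coefficient.  For power series \<open>D\<close>, \<open>E\<close>, \<open>F\<close> of linear maps
  put \<open>\<Phi>(D) = (D \<otimes> 1) D - (1 \<otimes> D) D\<close> and \<open>\<Psi> = (F \<otimes> F) D - E F\<close>; a deformation is a triple with
  \<open>\<Phi>(D) = \<Phi>(E) = 0\<close> and \<open>\<Psi> = 0\<close>.  In the strict monoidal category of power series of linear maps
  between tensor powers one has the exact identities
  \<open>(1 \<otimes> \<Phi>) D - (D \<otimes> 1 \<otimes> 1) \<Phi> + (1 \<otimes> D \<otimes> 1) \<Phi> - (1 \<otimes> 1 \<otimes> D) \<Phi> + (\<Phi> \<otimes> 1) D = 0\<close> and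
  \<open>\<Phi>(E) F - (F \<otimes> F \<otimes> F) \<Phi>(D) = (F \<otimes> \<Psi>) D - (E \<otimes> 1) \<Psi> + (1 \<otimes> E) \<Psi> - (\<Psi> \<otimes> F) D\<close>.
  If all coefficients of \<open>\<Phi>(D)\<close>, \<open>\<Phi>(E)\<close>, \<open>\<Psi>\<close> below degree \<open>n\<close> vanish, then the degree \<open>n\<close> part of
  these identities says that their \<open>n\<close>-th coefficients form a 3-cocycle.  It is a coboundary, and
  adding a bounding 2-cochain to the \<open>n\<close>-th coefficients of \<open>D\<close>, \<open>E\<close>, \<open>F\<close> makes it vanish.
\<close>

section \<open>The category of tensor powers\<close>

text \<open>The definitions build each tensor map by its own \<open>tlift\<close>, so
  coassociativity, the differentials and the morphism equation share no common form. All are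
  rewritten with two operations on multilinear functions of lists, composition and juxtaposition.
  Factors are juxtaposed by appending lists, so no associators occur, and the identities follow from
  associativity, units and the interchange law alone. Lifting these laws to coefficient sequences
  first confines the index combinatorics to a few lemmas on finite sums. Each term of the two
  identities has exactly one curvature factor. In the lowest degree where a curvature can be
  nonzero, every other factor therefore enters through its constant coefficient, that is, through
  the undeformed structure, and what is left is the differential. The signs of the curvatures make
  their linearisation equal to minus the differential in all three components, so a bounding cochain
  is added with coefficient 1 and nothing is divided.\<close>

lemma subspace_tpow:
  fixes sX :: "'k::field \<Rightarrow> 'x::ab_group_add \<Rightarrow> 'x"
  shows "module.subspace tscale (tpow sX n)"
proof -
  interpret vector_space "tscale :: 'k \<Rightarrow> ('x list, 'k) tensor \<Rightarrow> _" by (rule vector_space_tscale)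
  show ?thesis unfolding tpow_def by (rule subspace_span)
qed

lemma tpow_closed:
  fixes sX :: "'k::field \<Rightarrow> 'x::ab_group_add \<Rightarrow> 'x"
  shows tpow_0 [simp]: "0 \<in> tpow sX n"
    and tpow_add: "s \<in> tpow sX n \<Longrightarrow> t \<in> tpow sX n \<Longrightarrow> s + t \<in> tpow sX n"
    and tpow_scale: "t \<in> tpow sX n \<Longrightarrow> tscale c t \<in> tpow sX n"
proof -
  interpret vector_space "tscale :: 'k \<Rightarrow> ('x list, 'k) tensor \<Rightarrow> _" by (rule vector_space_tscale)
  show "0 \<in> tpow sX n" "s \<in> tpow sX n \<Longrightarrow> t \<in> tpow sX n \<Longrightarrow> s + t \<in> tpow sX n"
    "t \<in> tpow sX n \<Longrightarrow> tscale c t \<in> tpow sX n"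
    using subspace_tpow[of sX n] by (auto simp: subspace_def)
qed

lemma tscale_minus_one: "tscale (-1) t = - t"
  by (simp add: tscale_def fun_eq_iff)

lemma tpure_in_tpow:
  fixes sX :: "'k::field \<Rightarrow> 'x::ab_group_add \<Rightarrow> 'x"
  shows "length w = n \<Longrightarrow> tpure sX w \<in> tpow sX n"
proof -
  interpret vector_space "tscale :: 'k \<Rightarrow> ('x list, 'k) tensor \<Rightarrow> _" by (rule vector_space_tscale)
  show "length w = n \<Longrightarrow> ?thesis" unfolding tpow_def by (auto intro: span_base)
qed

text \<open>Span induction in which \<open>add\<close> and \<open>scale\<close> also receive
  membership: some maps below are additive only on genuine tensors.\<close>

lemma tpow_induct [consumes 1, case_names zero pure add scale]:
  fixes sX :: "'k::field \<Rightarrow> 'x::ab_group_add \<Rightarrow> 'x"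
  assumes "t \<in> tpow sX n" and "P 0" and pure: "\<And>w. length w = n \<Longrightarrow> P (tpure sX w)"
    and add: "\<And>s t. s \<in> tpow sX n \<Longrightarrow> t \<in> tpow sX n \<Longrightarrow> P s \<Longrightarrow> P t \<Longrightarrow> P (s + t)"
    and scale: "\<And>c t. t \<in> tpow sX n \<Longrightarrow> P t \<Longrightarrow> P (tscale c t)"
  shows "P t"
proof -
  interpret vector_space "tscale :: 'k \<Rightarrow> ('x list, 'k) tensor \<Rightarrow> _" by (rule vector_space_tscale)
  have "t \<in> tpow sX n \<and> P t"
    using assms(1) unfolding tpow_def
  proof (induction rule: span_induct_alt)
    case base
    (* The induction method eta-expands tensors; zero_fun_apply would then rewrite 0 to a lambda term. *)
    show ?case using assms(2) by (simp add: span_zero del: zero_fun_apply)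
  next
    case (step c x y)
    then show ?case using pure add scale
      by (auto simp: tpow_def[symmetric] tpure_in_tpow tpow_add tpow_scale simp del: plus_fun_apply)
  qed
  then show ?thesis by blast
qed

section \<open>Linearity of \<open>tlift\<close> in both arguments\<close>

lemma linearD:
  assumes "Vector_Spaces.linear s1 s2 f"
  shows linear_addD: "f (x + y) = f x + f y" and linear_scaleD: "f (s1 c x) = s2 c (f x)"
    and linear_zeroD: "f 0 = 0"
  using assms apply (auto simp: Vector_Spaces.linear_iff)
  by (metis add_cancel_right_right)

lemmas tlift_add = linear_addD[OF linear_tlift]
lemmas tlift_scale = linear_scaleD[OF linear_tlift]
lemmas tlift_zero = linear_zeroD[OF linear_tlift]

lemma linear_plus:
  "Vector_Spaces.linear s1 tscale f \<Longrightarrow> Vector_Spaces.linear s1 tscale g \<Longrightarrow>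
    Vector_Spaces.linear s1 tscale (\<lambda>x. f x + g x)"
  by (auto simp: Vector_Spaces.linear_iff tscale_def fun_eq_iff algebra_simps)

lemma linear_smult:
  "Vector_Spaces.linear s1 tscale f \<Longrightarrow> Vector_Spaces.linear s1 tscale (\<lambda>x. tscale c (f x))"
  by (auto simp: Vector_Spaces.linear_iff tscale_def fun_eq_iff algebra_simps)

lemma linear_zero_map: "vector_space s1 \<Longrightarrow> Vector_Spaces.linear s1 tscale (\<lambda>x. 0)"
  by (auto simp: Vector_Spaces.linear_iff vector_space_tscale tscale_def fun_eq_iff)

lemma multilinear_plus:
  "multilinear sX tscale n g \<Longrightarrow> multilinear sX tscale n h \<Longrightarrow> multilinear sX tscale n (\<lambda>w. g w + h w)"
  unfolding multilinear_def by (auto intro: linear_plus)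

lemma multilinear_smult:
  "multilinear sX tscale n g \<Longrightarrow> multilinear sX tscale n (\<lambda>w. tscale c (g w))"
  unfolding multilinear_def by (auto intro: linear_smult)

lemma multilinear_zero: "vector_space sX \<Longrightarrow> multilinear sX tscale n (\<lambda>w. 0)"
  unfolding multilinear_def by (auto intro: linear_zero_map)

lemma tlift_tpure_length:
  "multilinear sX tscale n g \<Longrightarrow> length w = n \<Longrightarrow> tlift g (tpure sX w) = g w"
  by (auto intro: tlift_tpure)

text \<open>\<open>tlift\<close> is linear in the tensor by definition, but in \<open>g\<close> it
  behaves as the tensor does on functionals, and a member of \<open>tpow\<close> need be additive
  only on multilinear ones. Hence the reduction to pure tensors.\<close>

lemma tlift_plus_left:
  assumes "multilinear sX tscale n g" "multilinear sX tscale n h" "t \<in> tpow sX n"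
  shows "tlift (\<lambda>w. g w + h w) t = tlift g t + tlift h t"
  by (rule tpow_unique[OF linear_tlift linear_plus[OF linear_tlift linear_tlift] _ assms(3)])
    (simp add: tlift_tpure_length[OF assms(1)] tlift_tpure_length[OF assms(2)]
      tlift_tpure_length[OF multilinear_plus[OF assms(1,2)]])

lemma tlift_smult_left:
  assumes "multilinear sX tscale n g" "t \<in> tpow sX n"
  shows "tlift (\<lambda>w. tscale c (g w)) t = tscale c (tlift g t)"
  by (rule tpow_unique[OF linear_tlift linear_smult[OF linear_tlift] _ assms(2)])
    (simp add: tlift_tpure_length[OF assms(1)] tlift_tpure_length[OF multilinear_smult[OF assms(1)]])

lemma tlift_zero_left:
  assumes "vector_space sX" "t \<in> tpow sX n"
  shows "tlift (\<lambda>w. 0) t = 0"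
  by (rule tpow_unique[OF linear_tlift linear_zero_map[OF vector_space_tscale] _ assms(2)])
    (simp add: tlift_tpure_length[OF multilinear_zero[OF assms(1)]])

lemma tlift_in_tpow:
  assumes "multilinear sX tscale n g" "\<And>w. length w = n \<Longrightarrow> g w \<in> tpow sY p" "t \<in> tpow sX n"
  shows "tlift g t \<in> tpow sY p"
  using assms(3)
  by (induction rule: tpow_induct)
    (simp_all add: tlift_zero tlift_tpure_length[OF assms(1)] assms(2) tlift_add tlift_scale tpow_closed
      del: zero_fun_apply plus_fun_apply)

subsection \<open>Concatenation of tensors\<close>

text \<open>The product of a tensor of degree \<open>m\<close> and one of degree \<open>n\<close> in
  degree \<open>m + n\<close>. List lengths carry the degrees. Linearity in \<open>s\<close> is
  immediate; in \<open>t\<close> it is available only on genuine tensors.\<close>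

definition tcat ::
  "('k::field \<Rightarrow> 'x::ab_group_add \<Rightarrow> 'x) \<Rightarrow> ('x list, 'k) tensor \<Rightarrow> ('x list, 'k) tensor \<Rightarrow>
   ('x list, 'k) tensor" where
  "tcat sX s t = tlift (\<lambda>u. tlift (\<lambda>v. tpure sX (u @ v)) t) s"

lemma multilinear_append_right:
  "vector_space sX \<Longrightarrow> multilinear sX tscale n (\<lambda>v. tpure sX (u @ v))"
  using multilinear_ctx[of sX n u "[]"] by simp

lemma multilinear_append_left:
  fixes sX :: "'k::field \<Rightarrow> 'x::ab_group_add \<Rightarrow> 'x"
  assumes X: "vector_space sX" and t: "t \<in> tpow sX n"
  shows "multilinear sX tscale m (\<lambda>u. tlift (\<lambda>v. tpure sX (u @ v)) t)"
  unfolding multilinear_def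
proof (intro allI impI linear_param[OF X t])
  fix u v :: "'x list"
  show "multilinear sX tscale n (\<lambda>va. tpure sX ((u @ x # v) @ va))" for x
    by (rule multilinear_append_right[OF X])
  show "Vector_Spaces.linear sX tscale (\<lambda>x. tpure sX ((u @ x # v) @ w))" for w
    using linear_ctx[OF X refl linear_id'[OF X], of u "v @ w"] by simp
qed

lemma linear_tcat_left: "Vector_Spaces.linear tscale tscale (\<lambda>s. tcat sX s t)"
  unfolding tcat_def by (rule linear_tlift)

lemmas tcat_add_left = linear_addD[OF linear_tcat_left]
lemmas tcat_zero_left = linear_zeroD[OF linear_tcat_left]

lemma tcat_add_right:
  assumes "vector_space sX" "s \<in> tpow sX m" "t \<in> tpow sX n" "t' \<in> tpow sX n"
  shows "tcat sX s (t + t') = tcat sX s t + tcat sX s t'"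
  unfolding tcat_def tlift_add
  by (rule tlift_plus_left[OF multilinear_append_left[OF assms(1,3)] multilinear_append_left[OF assms(1,4)] assms(2)])

lemma tcat_scale_right:
  assumes "vector_space sX" "s \<in> tpow sX m" "t \<in> tpow sX n"
  shows "tcat sX s (tscale c t) = tscale c (tcat sX s t)"
  unfolding tcat_def tlift_scale
  by (rule tlift_smult_left[OF multilinear_append_left[OF assms(1,3)] assms(2)])

lemma tcat_zero_right:
  assumes "vector_space sX" "s \<in> tpow sX m"
  shows "tcat sX s 0 = 0"
  unfolding tcat_def tlift_zero by (rule tlift_zero_left[OF assms])

lemma tcat_tpure_left: 
  assumes "vector_space sX" "t \<in> tpow sX n"
  shows "tcat sX (tpure sX u) t = tlift (\<lambda>v. tpure sX (u @ v)) t"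
  unfolding tcat_def by (rule tlift_tpure_length[OF multilinear_append_left[OF assms] refl])

lemma tcat_tpure:
  assumes "vector_space sX"
  shows "tcat sX (tpure sX u) (tpure sX v) = tpure sX (u @ v)"
  by (simp add: tcat_tpure_left[OF assms tpure_in_tpow[OF refl]]
    tlift_tpure_length[OF multilinear_append_right[OF assms] refl])

lemma tcat_in_tpow:
  assumes "vector_space sX" "s \<in> tpow sX m" "t \<in> tpow sX n"
  shows "tcat sX s t \<in> tpow sX (m + n)"
  unfolding tcat_def
  by (intro tlift_in_tpow[OF multilinear_append_left[OF assms(1,3)] _ assms(2)]
    tlift_in_tpow[OF multilinear_append_right[OF assms(1)] _ assms(3)] tpure_in_tpow) simp

text \<open>On pure tensors this is associativity of \<open>@\<close>; the arguments are reduced to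
  pure tensors one at a time, from left to right.\<close>

lemma tcat_assoc:
  assumes X: "vector_space sX" and s: "s \<in> tpow sX m" and t: "t \<in> tpow sX n" and r: "r \<in> tpow sX p"
  shows "tcat sX (tcat sX s t) r = tcat sX s (tcat sX t r)"
proof (rule tpow_unique[OF linear_comp[OF linear_tcat_left linear_tcat_left] linear_tcat_left _ s])
  fix w :: "'b list"
  let ?L = "\<lambda>w. tlift (\<lambda>v. tpure sX (w @ v))"
  have L: "tcat sX (tpure sX w) q = ?L w q" if "q \<in> tpow sX k" for w q k
    using tcat_tpure_left[OF X that] .
  have pure: "?L w (tpure sX v) = tpure sX (w @ v)" for w v
    by (rule tlift_tpure_length[OF multilinear_append_right[OF X] refl])
  have "tcat sX (?L w t) r = ?L w (tcat sX t r)"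
  proof (rule tpow_unique[OF linear_comp[OF linear_tlift linear_tcat_left] linear_comp[OF linear_tcat_left linear_tlift] _ t])
    fix v
    have "?L (w @ v) r = ?L w (?L v r)"
      by (rule tpow_unique[OF linear_tlift linear_comp[OF linear_tlift linear_tlift] _ r])
        (simp add: pure pure[of "w @ v", simplified])
    then show "tcat sX (?L w (tpure sX v)) r = ?L w (tcat sX (tpure sX v) r)"
      by (simp add: pure L[OF r])
  qed
  then show "tcat sX (tcat sX (tpure sX w) t) r = tcat sX (tpure sX w) (tcat sX t r)"
    by (simp add: L[OF t] L[OF tcat_in_tpow[OF X t r]])
qed

subsection \<open>Morphisms between tensor powers\<close>

text \<open>A linear map \<open>X\<^sup>\<otimes>\<^sup>m \<rightarrow> Y\<^sup>\<otimes>\<^sup>n\<close> is encoded by the corresponding multilinear function on lists of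
  length \<open>m\<close>; requiring the value 0 on all other lists makes equality of morphisms extensional.\<close>

definition mhom ::
  "('k::field \<Rightarrow> 'x::ab_group_add \<Rightarrow> 'x) \<Rightarrow> nat \<Rightarrow> ('k \<Rightarrow> 'y::ab_group_add \<Rightarrow> 'y) \<Rightarrow> nat \<Rightarrow>
   ('x list \<Rightarrow> ('y list, 'k) tensor) set" where
  "mhom sX m sY n = {g. vector_space sX \<and> vector_space sY \<and> multilinear sX tscale m g \<and>
     (\<forall>w. g w \<in> tpow sY n) \<and> (\<forall>w. length w \<noteq> m \<longrightarrow> g w = 0)}"

definition mcomp ::
  "('y list \<Rightarrow> ('z list, 'k::field) tensor) \<Rightarrow> ('x list \<Rightarrow> ('y list, 'k) tensor) \<Rightarrow>
   ('x list \<Rightarrow> ('z list, 'k) tensor)" where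
  "mcomp g h = (\<lambda>w. tlift g (h w))"

text \<open>\<open>mpar sY m g h\<close> is \<open>g \<otimes> h\<close>, where \<open>g\<close> consumes the first \<open>m\<close> tensor factors.\<close>

definition mpar ::
  "('k::field \<Rightarrow> 'y::ab_group_add \<Rightarrow> 'y) \<Rightarrow> nat \<Rightarrow> ('x list \<Rightarrow> ('y list, 'k) tensor) \<Rightarrow>
   ('x list \<Rightarrow> ('y list, 'k) tensor) \<Rightarrow> ('x list \<Rightarrow> ('y list, 'k) tensor)" where
  "mpar sY m g h = (\<lambda>w. tcat sY (g (take m w)) (h (drop m w)))"

definition mid ::
  "('k::field \<Rightarrow> 'x::ab_group_add \<Rightarrow> 'x) \<Rightarrow> nat \<Rightarrow> 'x list \<Rightarrow> ('x list, 'k) tensor" where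
  "mid sX m = (\<lambda>w. if length w = m then tpure sX w else 0)"

lemma mhomD:
  assumes "g \<in> mhom sX m sY n"
  shows "vector_space sX" "vector_space sY" "multilinear sX tscale m g" "g w \<in> tpow sY n"
    "length w \<noteq> m \<Longrightarrow> g w = 0"
  using assms by (auto simp: mhom_def)

lemma multilinear_cong:
  "(\<And>w. length w = n \<Longrightarrow> g w = h w) \<Longrightarrow> multilinear sX sY n g = multilinear sX sY n h"
  by (simp add: multilinear_def)

lemma mhom_add: "g \<in> mhom sX m sY n \<Longrightarrow> h \<in> mhom sX m sY n \<Longrightarrow> g + h \<in> mhom sX m sY n"
  by (auto simp: mhom_def tpow_add plus_fun_def[of g h] multilinear_plus)

lemma mhom_zero:
  fixes sX :: "'k::field \<Rightarrow> 'x::ab_group_add \<Rightarrow> 'x" and sY :: "'k \<Rightarrow> 'y::ab_group_add \<Rightarrow> 'y"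
  shows "vector_space sX \<Longrightarrow> vector_space sY \<Longrightarrow> 0 \<in> mhom sX m sY n"
  using multilinear_zero[of sX m]
  by (simp add: mhom_def zero_fun_def[where 'a="'x list" and 'b="('y list, 'k) tensor"])

lemma mhom_uminus: "g \<in> mhom sX m sY n \<Longrightarrow> - g \<in> mhom sX m sY n"
  using multilinear_smult[of sX m g "-1"] tpow_scale[of _ sY n "-1"]
  by (auto simp: mhom_def tscale_minus_one fun_Compl_def[of g])

lemma mhom_diff: "g \<in> mhom sX m sY n \<Longrightarrow> h \<in> mhom sX m sY n \<Longrightarrow> g - h \<in> mhom sX m sY n"
  using mhom_add[OF _ mhom_uminus, of g sX m sY n h] by simp

lemma mhom_sum:
  assumes "vector_space sX" "vector_space sY" "\<And>i. i \<in> I \<Longrightarrow> g i \<in> mhom sX m sY n"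
  shows "sum g I \<in> mhom sX m sY n"
  using assms(3) by (induction I rule: infinite_finite_induct) (auto simp: mhom_zero assms(1,2) mhom_add)

lemma mid_mhom: "vector_space sX \<Longrightarrow> mid sX m \<in> mhom sX m sX m"
  using multilinear_tpure[of sX m]
  by (auto simp: mhom_def mid_def tpure_in_tpow cong: multilinear_cong)

lemma linear_tlift_comp:
  "multilinear sX tscale m g \<Longrightarrow> multilinear sX tscale m (\<lambda>w. tlift h (g w))"
  by (auto simp: multilinear_def intro: linear_comp[OF _ linear_tlift])

lemma mcomp_mhom:
  assumes "g \<in> mhom sY n sZ p" "h \<in> mhom sX m sY n"
  shows "mcomp g h \<in> mhom sX m sZ p"
  unfolding mhom_def mcomp_def
  using mhomD[OF assms(1)] mhomD[OF assms(2)]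
  by (auto intro!: linear_tlift_comp tlift_in_tpow[where n = n and sX = sY] simp: tlift_zero)

text \<open>The totals \<open>N\<close> and \<open>P\<close> are variables with equations, so that
  numerals such as 3 and 4 match without first being written as sums.\<close>

lemma mpar_mhom:
  fixes sX :: "'k::field \<Rightarrow> 'x::ab_group_add \<Rightarrow> 'x" and sY :: "'k \<Rightarrow> 'y::ab_group_add \<Rightarrow> 'y"
  assumes g: "g \<in> mhom sX m sY p" and h: "h \<in> mhom sX n sY q" and N: "N = m + n" "P = p + q"
  shows "mpar sY m g h \<in> mhom sX N sY P"
proof -
  note gD = mhomD[OF g] and hD = mhomD[OF h]
  note Y = gD(2)
  have "multilinear sX tscale N (mpar sY m g h)"
    unfolding multilinear_def
  proof (intro allI impI)
    fix u v :: "'x list" assume l: "length u + 1 + length v = N"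
    show "Vector_Spaces.linear sX tscale (\<lambda>x. mpar sY m g h (u @ x # v))"
    \<comment> \<open>The varying entry lies either among the \<open>m\<close> inputs of
      \<open>g\<close> or among those of \<open>h\<close>; the other factor is then
      constant.\<close>
    proof (cases "length u < m")
      case True
      let ?j = "m - length u - 1"
      have e: "take m (u @ x # v) = u @ x # take ?j v" "drop m (u @ x # v) = drop ?j v" for x
        using True by (auto simp: take_Cons' drop_Cons')
      have "Vector_Spaces.linear sX tscale (\<lambda>x. g (u @ x # take ?j v))"
        using gD(3) True l N by (auto simp: multilinear_def)
      then show ?thesis unfolding mpar_def e by (rule linear_comp[OF _ linear_tcat_left])
    next
      case False
      have e: "take m (u @ x # v) = take m u" "drop m (u @ x # v) = drop m u @ x # v" for x
        using False by auto
      have "Vector_Spaces.linear sX tscale (\<lambda>x. h (drop m u @ x # v))"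
        using hD(3) False l N by (auto simp: multilinear_def)
      then show ?thesis unfolding mpar_def e
        by (auto simp: Vector_Spaces.linear_iff tcat_add_right[OF Y gD(4) hD(4) hD(4)] tcat_scale_right[OF Y gD(4) hD(4)])
    qed
  qed
  \<comment> \<open>A word of wrong total length has a block of wrong length, whose factor is 0 by
    the convention in \<open>mhom\<close>.\<close>
  moreover have "mpar sY m g h w = 0" if "length w \<noteq> N" for w
  proof (cases "length w < m")
    case True
    then show ?thesis using gD(5)[of "take m w"] by (simp add: mpar_def tcat_zero_left)
  next
    case False
    then have "h (drop m w) = 0" using that N by (intro hD(5)) auto
    then show ?thesis by (simp add: mpar_def tcat_zero_right[OF Y gD(4)])
  qed
  ultimately show ?thesis
    using gD hD tcat_in_tpow[OF Y gD(4) hD(4)] by (auto simp: mhom_def mpar_def N)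
qed

lemma mcomp_add_left:
  assumes "g \<in> mhom sY n sZ p" "g' \<in> mhom sY n sZ p" "h \<in> mhom sX m sY n"
  shows "mcomp (g + g') h = mcomp g h + mcomp g' h"
  using tlift_plus_left[OF mhomD(3)[OF assms(1)] mhomD(3)[OF assms(2)] mhomD(4)[OF assms(3)]]
  by (auto simp: mcomp_def fun_eq_iff plus_fun_def[of g g'])

lemma mcomp_zero_left:
  assumes "h \<in> mhom sX m sY n"
  shows "mcomp 0 h = 0"
  using tlift_zero_left[OF mhomD(2)[OF assms] mhomD(4)[OF assms]]
  by (auto simp: mcomp_def fun_eq_iff zero_fun_def[where 'a="'b list"])

lemma mcomp_add_right: "mcomp g (h + h') = mcomp g h + mcomp g h'"
  by (simp add: mcomp_def tlift_add fun_eq_iff)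

lemma mcomp_zero_right: "mcomp g 0 = 0"
  by (simp add: mcomp_def tlift_zero fun_eq_iff)

text \<open>\<open>tlift\<close> precomposes functionals, so both sides unfold to the same term, for
  arbitrary functions.\<close>

lemma mcomp_assoc: "mcomp (mcomp g h) k = mcomp g (mcomp h k)"
  by (simp add: mcomp_def tlift_def fun_eq_iff)

lemma mcomp_mid_left:
  assumes "h \<in> mhom sX m sY n"
  shows "mcomp (mid sY n) h = h"
proof
  fix w
  note Y = mhomD(2)[OF assms]
  have "tlift (mid sY n) t = t" if "t \<in> tpow sY n" for t
    by (rule tpow_unique[OF linear_tlift linear_id'[OF vector_space_tscale] _ that])
      (simp add: tlift_tpure_length[OF mhomD(3)[OF mid_mhom[OF Y]]], simp add: mid_def)
  then show "mcomp (mid sY n) h w = h w"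
    using mhomD(4)[OF assms] by (simp add: mcomp_def)
qed

lemma mcomp_mid_right:
  assumes "g \<in> mhom sX m sY n"
  shows "mcomp g (mid sX m) = g"
  using mhomD(5)[OF assms] tlift_tpure_length[OF mhomD(3)[OF assms]]
  by (auto simp: mcomp_def mid_def fun_eq_iff tlift_zero)

lemma mpar_add_left: "mpar sY m (g + g') h = mpar sY m g h + mpar sY m g' h"
  by (simp add: mpar_def fun_eq_iff tcat_add_left)

lemma mpar_zero_left: "mpar sY m 0 h = 0"
  by (simp add: mpar_def fun_eq_iff tcat_zero_left)

lemma mpar_add_right:
  assumes "g \<in> mhom sX m sY p" "h \<in> mhom sX n sY q" "h' \<in> mhom sX n sY q"
  shows "mpar sY m g (h + h') = mpar sY m g h + mpar sY m g h'"
  using tcat_add_right[OF mhomD(2)[OF assms(1)] mhomD(4)[OF assms(1)] mhomD(4)[OF assms(2)] mhomD(4)[OF assms(3)]]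
  by (simp add: mpar_def fun_eq_iff)

lemma mpar_zero_right:
  assumes "g \<in> mhom sX m sY p"
  shows "mpar sY m g 0 = 0"
  using tcat_zero_right[OF mhomD(2)[OF assms(1)] mhomD(4)[OF assms(1)]]
  by (simp add: mpar_def fun_eq_iff)

lemma mpar_mid:
  assumes "vector_space sX"
  shows "mpar sX m (mid sX m) (mid sX n) = mid sX (m + n)"
proof
  fix w :: "'b list"
  show "mpar sX m (mid sX m) (mid sX n) w = mid sX (m + n) w"
    using mhomD(5)[OF mpar_mhom[OF mid_mhom[OF assms] mid_mhom[OF assms] refl refl], of w m n]
    by (cases "length w = m + n") (auto simp: mid_def mpar_def tcat_tpure[OF assms])
qed

lemma mpar_assoc:
  fixes sX :: "'k::field \<Rightarrow> 'x::ab_group_add \<Rightarrow> 'x"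
  assumes "g \<in> mhom sX m sY p" "h \<in> mhom sX n sY q" "k \<in> mhom sX l sY r"
  shows "mpar sY (m + n) (mpar sY m g h) k = mpar sY m g (mpar sY n h k)"
proof
  fix w :: "'x list"
  have "take m (take (m + n) w) = take m w" "drop m (take (m + n) w) = take n (drop m w)"
    "drop n (drop m w) = drop (m + n) w"
    by (simp_all add: drop_take add.commute)
  then show "mpar sY (m + n) (mpar sY m g h) k w = mpar sY m g (mpar sY n h k) w"
    unfolding mpar_def
    using tcat_assoc[OF mhomD(2)[OF assms(1)] mhomD(4)[OF assms(1)] mhomD(4)[OF assms(2)] mhomD(4)[OF assms(3)]]
    by metis
qed

text \<open>The interchange law on tensors. Uniqueness reduces the left argument to pure tensors;
  the right one needs span induction, because \<open>tcat\<close> is linear there only on members of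
  \<open>tpow\<close>.\<close>

lemma tlift_mpar_tcat:
  fixes sX :: "'k::field \<Rightarrow> 'x::ab_group_add \<Rightarrow> 'x"
  assumes g: "g \<in> mhom sX m sY p" and h: "h \<in> mhom sX n sY q"
    and s: "s \<in> tpow sX m" and r: "r \<in> tpow sX n"
  shows "tlift (mpar sY m g h) (tcat sX s r) = tcat sY (tlift g s) (tlift h r)"
proof (rule tpow_unique[OF linear_comp[OF linear_tcat_left linear_tlift] linear_comp[OF linear_tlift linear_tcat_left] _ s])
  fix w :: "'x list" assume w: "length w = m"
  note X = mhomD(1)[OF g] and Y = mhomD(2)[OF g]
  note gh = mpar_mhom[OF g h refl refl]
  have h': "tlift h r \<in> tpow sY q" if "r \<in> tpow sX n" for r
    by (rule tlift_in_tpow[OF mhomD(3)[OF h] mhomD(4)[OF h] that])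
  have "tlift (mpar sY m g h) (tlift (\<lambda>v. tpure sX (w @ v)) r) = tcat sY (g w) (tlift h r)"
    using r
  proof (induction rule: tpow_induct)
    case (pure v)
    then show ?case
      using tlift_tpure_length[OF mhomD(3)[OF gh], of "w @ v"] w tlift_tpure_length[OF mhomD(3)[OF h], of v]
      by (simp add: tlift_tpure_length[OF multilinear_append_right[OF X] refl] mpar_def)
  qed (simp_all add: tlift_zero tlift_add tlift_scale tcat_zero_right[OF Y mhomD(4)[OF g]]
      tcat_add_right[OF Y mhomD(4)[OF g] h' h'] tcat_scale_right[OF Y mhomD(4)[OF g] h']
      del: zero_fun_apply plus_fun_apply)
  then show "tlift (mpar sY m g h) (tcat sX (tpure sX w) r) = tcat sY (tlift g (tpure sX w)) (tlift h r)"
    by (simp add: tcat_tpure_left[OF X r] tlift_tpure_length[OF mhomD(3)[OF g] w])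
qed

lemma mpar_interchange:
  assumes "g \<in> mhom sY m sZ p" "h \<in> mhom sY n sZ q" "g' \<in> mhom sX k sY m" "h' \<in> mhom sX l sY n"
  shows "mcomp (mpar sZ m g h) (mpar sY k g' h') = mpar sZ k (mcomp g g') (mcomp h h')"
  using tlift_mpar_tcat[OF assms(1,2) mhomD(4)[OF assms(3)] mhomD(4)[OF assms(4)]]
  by (simp add: mcomp_def mpar_def fun_eq_iff)

section \<open>Power series of morphisms\<close>

definition chom ::
  "('k::field \<Rightarrow> 'x::ab_group_add \<Rightarrow> 'x) \<Rightarrow> nat \<Rightarrow> ('k \<Rightarrow> 'y::ab_group_add \<Rightarrow> 'y) \<Rightarrow> nat \<Rightarrow>
   (nat \<Rightarrow> 'x list \<Rightarrow> ('y list, 'k) tensor) set" where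
  "chom sX m sY n = {S. \<forall>i. S i \<in> mhom sX m sY n}"

text \<open>Sequences are coefficient sequences of power series in \<open>t\<close>, and \<open>ccomp\<close>, \<open>cpar\<close>, \<open>cid\<close> are
  the \<open>t\<close>-bilinear extensions of \<open>mcomp\<close>, \<open>mpar\<close>, \<open>mid\<close>.\<close>

definition ccomp ::
  "(nat \<Rightarrow> 'y list \<Rightarrow> ('z list, 'k::field) tensor) \<Rightarrow> (nat \<Rightarrow> 'x list \<Rightarrow> ('y list, 'k) tensor) \<Rightarrow>
   (nat \<Rightarrow> 'x list \<Rightarrow> ('z list, 'k) tensor)" where
  "ccomp S T = (\<lambda>n. \<Sum>i\<le>n. mcomp (S i) (T (n - i)))"

definition cpar ::
  "('k::field \<Rightarrow> 'y::ab_group_add \<Rightarrow> 'y) \<Rightarrow> nat \<Rightarrow> (nat \<Rightarrow> 'x list \<Rightarrow> ('y list, 'k) tensor) \<Rightarrow>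
   (nat \<Rightarrow> 'x list \<Rightarrow> ('y list, 'k) tensor) \<Rightarrow> (nat \<Rightarrow> 'x list \<Rightarrow> ('y list, 'k) tensor)" where
  "cpar sY m S T = (\<lambda>n. \<Sum>i\<le>n. mpar sY m (S i) (T (n - i)))"

definition cid ::
  "('k::field \<Rightarrow> 'x::ab_group_add \<Rightarrow> 'x) \<Rightarrow> nat \<Rightarrow> nat \<Rightarrow> 'x list \<Rightarrow> ('x list, 'k) tensor" where
  "cid sX m = (\<lambda>n. if n = 0 then mid sX m else 0)"

lemma chomD: "S \<in> chom sX m sY n \<Longrightarrow> S i \<in> mhom sX m sY n"
  by (simp add: chom_def)

lemma mcomp_sum_left:
  assumes "\<And>i. i \<in> I \<Longrightarrow> g i \<in> mhom sY n sZ p" and h: "h \<in> mhom sX m sY n"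
  shows "mcomp (sum g I) h = (\<Sum>i\<in>I. mcomp (g i) h)"
  using assms(1)
proof (induction I rule: infinite_finite_induct)
  case (insert x F)
  then have "sum g F \<in> mhom sY n sZ p"
    using mhomD(1,2)[of "g x" sY n sZ p] by (intro mhom_sum) auto
  then show ?case using insert mcomp_add_left[OF _ _ h, of "g x" sZ p "sum g F"] by (simp del: plus_fun_apply)
qed (simp_all add: mcomp_zero_left[OF h] del: zero_fun_apply)

lemma mcomp_sum_right: "mcomp g (sum h I) = (\<Sum>i\<in>I. mcomp g (h i))"
  by (induction I rule: infinite_finite_induct)
    (simp_all add: mcomp_zero_right mcomp_add_right del: plus_fun_apply zero_fun_apply)

lemma mpar_sum_left: "mpar sY m (sum g I) h = (\<Sum>i\<in>I. mpar sY m (g i) h)"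
  by (induction I rule: infinite_finite_induct)
    (simp_all add: mpar_zero_left mpar_add_left del: plus_fun_apply zero_fun_apply)

lemma mpar_sum_right:
  assumes "\<And>i. i \<in> I \<Longrightarrow> h i \<in> mhom sX n sY q" and g: "g \<in> mhom sX m sY p"
  shows "mpar sY m g (sum h I) = (\<Sum>i\<in>I. mpar sY m g (h i))"
  using assms(1)
proof (induction I rule: infinite_finite_induct)
  case (insert x F)
  then have "sum h F \<in> mhom sX n sY q"
    using mhomD(1,2)[of "h x" sX n sY q] by (intro mhom_sum) auto
  then show ?case using insert mpar_add_right[OF g, of "h x" n q "sum h F"] by (simp del: plus_fun_apply)
qed (simp_all add: mpar_zero_right[OF g] del: zero_fun_apply)

lemma ccomp_chom:
  assumes "S \<in> chom sY n sZ p" "T \<in> chom sX m sY n"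
  shows "ccomp S T \<in> chom sX m sZ p"
  using assms mhomD(1,2)[OF chomD[OF assms(1)]] mhomD(1,2)[OF chomD[OF assms(2)]]
  by (auto simp: chom_def ccomp_def intro!: mhom_sum mcomp_mhom)

lemma cpar_chom:
  assumes "S \<in> chom sX m sY p" "T \<in> chom sX n sY q" "N = m + n" "P = p + q"
  shows "cpar sY m S T \<in> chom sX N sY P"
  using assms mhomD(1,2)[OF chomD[OF assms(1)]]
  by (auto simp: chom_def cpar_def intro!: mhom_sum mpar_mhom)

lemma cid_chom: "vector_space sX \<Longrightarrow> cid sX m \<in> chom sX m sX m"
  by (simp add: chom_def cid_def mid_mhom mhom_zero)

lemma chom_diff: "S \<in> chom sX m sY n \<Longrightarrow> T \<in> chom sX m sY n \<Longrightarrow> S - T \<in> chom sX m sY n"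
  by (simp add: chom_def mhom_diff)

text \<open>Both sides enumerate the triples of total \<open>n\<close>; \<open>p\<close> is the sum
  of the first two entries.\<close>

lemma sum_antidiagonal_assoc:
  fixes G :: "nat \<Rightarrow> nat \<Rightarrow> nat \<Rightarrow> 'c::comm_monoid_add"
  shows "(\<Sum>p\<le>n. \<Sum>i\<le>p. G i (p - i) (n - p)) = (\<Sum>i\<le>n. \<Sum>j\<le>n - i. G i j (n - i - j))"
  unfolding sum.Sigma[OF finite_atMost ballI[OF finite_atMost]]
  by (rule sum.reindex_bij_witness[where i = "\<lambda>(i, j). (i + j, i)" and j = "\<lambda>(p, i). (i, p - i)"]) auto

text \<open>Quadruples of total \<open>n\<close>, grouped by first plus second entry on the left and
  by first plus third on the right. Exchanging the middle entries is an involution, so one map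
  serves as both witnesses.\<close>

lemma sum_antidiagonal_interchange:
  fixes G :: "nat \<Rightarrow> nat \<Rightarrow> nat \<Rightarrow> nat \<Rightarrow> 'c::comm_monoid_add"
  shows "(\<Sum>p\<le>n. \<Sum>i\<le>p. \<Sum>j\<le>n - p. G i (p - i) j (n - p - j)) =
    (\<Sum>p\<le>n. \<Sum>i\<le>p. \<Sum>j\<le>n - p. G i j (p - i) (n - p - j))"
  unfolding sum.Sigma[OF finite_atMost ballI[OF finite_atMost]] 
    sum.Sigma[OF finite_atMost ballI[OF finite_SigmaI[OF finite_atMost finite_atMost]]]
  by (rule sum.reindex_bij_witness[where i = "\<lambda>(p, i, j). (i + j, i, p - i)"
        and j = "\<lambda>(p, i, j). (i + j, i, p - i)"]) (auto simp: add.commute)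

lemma ccomp_assoc:
  assumes S: "S \<in> chom sZ p sW q" and T: "T \<in> chom sY n sZ p" and U: "U \<in> chom sX m sY n"
  shows "ccomp (ccomp S T) U = ccomp S (ccomp T U)"
proof
  fix n
  have "ccomp (ccomp S T) U n =
      (\<Sum>k\<le>n. \<Sum>i\<le>k. mcomp (S i) (mcomp (T (k - i)) (U (n - k))))"
    unfolding ccomp_def
    by (simp add: mcomp_sum_left[OF mcomp_mhom[OF chomD[OF S] chomD[OF T]] chomD[OF U]] mcomp_assoc)
  also have "\<dots> = ccomp S (ccomp T U) n"
    unfolding sum_antidiagonal_assoc[where G = "\<lambda>i j k. mcomp (S i) (mcomp (T j) (U k))"]
    by (simp add: ccomp_def mcomp_sum_right)
  finally show "ccomp (ccomp S T) U n = ccomp S (ccomp T U) n" .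
qed

lemma cpar_assoc:
  assumes S: "S \<in> chom sX m sY p" and T: "T \<in> chom sX n sY q" and U: "U \<in> chom sX l sY r"
  shows "cpar sY (m + n) (cpar sY m S T) U = cpar sY m S (cpar sY n T U)"
proof
  fix k
  have "cpar sY (m + n) (cpar sY m S T) U k =
      (\<Sum>j\<le>k. \<Sum>i\<le>j. mpar sY m (S i) (mpar sY n (T (j - i)) (U (k - j))))"
    unfolding cpar_def mpar_sum_left mpar_assoc[OF chomD[OF S] chomD[OF T] chomD[OF U]] ..
  also have "\<dots> = cpar sY m S (cpar sY n T U) k"
    unfolding sum_antidiagonal_assoc[where G = "\<lambda>i j k. mpar sY m (S i) (mpar sY n (T j) (U k))"]
    by (simp add: cpar_def mpar_sum_right[OF mpar_mhom[OF chomD[OF T] chomD[OF U] refl refl] chomD[OF S]])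
  finally show "cpar sY (m + n) (cpar sY m S T) U k = cpar sY m S (cpar sY n T U) k" .
qed

lemma cpar_interchange:
  assumes S: "S \<in> chom sY m sZ p" and T: "T \<in> chom sY n sZ q"
    and S': "S' \<in> chom sX k sY m" and T': "T' \<in> chom sX l sY n"
  shows "ccomp (cpar sZ m S T) (cpar sY k S' T') = cpar sZ k (ccomp S S') (ccomp T T')"
proof
  fix N
  have "ccomp (cpar sZ m S T) (cpar sY k S' T') N =
      (\<Sum>p\<le>N. \<Sum>i\<le>p. \<Sum>j\<le>N - p. mpar sZ k (mcomp (S i) (S' j)) (mcomp (T (p - i)) (T' (N - p - j))))"
    unfolding ccomp_def cpar_def
    unfolding mcomp_sum_left[OF mpar_mhom[OF chomD[OF S] chomD[OF T] refl refl]
        mhom_sum[OF mhomD(1)[OF chomD[OF S']] mhomD(2)[OF chomD[OF S']] mpar_mhom[OF chomD[OF S'] chomD[OF T'] refl refl]]]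
    unfolding mcomp_sum_right mpar_interchange[OF chomD[OF S] chomD[OF T] chomD[OF S'] chomD[OF T']] ..
  \<comment> \<open>The outer index passes from the total degree of \<open>S\<close> and
    \<open>T\<close> to that of \<open>S\<close> and \<open>S'\<close>.\<close>
  also have "\<dots> = (\<Sum>p\<le>N. \<Sum>i\<le>p. \<Sum>j\<le>N - p. mpar sZ k (mcomp (S i) (S' (p - i))) (mcomp (T j) (T' (N - p - j))))"
    by (rule sum_antidiagonal_interchange[where G = "\<lambda>i u j v. mpar sZ k (mcomp (S i) (S' j)) (mcomp (T u) (T' v))"])
  also have "\<dots> = cpar sZ k (ccomp S S') (ccomp T T') N"
    unfolding ccomp_def cpar_def mpar_sum_left
      mpar_sum_right[OF mcomp_mhom[OF chomD[OF T] chomD[OF T']] mcomp_mhom[OF chomD[OF S] chomD[OF S']]] ..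
  finally show "ccomp (cpar sZ m S T) (cpar sY k S' T') N = cpar sZ k (ccomp S S') (ccomp T T') N" .
qed

lemma ccomp_diff_left:
  assumes "S \<in> chom sY n sZ p" "S' \<in> chom sY n sZ p" "T \<in> chom sX m sY n"
  shows "ccomp (S - S') T = ccomp S T - ccomp S' T"
proof
  fix k
  have "mcomp (S i - S' i) (T j) = mcomp (S i) (T j) - mcomp (S' i) (T j)" for i j
    using mcomp_add_left[OF chomD[OF chom_diff[OF assms(1,2)]] chomD[OF assms(2)] chomD[OF assms(3)], of i i j]
    by simp
  then show "ccomp (S - S') T k = (ccomp S T - ccomp S' T) k"
    by (simp add: ccomp_def sum_subtractf)
qed

lemma ccomp_diff_right: "ccomp S (T - T') = ccomp S T - ccomp S T'"
proof
  fix k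
  have "mcomp (S i) (T j - T' j) = mcomp (S i) (T j) - mcomp (S i) (T' j)" for i j
    using mcomp_add_right[of "S i" "T j - T' j" "T' j"] by simp
  then show "ccomp S (T - T') k = (ccomp S T - ccomp S T') k"
    by (simp add: ccomp_def sum_subtractf)
qed

lemma cpar_diff_left: "cpar sY m (S - S') T = cpar sY m S T - cpar sY m S' T"
proof
  fix k
  have "mpar sY m (S i - S' i) (T j) = mpar sY m (S i) (T j) - mpar sY m (S' i) (T j)" for i j
    using mpar_add_left[of sY m "S i - S' i" "S' i" "T j"] by simp
  then show "cpar sY m (S - S') T k = (cpar sY m S T - cpar sY m S' T) k"
    by (simp add: cpar_def sum_subtractf)
qed

lemma cpar_diff_right:
  assumes "S \<in> chom sX m sY p" "T \<in> chom sX n sY q" "T' \<in> chom sX n sY q"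
  shows "cpar sY m S (T - T') = cpar sY m S T - cpar sY m S T'"
proof
  fix k
  have "mpar sY m (S i) (T j - T' j) = mpar sY m (S i) (T j) - mpar sY m (S i) (T' j)" for i j
    using mpar_add_right[OF chomD[OF assms(1)] chomD[OF chom_diff[OF assms(2,3)]] chomD[OF assms(3)], of i j j]
    by simp
  then show "cpar sY m S (T - T') k = (cpar sY m S T - cpar sY m S T') k"
    by (simp add: cpar_def sum_subtractf)
qed

section \<open>Products with a series that starts in degree \<open>n\<close>\<close>

text \<open>Only one end of the convolution survives. Here and in the next three lemmas,
  \<open>k \<le> n\<close> gives the vanishing below \<open>n\<close> together with the leading
  coefficient, as nested products require.\<close>

lemma ccomp_low:
  assumes "\<And>i. i < n \<Longrightarrow> S i = 0" "k \<le> n" and T: "T \<in> chom sX m sY p"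
  shows "ccomp S T k = mcomp (S k) (T 0)"
  using assms(1,2)
  by (simp add: ccomp_def atMost_Suc[symmetric] lessThan_Suc_atMost[symmetric]
    mcomp_zero_left[OF chomD[OF T]])

lemma ccomp_high:
  assumes "\<And>i. i < n \<Longrightarrow> T i = 0" "k \<le> n"
  shows "ccomp S T k = mcomp (S 0) (T k)"
  using assms
  by (subst ccomp_def, subst sum.atMost_shift) (simp add: mcomp_zero_right)

lemma cpar_low:
  assumes "\<And>i. i < n \<Longrightarrow> S i = 0" "k \<le> n"
  shows "cpar sY m S T k = mpar sY m (S k) (T 0)"
  using assms
  by (simp add: cpar_def lessThan_Suc_atMost[symmetric] mpar_zero_left)

lemma cpar_high:
  assumes "\<And>i. i < n \<Longrightarrow> T i = 0" "k \<le> n" and S: "S \<in> chom sX m sY p"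
  shows "cpar sY m S T k = mpar sY m (S 0) (T k)"
  using assms(1,2)
  by (subst cpar_def, subst sum.atMost_shift) (simp add: mpar_zero_right[OF chomD[OF S]])

lemma ccomp_cid_left:
  assumes "S \<in> chom sX m sY n"
  shows "ccomp (cid sY n) S = S"
proof
  fix k
  show "ccomp (cid sY n) S k = S k"
    by (subst ccomp_def, subst sum.atMost_shift)
      (simp add: cid_def mcomp_mid_left[OF chomD[OF assms]] mcomp_zero_left[OF chomD[OF assms]])
qed

lemma ccomp_cid_right:
  assumes "S \<in> chom sX m sY n"
  shows "ccomp S (cid sX m) = S"
proof
  fix k
  show "ccomp S (cid sX m) k = S k"
    by (simp add: ccomp_def lessThan_Suc_atMost[symmetric] cid_def mcomp_mid_right[OF chomD[OF assms]] mcomp_zero_right)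
qed

lemma cpar_cid:
  assumes "vector_space sX"
  shows "cpar sX m (cid sX m) (cid sX n) = cid sX (m + n)"
proof
  fix k
  have "cpar sX m (cid sX m) (cid sX n) k = mpar sX m (cid sX m k) (cid sX n 0)"
    by (simp add: cpar_def lessThan_Suc_atMost[symmetric] cid_def[of sX n]
      mpar_zero_right[OF chomD[OF cid_chom[OF assms]]])
  then show "cpar sX m (cid sX m) (cid sX n) k = cid sX (m + n) k"
    by (simp add: cid_def mpar_mid[OF assms] mpar_zero_left del: zero_fun_apply)
qed

section \<open>Bianchi identities\<close>

text \<open>\<open>curv\<close> and \<open>mcurv\<close> measure the failure of coassociativity of \<open>D\<close>, and of \<open>F\<close> being a
  morphism from \<open>D\<close> to \<open>E\<close>.\<close>

definition curv ::
  "('k::field \<Rightarrow> 'x::ab_group_add \<Rightarrow> 'x) \<Rightarrow> (nat \<Rightarrow> 'x list \<Rightarrow> ('x list, 'k) tensor) \<Rightarrow>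
   nat \<Rightarrow> 'x list \<Rightarrow> ('x list, 'k) tensor" where
  "curv sX D = ccomp (cpar sX 1 D (cid sX 1)) D - ccomp (cpar sX 1 (cid sX 1) D) D"

definition mcurv ::
  "('k::field \<Rightarrow> 'y::ab_group_add \<Rightarrow> 'y) \<Rightarrow> (nat \<Rightarrow> 'x list \<Rightarrow> ('x list, 'k) tensor) \<Rightarrow>
   (nat \<Rightarrow> 'y list \<Rightarrow> ('y list, 'k) tensor) \<Rightarrow> (nat \<Rightarrow> 'x list \<Rightarrow> ('y list, 'k) tensor) \<Rightarrow>
   nat \<Rightarrow> 'x list \<Rightarrow> ('y list, 'k) tensor" where
  "mcurv sY D E F = ccomp (cpar sY 1 F F) D - ccomp E F"

lemma curv_chom:
  assumes "D \<in> chom sX 1 sX 2"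
  shows "curv sX D \<in> chom sX 1 sX 3"
proof -
  note I = cid_chom[OF mhomD(1)[OF chomD[OF assms]], of 1]
  show ?thesis unfolding curv_def
    by (intro chom_diff ccomp_chom[OF _ assms] cpar_chom[OF assms I] cpar_chom[OF I assms]) simp_all
qed

lemma mcurv_chom:
  assumes "D \<in> chom sX 1 sX 2" "E \<in> chom sY 1 sY 2" "F \<in> chom sX 1 sY 1"
  shows "mcurv sY D E F \<in> chom sX 1 sY 2"
  unfolding mcurv_def
  by (intro chom_diff ccomp_chom[OF _ assms(1)] ccomp_chom[OF assms(2,3)] cpar_chom[OF assms(3,3)]) simp_all

text \<open>Inserting the definition of \<open>curv\<close> gives ten composites of three copies of
  \<open>D\<close>. Eight cancel in pairs, because juxtaposition with the identity respects
  composition; the other two both equal \<open>(D \<otimes> D) D\<close>.\<close>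

lemma bianchi_curv:
  fixes sX :: "'k::field \<Rightarrow> 'x::ab_group_add \<Rightarrow> 'x"
  assumes D: "D \<in> chom sX 1 sX 2"
  defines "I \<equiv> cid sX 1" and "p \<equiv> cpar sX 1"
  shows "ccomp (p I (curv sX D)) D - ccomp (p D (p I I)) (curv sX D)
     + ccomp (p I (p D I)) (curv sX D) - ccomp (p I (p I D)) (curv sX D)
     + ccomp (p (curv sX D) I) D = 0"
proof -
  have X: "vector_space sX" by (rule mhomD(1)[OF chomD[OF D]])
  have I: "I \<in> chom sX 1 sX 1" unfolding I_def by (rule cid_chom[OF X])
  have II: "p I I \<in> chom sX 2 sX 2" unfolding p_def by (rule cpar_chom[OF I I]) simp_all
  have DI: "p D I \<in> chom sX 2 sX 3" unfolding p_def by (rule cpar_chom[OF D I]) simp_all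
  have ID: "p I D \<in> chom sX 2 sX 3" unfolding p_def by (rule cpar_chom[OF I D]) simp_all
  have DID: "ccomp (p D I) D \<in> chom sX 1 sX 3" and IDD: "ccomp (p I D) D \<in> chom sX 1 sX 3"
    by (rule ccomp_chom[OF DI D] ccomp_chom[OF ID D])+
  have DII: "p D (p I I) \<in> chom sX 3 sX 4" unfolding p_def by (rule cpar_chom[OF D II[unfolded p_def]]) simp_all
  have IID: "p I (p I D) \<in> chom sX 3 sX 4" unfolding p_def by (rule cpar_chom[OF I ID[unfolded p_def]]) simp_all
  have pII: "p I I = cid sX 2" using cpar_cid[OF X, of 1 1] by (simp add: p_def I_def numeral_2_eq_2)
  have "ccomp I I = I" "ccomp D I = D"
    using ccomp_cid_left[OF I] ccomp_cid_right[OF D] by (simp_all add: I_def)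
  moreover have "ccomp (p I I) D = D"
    using ccomp_cid_left[OF D] by (simp add: pII)
  ultimately have cI: "ccomp I I = I" "ccomp D I = D" "ccomp (p I I) D = D" by simp_all
  \<comment> \<open>The outer index is 2 because \<open>p U V\<close> consumes two tensor
    factors.\<close>
  have assoc: "cpar sX 2 (p U V) W = p U (p V W)"
    if "U \<in> chom sX 1 sX a" "V \<in> chom sX 1 sX b" "W \<in> chom sX 1 sX c" for U V W a b c
    using cpar_assoc[OF that] by (simp add: p_def numeral_2_eq_2)
  have right: "ccomp (p I (ccomp U D)) D = ccomp (p I U) (ccomp (p I D) D)"
    if U: "U \<in> chom sX 2 sX 3" for U
  proof -
    have "p I U \<in> chom sX 3 sX 4" unfolding p_def by (rule cpar_chom[OF I U]) simp_all
    moreover have "p I (ccomp U D) = ccomp (p I U) (p I D)"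
      using cpar_interchange[OF I U I D] by (simp add: p_def cI)
    ultimately show ?thesis by (simp add: ccomp_assoc[OF _ ID D])
  qed
  have left: "ccomp (p (ccomp U D) I) D = ccomp (cpar sX 2 U I) (ccomp (p D I) D)"
    if U: "U \<in> chom sX 2 sX 3" for U
  proof -
    have "cpar sX 2 U I \<in> chom sX 3 sX 4" by (rule cpar_chom[OF U I]) simp_all
    moreover have "p (ccomp U D) I = ccomp (cpar sX 2 U I) (p D I)"
      using cpar_interchange[OF U I D I] by (simp add: p_def cI)
    ultimately show ?thesis by (simp add: ccomp_assoc[OF _ DI D])
  qed
  \<comment> \<open>The two composites left over apply \<open>D\<close> to different factors, so the
    interchange law lets the order be forgotten.\<close>
  have 1: "ccomp (p D (p I I)) (ccomp (p I D) D) = ccomp (p D D) D"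
    using cpar_interchange[OF D II I D] by (simp add: p_def[symmetric] cI ccomp_assoc[OF DII ID D, symmetric] del: One_nat_def)
  have 2: "ccomp (p I (p I D)) (ccomp (p D I) D) = ccomp (p D D) D"
    using cpar_interchange[OF II D D I] by (simp add: p_def[symmetric] cI ccomp_assoc[OF IID DI D, symmetric] assoc[OF I I D] del: One_nat_def)
  have "ccomp (p I (curv sX D)) D =
      ccomp (p I (p D I)) (ccomp (p I D) D) - ccomp (p I (p I D)) (ccomp (p I D) D)"
  proof -
    have "p I (curv sX D) = p I (ccomp (p D I) D) - p I (ccomp (p I D) D)"
      unfolding curv_def p_def I_def[symmetric]
      by (rule cpar_diff_right[OF I DID[unfolded p_def] IDD[unfolded p_def]])
    moreover have "p I (ccomp (p D I) D) \<in> chom sX 2 sX 4" "p I (ccomp (p I D) D) \<in> chom sX 2 sX 4"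
      unfolding p_def by (rule cpar_chom[OF I DID[unfolded p_def]] cpar_chom[OF I IDD[unfolded p_def]]; simp)+
    ultimately show ?thesis by (simp add: ccomp_diff_left[OF _ _ D] right[OF DI] right[OF ID])
  qed
  moreover have "ccomp (p (curv sX D) I) D =
      ccomp (p D (p I I)) (ccomp (p D I) D) - ccomp (p I (p D I)) (ccomp (p D I) D)"
  proof -
    have "p (curv sX D) I = p (ccomp (p D I) D) I - p (ccomp (p I D) D) I"
      unfolding curv_def p_def I_def[symmetric] by (rule cpar_diff_left)
    moreover have "p (ccomp (p D I) D) I \<in> chom sX 2 sX 4" "p (ccomp (p I D) D) I \<in> chom sX 2 sX 4"
      unfolding p_def by (rule cpar_chom[OF DID[unfolded p_def] I] cpar_chom[OF IDD[unfolded p_def] I]; simp)+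
    ultimately show ?thesis
      by (simp add: ccomp_diff_left[OF _ _ D] left[OF DI] left[OF ID] assoc[OF D I I] assoc[OF I D I])
  qed
  moreover have "ccomp U (curv sX D) = ccomp U (ccomp (p D I) D) - ccomp U (ccomp (p I D) D)"
    for U :: "nat \<Rightarrow> 'x list \<Rightarrow> ('x list, 'k) tensor"
    unfolding curv_def p_def I_def by (rule ccomp_diff_right)
  ultimately show ?thesis by (simp add: 1 2)
qed

text \<open>Expanding \<open>M\<close> on the right gives eight composites. The four containing both
  \<open>E\<close> and \<open>D\<close> cancel in pairs by interchange; those without
  \<open>E\<close> assemble to the curvature of \<open>D\<close>, those without \<open>D\<close> to
  that of \<open>E\<close>. \<open>p\<close> and \<open>q\<close> are one operation at two types,
  since a local abbreviation has a single type.\<close>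

lemma bianchi_mcurv:
  fixes sX :: "'k::field \<Rightarrow> 'x::ab_group_add \<Rightarrow> 'x" and sY :: "'k \<Rightarrow> 'y::ab_group_add \<Rightarrow> 'y"
  assumes D: "D \<in> chom sX 1 sX 2" and E: "E \<in> chom sY 1 sY 2" and F: "F \<in> chom sX 1 sY 1"
  defines "I \<equiv> cid sY 1" and "p \<equiv> cpar sY 1" and "q \<equiv> cpar sY 1" and "M \<equiv> mcurv sY D E F"
  shows "ccomp (curv sY E) F - ccomp (q F (q F F)) (curv sX D) =
    ccomp (q F M) D - ccomp (p E I) M + ccomp (p I E) M - ccomp (q M F) D"
proof -
  have X: "vector_space sX" by (rule mhomD(1)[OF chomD[OF D]])
  have Y: "vector_space sY" by (rule mhomD(1)[OF chomD[OF E]])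
  define J where "J = cid sX 1"
  define r where "r = (cpar sX 1 :: _ \<Rightarrow> _ \<Rightarrow> nat \<Rightarrow> 'x list \<Rightarrow> _)"
  have I: "I \<in> chom sY 1 sY 1" unfolding I_def by (rule cid_chom[OF Y])
  have J: "J \<in> chom sX 1 sX 1" unfolding J_def by (rule cid_chom[OF X])
  have FF: "q F F \<in> chom sX 2 sY 2" unfolding q_def by (rule cpar_chom[OF F F]) simp_all
  have FFF: "q F (q F F) \<in> chom sX 3 sY 3" unfolding q_def by (rule cpar_chom[OF F FF[unfolded q_def]]) simp_all
  have EI: "p E I \<in> chom sY 2 sY 3" unfolding p_def by (rule cpar_chom[OF E I]) simp_all
  have IE: "p I E \<in> chom sY 2 sY 3" unfolding p_def by (rule cpar_chom[OF I E]) simp_all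
  have DJ: "r D J \<in> chom sX 2 sX 3" unfolding r_def by (rule cpar_chom[OF D J]) simp_all
  have JD: "r J D \<in> chom sX 2 sX 3" unfolding r_def by (rule cpar_chom[OF J D]) simp_all
  have FFD: "ccomp (q F F) D \<in> chom sX 1 sY 2" and EF: "ccomp E F \<in> chom sX 1 sY 2"
    by (rule ccomp_chom[OF FF D] ccomp_chom[OF E F])+
  have cI: "ccomp I F = F" "ccomp F J = F"
    using ccomp_cid_left[OF F] ccomp_cid_right[OF F] by (simp_all add: I_def J_def)
  have assoc: "cpar sY 2 (q F F) F = q F (q F F)"
    using cpar_assoc[OF F F F] by (simp add: q_def numeral_2_eq_2)
  have Mdef: "M = ccomp (q F F) D - ccomp E F" by (simp add: M_def mcurv_def q_def)
  have sub: "ccomp U M = ccomp U (ccomp (q F F) D) - ccomp U (ccomp E F)"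
    for U :: "nat \<Rightarrow> 'y list \<Rightarrow> ('y list, 'k) tensor"
    unfolding Mdef by (rule ccomp_diff_right)
  have 1: "ccomp (q F (ccomp (q F F) D)) D = ccomp (q F (q F F)) (ccomp (r J D) D)"
    using cpar_interchange[OF F FF J D] 
    by (simp add: q_def[symmetric] r_def[symmetric] cI ccomp_assoc[OF FFF JD D, symmetric] del: One_nat_def)
  have 2: "ccomp (q (ccomp (q F F) D) F) D = ccomp (q F (q F F)) (ccomp (r D J) D)"
    using cpar_interchange[OF FF F D J]
    by (simp add: q_def[symmetric] r_def[symmetric] cI assoc ccomp_assoc[OF FFF DJ D, symmetric] del: One_nat_def)
  have 3: "ccomp (q F (ccomp E F)) D = ccomp (p I E) (ccomp (q F F) D)"
    using cpar_interchange[OF I E F F] 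
    by (simp add: q_def[symmetric] p_def[symmetric] cI ccomp_assoc[OF IE FF D, symmetric] del: One_nat_def)
  have 4: "ccomp (q (ccomp E F) F) D = ccomp (p E I) (ccomp (q F F) D)"
    using cpar_interchange[OF E I F F] 
    by (simp add: q_def[symmetric] p_def[symmetric] cI ccomp_assoc[OF EI FF D, symmetric] del: One_nat_def)
  have "ccomp (q F M) D = ccomp (q F (ccomp (q F F) D)) D - ccomp (q F (ccomp E F)) D"
  proof -
    have "q F M = q F (ccomp (q F F) D) - q F (ccomp E F)"
      unfolding Mdef q_def by (rule cpar_diff_right[OF F FFD[unfolded q_def] EF])
    moreover have "q F (ccomp (q F F) D) \<in> chom sX 2 sY 3" "q F (ccomp E F) \<in> chom sX 2 sY 3"
      unfolding q_def by (rule cpar_chom[OF F FFD[unfolded q_def]] cpar_chom[OF F EF]; simp)+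
    ultimately show ?thesis by (simp add: ccomp_diff_left[OF _ _ D])
  qed
  moreover have "ccomp (q M F) D = ccomp (q (ccomp (q F F) D) F) D - ccomp (q (ccomp E F) F) D"
  proof -
    have "q M F = q (ccomp (q F F) D) F - q (ccomp E F) F"
      unfolding Mdef q_def by (rule cpar_diff_left)
    moreover have "q (ccomp (q F F) D) F \<in> chom sX 2 sY 3" "q (ccomp E F) F \<in> chom sX 2 sY 3"
      unfolding q_def by (rule cpar_chom[OF FFD[unfolded q_def] F] cpar_chom[OF EF F]; simp)+
    ultimately show ?thesis by (simp add: ccomp_diff_left[OF _ _ D])
  qed
  moreover have "ccomp (curv sY E) F = ccomp (p E I) (ccomp E F) - ccomp (p I E) (ccomp E F)"
    unfolding curv_def p_def[symmetric] I_def[symmetric]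
    by (simp add: ccomp_diff_left[OF ccomp_chom[OF EI E] ccomp_chom[OF IE E] F] ccomp_assoc[OF EI E F] ccomp_assoc[OF IE E F])
  moreover have "ccomp (q F (q F F)) (curv sX D) =
      ccomp (q F (q F F)) (ccomp (r D J) D) - ccomp (q F (q F F)) (ccomp (r J D) D)"
    unfolding curv_def r_def J_def by (rule ccomp_diff_right)
  ultimately show ?thesis by (simp add: sub 1 2 3 4)
qed

section \<open>Dependence on low coefficients and first-order variation\<close>

lemma cpar_cid_left:
  assumes "vector_space sX"
  shows "cpar sX m (cid sX m) T k = mpar sX m (mid sX m) (T k)"
  by (subst cpar_def, subst sum.atMost_shift) (simp add: cid_def mpar_zero_left)

lemma cpar_cid_right:
  assumes "S \<in> chom sX m sY p"
  shows "cpar sY m S (cid sY n) k = mpar sY m (S k) (mid sY n)"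
  by (simp add: cpar_def lessThan_Suc_atMost[symmetric] cid_def mpar_zero_right[OF chomD[OF assms]])

lemma cpar_0: "cpar sY m S T 0 = mpar sY m (S 0) (T 0)"
  by (simp add: cpar_def)

lemma ccomp_cong: "(\<And>i. i \<le> n \<Longrightarrow> S i = S' i) \<Longrightarrow> (\<And>i. i \<le> n \<Longrightarrow> T i = T' i) \<Longrightarrow> ccomp S T n = ccomp S' T' n"
  by (simp add: ccomp_def)

lemma cpar_cong: "(\<And>i. i \<le> n \<Longrightarrow> S i = S' i) \<Longrightarrow> (\<And>i. i \<le> n \<Longrightarrow> T i = T' i) \<Longrightarrow> cpar sY m S T n = cpar sY m S' T' n"
  by (simp add: cpar_def)

text \<open>A change of coefficient \<open>n\<close> touches only the two extreme summands of a
  convolution; \<open>0 < n\<close> keeps them apart.\<close>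

lemma sum_atMost_ends: 
  fixes g :: "nat \<Rightarrow> 'c::comm_monoid_add"
  assumes "0 < n" shows "(\<Sum>i\<le>n. g i) = g 0 + (\<Sum>i\<in>{0<..<n}. g i) + g n"
proof -
  have "{..n} = insert 0 (insert n {0<..<n})" using assms by auto
  then show ?thesis using assms by (simp add: ac_simps)
qed

text \<open>The product of the two increments would have degree 2n, which exceeds \<open>n\<close>
  because \<open>n\<close> is positive. So the change is linear, and each increment meets only a
  constant coefficient.\<close>

lemma ccomp_first_order:
  assumes n: "0 < n" and S: "S \<in> chom sY q sZ p" and x: "x \<in> mhom sY q sZ p" and T: "T \<in> chom sX m sY q"
    and S': "\<And>i. i < n \<Longrightarrow> S' i = S i" "S' n = S n + x"
    and T': "\<And>i. i < n \<Longrightarrow> T' i = T i" "T' n = T n + y"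
  shows "ccomp S' T' n = ccomp S T n + (mcomp x (T 0) + mcomp (S 0) y)"
proof -
  have "(\<Sum>i\<in>{0<..<n}. mcomp (S' i) (T' (n - i))) = (\<Sum>i\<in>{0<..<n}. mcomp (S i) (T (n - i)))"
    by (intro sum.cong) (simp_all add: S' T')
  moreover have "mcomp (S n + x) (T 0) = mcomp (S n) (T 0) + mcomp x (T 0)"
    by (rule mcomp_add_left[OF chomD[OF S] x chomD[OF T]])
  ultimately show ?thesis
    using n by (simp add: ccomp_def sum_atMost_ends S' T' mcomp_add_right ac_simps)
qed

lemma cpar_first_order:
  assumes n: "0 < n" and S: "S \<in> chom sX m sY p" and y: "y \<in> mhom sX l sY q" and T: "T \<in> chom sX l sY q"
    and S': "\<And>i. i < n \<Longrightarrow> S' i = S i" "S' n = S n + x"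
    and T': "\<And>i. i < n \<Longrightarrow> T' i = T i" "T' n = T n + y"
  shows "cpar sY m S' T' n = cpar sY m S T n + (mpar sY m x (T 0) + mpar sY m (S 0) y)"
proof -
  have "(\<Sum>i\<in>{0<..<n}. mpar sY m (S' i) (T' (n - i))) = (\<Sum>i\<in>{0<..<n}. mpar sY m (S i) (T (n - i)))"
    by (intro sum.cong) (simp_all add: S' T')
  moreover have "mpar sY m (S 0) (T n + y) = mpar sY m (S 0) (T n) + mpar sY m (S 0) y"
    by (rule mpar_add_right[OF chomD[OF S] chomD[OF T] y])
  ultimately show ?thesis
    using n by (simp add: cpar_def sum_atMost_ends S' T' mpar_add_left ac_simps)
qed

text \<open>Coefficient \<open>n\<close> of a product involves no coefficient beyond
  \<open>n\<close>. Hence later corrections cannot spoil a settled degree, and the limit can be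
  tested stage by stage.\<close>

lemma curv_cong: "(\<And>i. i \<le> n \<Longrightarrow> D i = D' i) \<Longrightarrow> curv sX D n = curv sX D' n"
  unfolding curv_def by (simp cong: ccomp_cong cpar_cong)

lemma mcurv_cong:
  "(\<And>i. i \<le> n \<Longrightarrow> D i = D' i) \<Longrightarrow> (\<And>i. i \<le> n \<Longrightarrow> E i = E' i) \<Longrightarrow> (\<And>i. i \<le> n \<Longrightarrow> F i = F' i) \<Longrightarrow>
    mcurv sY D E F n = mcurv sY D' E' F' n"
  unfolding mcurv_def by (simp cong: ccomp_cong cpar_cong)

text \<open>The product rule for the two composites in \<open>curv\<close>: the increment enters
  once in the outer and once in the inner place. The total change is minus the Hochschild
  differential of \<open>z\<close>, as comparison with \<open>def_diff_2\<close> shows.\<close>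

lemma curv_first_order:
  fixes sX :: "'k::field \<Rightarrow> 'x::ab_group_add \<Rightarrow> 'x"
  assumes n: "0 < n" and D: "D \<in> chom sX 1 sX 2" and z: "z \<in> mhom sX 1 sX 2"
    and D': "\<And>i. i < n \<Longrightarrow> D' i = D i" "D' n = D n + z"
  defines "I \<equiv> mid sX 1" and "p \<equiv> mpar sX 1"
  shows "curv sX D' n = curv sX D n +
    (mcomp (p z I) (D 0) + mcomp (p (D 0) I) z) - (mcomp (p I z) (D 0) + mcomp (p I (D 0)) z)"
proof -
  have X: "vector_space sX" by (rule mhomD(1)[OF z])
  note cI = cid_chom[OF X, of 1] and I = mid_mhom[OF X, of 1]
  have DI: "cpar sX 1 D (cid sX 1) \<in> chom sX 2 sX 3" by (rule cpar_chom[OF D cI]) simp_all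
  have ID: "cpar sX 1 (cid sX 1) D \<in> chom sX 2 sX 3" by (rule cpar_chom[OF cI D]) simp_all
  have zI: "p z I \<in> mhom sX 2 sX 3" unfolding p_def I_def by (rule mpar_mhom[OF z I]) simp_all
  have Iz: "p I z \<in> mhom sX 2 sX 3" unfolding p_def I_def by (rule mpar_mhom[OF I z]) simp_all
  have low: "cpar sX 1 D' (cid sX 1) i = cpar sX 1 D (cid sX 1) i" "cpar sX 1 (cid sX 1) D' i = cpar sX 1 (cid sX 1) D i"
    if "i < n" for i using that D'(1) by (auto intro!: cpar_cong)
  \<comment> \<open>\<open>cpar_first_order\<close> varies both arguments; the identity series
    receives the increment 0.\<close>
  have z0: "(0 :: 'x list \<Rightarrow> ('x list, 'k) tensor) \<in> mhom sX 1 sX 1" by (rule mhom_zero[OF X X])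
  have topl: "cpar sX 1 D' (cid sX 1) n = cpar sX 1 D (cid sX 1) n + p z I"
    using cpar_first_order[OF n D z0 cI D' refl]
    by (simp add: p_def I_def cid_def[of sX] mpar_zero_right[OF chomD[OF D]]
      del: One_nat_def)
  have topr: "cpar sX 1 (cid sX 1) D' n = cpar sX 1 (cid sX 1) D n + p I z"
    by (simp add: cpar_cid_left[OF X] D' mpar_add_right[OF I chomD[OF D] z] p_def I_def
      del: One_nat_def)
  have "ccomp (cpar sX 1 D' (cid sX 1)) D' n = ccomp (cpar sX 1 D (cid sX 1)) D n +
     (mcomp (p z I) (D 0) + mcomp (p (D 0) I) z)"
    using ccomp_first_order[OF n DI zI D low(1) topl D'] by (simp add: cpar_0 cid_def p_def I_def)
  moreover have "ccomp (cpar sX 1 (cid sX 1) D') D' n = ccomp (cpar sX 1 (cid sX 1) D) D n +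
     (mcomp (p I z) (D 0) + mcomp (p I (D 0)) z)"
    using ccomp_first_order[OF n ID Iz D low(2) topr D'] by (simp add: cpar_0 cid_def p_def I_def)
  ultimately show ?thesis by (simp add: curv_def)
qed

text \<open>\<open>F\<close> occurs twice in \<open>F \<otimes> F\<close>, so its increment
  contributes two terms there and a third through \<open>E F\<close>.\<close>

lemma mcurv_first_order:
  fixes sX :: "'k::field \<Rightarrow> 'x::ab_group_add \<Rightarrow> 'x" and sY :: "'k \<Rightarrow> 'y::ab_group_add \<Rightarrow> 'y"
  assumes n: "0 < n" and D: "D \<in> chom sX 1 sX 2" and E: "E \<in> chom sY 1 sY 2" and F: "F \<in> chom sX 1 sY 1"
    and z: "z \<in> mhom sX 1 sX 2" and y: "y \<in> mhom sY 1 sY 2" and x: "x \<in> mhom sX 1 sY 1"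
    and D': "\<And>i. i < n \<Longrightarrow> D' i = D i" "D' n = D n + z"
    and E': "\<And>i. i < n \<Longrightarrow> E' i = E i" "E' n = E n + y"
    and F': "\<And>i. i < n \<Longrightarrow> F' i = F i" "F' n = F n + x"
  defines "p \<equiv> mpar sY 1"
  shows "mcurv sY D' E' F' n = mcurv sY D E F n +
    (mcomp (p (F 0) x) (D 0) + mcomp (p x (F 0)) (D 0) + mcomp (p (F 0) (F 0)) z) -
    (mcomp y (F 0) + mcomp (E 0) x)"
proof -
  have FF: "cpar sY 1 F F \<in> chom sX 2 sY 2" by (rule cpar_chom[OF F F]) simp_all
  have xF: "p x (F 0) \<in> mhom sX 2 sY 2" unfolding p_def by (rule mpar_mhom[OF x chomD[OF F]]) simp_all
  have Fx: "p (F 0) x \<in> mhom sX 2 sY 2" unfolding p_def by (rule mpar_mhom[OF chomD[OF F] x]) simp_all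
  have low: "cpar sY 1 F' F' i = cpar sY 1 F F i" if "i < n" for i
    using that F'(1) by (auto intro!: cpar_cong)
  have top: "cpar sY 1 F' F' n = cpar sY 1 F F n + (p x (F 0) + p (F 0) x)"
    using cpar_first_order[OF n F x F F' F'] by (simp add: p_def)
  have "ccomp (cpar sY 1 F' F') D' n = ccomp (cpar sY 1 F F) D n +
     (mcomp (p x (F 0)) (D 0) + mcomp (p (F 0) x) (D 0) + mcomp (p (F 0) (F 0)) z)"
    using ccomp_first_order[OF n FF mhom_add[OF xF Fx] D low top D']
    by (simp add: cpar_0 p_def[symmetric] mcomp_add_left[OF xF Fx chomD[OF D]] del: One_nat_def plus_fun_apply)
  moreover have "ccomp E' F' n = ccomp E F n + (mcomp y (F 0) + mcomp (E 0) x)"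
    by (rule ccomp_first_order[OF n E y F E' F'])
  ultimately show ?thesis by (simp add: mcurv_def ac_simps)
qed

section \<open>Constant series\<close>

lemma ccomp_concentrated:
  assumes "\<And>i. 0 < i \<Longrightarrow> S i = 0" "\<And>i. 0 < i \<Longrightarrow> T i = 0" "T \<in> chom sX m sY p" "0 < k"
  shows "ccomp S T k = 0"
proof -
  have "mcomp (S i) (T (k - i)) = 0" if "i \<le> k" for i
    using assms that mcomp_zero_left[OF chomD[OF assms(3)]]
    by (cases "i = 0") (auto simp: mcomp_zero_right)
  then show ?thesis by (simp add: ccomp_def)
qed

lemma cpar_concentrated:
  assumes "\<And>i. 0 < i \<Longrightarrow> S i = 0" "\<And>i. 0 < i \<Longrightarrow> T i = 0" "S \<in> chom sX m sY p" "0 < k"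
  shows "cpar sY m S T k = 0"
proof -
  have "mpar sY m (S i) (T (k - i)) = 0" if "i \<le> k" for i
    using assms that mpar_zero_right[OF chomD[OF assms(3)]]
    by (cases "i = 0") (auto simp: mpar_zero_left)
  then show ?thesis by (simp add: cpar_def)
qed

text \<open>Products of constant series are constant. Thus the undeformed structures, read as
  series, have no curvature in positive degrees.\<close>

lemma curv_concentrated:
  assumes D: "D \<in> chom sX 1 sX 2" and "\<And>i. 0 < i \<Longrightarrow> D i = 0" "0 < k"
  shows "curv sX D k = 0"
proof -
  have X: "vector_space sX" by (rule mhomD(1)[OF chomD[OF D]])
  have "cpar sX 1 D (cid sX 1) i = 0" "cpar sX 1 (cid sX 1) D i = 0" if "0 < i" for i
    using cpar_concentrated[OF assms(2) _ D that, of "cid sX 1"]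
      cpar_concentrated[OF _ assms(2) cid_chom[OF X] that, of 1] by (simp_all add: cid_def)
  then show ?thesis
    using ccomp_concentrated[OF _ assms(2) D assms(3), of "cpar sX 1 D (cid sX 1)"]
      ccomp_concentrated[OF _ assms(2) D assms(3), of "cpar sX 1 (cid sX 1) D"] by (simp add: curv_def)
qed

lemma mcurv_concentrated:
  assumes D: "D \<in> chom sX 1 sX 2" and F: "F \<in> chom sX 1 sY 1"
    and "\<And>i. 0 < i \<Longrightarrow> D i = 0" "\<And>i. 0 < i \<Longrightarrow> E i = 0" "\<And>i. 0 < i \<Longrightarrow> F i = 0" "0 < k"
  shows "mcurv sY D E F k = 0"
  using ccomp_concentrated[OF cpar_concentrated[OF assms(5,5) F] assms(3) D assms(6)]
    ccomp_concentrated[OF assms(4,5) F assms(6)] by (simp add: mcurv_def)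

section \<open>Cochains as morphisms\<close>

text \<open>A linear map on a space is a morphism out of words of length one. \<open>unary\<close>
  and \<open>elem\<close> translate between the cochains of the complex and \<open>mhom\<close>; the
  value 0 off length one makes them mutually inverse there.\<close>

definition unary :: "('x \<Rightarrow> ('y list, 'k::field) tensor) \<Rightarrow> 'x list \<Rightarrow> ('y list, 'k) tensor" where
  "unary \<sigma> = (\<lambda>w. if length w = 1 then \<sigma> (hd w) else 0)"

definition elem :: "('x list \<Rightarrow> ('y list, 'k::field) tensor) \<Rightarrow> 'x \<Rightarrow> ('y list, 'k) tensor" where
  "elem g = (\<lambda>x. g [x])"

lemma elem_apply: "elem g x = g [x]"
  by (simp add: elem_def)

lemma elem_unary [simp]: "elem (unary \<sigma>) = \<sigma>"
  by (simp add: elem_def unary_def fun_eq_iff)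

lemma unary_singleton [simp]: "unary \<sigma> [x] = \<sigma> x"
  by (simp add: unary_def)

lemma unary_mhom:
  assumes "\<sigma> \<in> Hom_tpow sM sX n" "vector_space sX"
  shows "unary \<sigma> \<in> mhom sM 1 sX n"
proof -
  have l: "Vector_Spaces.linear sM tscale \<sigma>" and "range \<sigma> \<subseteq> tpow sX n"
    using assms(1) by (auto simp: Hom_tpow_def)
  moreover have "vector_space sM" using l by (simp add: Vector_Spaces.linear_iff)
  ultimately show ?thesis
    using assms(2) by (auto simp: mhom_def multilinear_def unary_def)
qed

lemma elem_Hom:
  assumes "g \<in> mhom sM 1 sX n"
  shows "elem g \<in> Hom_tpow sM sX n"
proof -
  have "Vector_Spaces.linear sM tscale (\<lambda>x. g ([] @ x # []))"
    using mhomD(3)[OF assms] unfolding multilinear_def by (metis add.right_neutral add_0 list.size(3))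
  then show ?thesis using mhomD(4)[OF assms] by (auto simp: Hom_tpow_def elem_def)
qed

lemma unary_elem:
  assumes "g \<in> mhom sM 1 sX n"
  shows "unary (elem g) = g"
proof
  fix w
  show "unary (elem g) w = g w"
    using mhomD(5)[OF assms, of w] by (cases w) (auto simp: unary_def elem_def)
qed

lemma mhom_eqI:
  assumes "g \<in> mhom sM 1 sX n" "h \<in> mhom sM 1 sX n" "\<And>x. g [x] = h [x]"
  shows "g = h"
  using assms(3) unary_elem[OF assms(1)] unary_elem[OF assms(2)] by (metis elem_def ext)

section \<open>Structure maps as juxtapositions\<close>

text \<open>The empty word is the unit of concatenation; it handles the end positions, where an
  identity block is empty.\<close>

lemma tcat_tpure_Nil:
  assumes "vector_space sX" "t \<in> tpow sX n"
  shows "tcat sX (tpure sX []) t = t" "tcat sX t (tpure sX []) = t"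
proof -
  have "tlift (\<lambda>v. tpure sX ([] @ v)) t = t"
    by (rule tpow_unique[OF linear_tlift linear_id'[OF vector_space_tscale] _ assms(2)])
      (simp add: tlift_tpure_length[OF multilinear_tpure[OF assms(1)] refl])
  then show "tcat sX (tpure sX []) t = t" by (simp add: tcat_tpure_left[OF assms])
  show "tcat sX t (tpure sX []) = t"
    by (rule tpow_unique[OF linear_tcat_left linear_id'[OF vector_space_tscale] _ assms(2)])
      (simp add: tcat_tpure[OF assms(1)])
qed

lemma tcat_context:
  assumes X: "vector_space sX" and t: "t \<in> tpow sX n"
  shows "tcat sX (tpure sX u) (tcat sX t (tpure sX v)) = tlift (\<lambda>x. tpure sX (u @ x @ v)) t"
proof -
  have "tlift (\<lambda>w. tpure sX (u @ w)) (tcat sX t (tpure sX v)) = tlift (\<lambda>x. tpure sX (u @ x @ v)) t"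
    by (rule tpow_unique[OF linear_comp[OF linear_tcat_left linear_tlift] linear_tlift _ t])
      (simp add: tcat_tpure[OF X] tlift_tpure_length[OF multilinear_append_right[OF X] refl]
        tlift_tpure_length[OF multilinear_ctx[OF X] refl])
  then show ?thesis
    by (simp add: tcat_tpure_left[OF X tcat_in_tpow[OF X t tpure_in_tpow[OF refl]]])
qed

lemma tcat_tpure_right:
  assumes X: "vector_space sX" and t: "t \<in> tpow sX n"
  shows "tcat sX t (tpure sX v) = tlift (\<lambda>x. tpure sX (x @ v)) t"
  by (rule tpow_unique[OF linear_tcat_left linear_tlift _ t])
    (use tlift_tpure_length[OF multilinear_ctx[OF X, where p = "[]"] refl] in \<open>simp add: tcat_tpure[OF X]\<close>)

text \<open>On a word both sides keep a prefix of length \<open>i\<close> and a suffix of length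
  \<open>j\<close> around the letter \<open>w ! i\<close>. \<open>ins_map\<close> counts factors
  from 1, hence \<open>Suc i\<close>.\<close>

lemma ins_map_mpar:
  fixes sX :: "'k::field \<Rightarrow> 'x::ab_group_add \<Rightarrow> 'x"
  assumes D: "D \<in> mhom sX 1 sX 2" and t: "t \<in> tpow sX n" and n: "n = i + 1 + j"
  shows "ins_map sX (Suc i) (elem D) t = tlift (mpar sX i (mid sX i) (mpar sX 1 D (mid sX j))) t"
proof (rule tpow_unique[OF _ linear_tlift _ t])
  show "Vector_Spaces.linear tscale tscale (ins_map sX (Suc i) (elem D))"
    unfolding ins_map_def by (rule linear_tlift)
  fix w :: "'x list" assume w: "length w = n"
  have X: "vector_space sX" by (rule mhomD(1)[OF D])
  have P: "mpar sX i (mid sX i) (mpar sX 1 D (mid sX j)) \<in> mhom sX n sX (i + (2 + j))"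
    using n by (intro mpar_mhom[OF mid_mhom[OF X] mpar_mhom[OF D mid_mhom[OF X]]]) simp_all
  have "take 1 (drop i w) = [w ! i]" using w n by (simp add: take_Suc_conv_app_nth)
  then have "mpar sX i (mid sX i) (mpar sX 1 D (mid sX j)) w =
      tlift (\<lambda>v. tpure sX (take i w @ v @ drop (Suc i) w)) (D [w ! i])"
    using w n by (simp add: mpar_def mid_def tcat_context[OF X mhomD(4)[OF D]])
  then show "ins_map sX (Suc i) (elem D) (tpure sX w) =
      tlift (mpar sX i (mid sX i) (mpar sX 1 D (mid sX j))) (tpure sX w)"
    using w n tlift_tpure_length[OF mhomD(3)[OF P] w]
    by (simp add: ins_map_tpure[OF X elem_Hom[OF D]] elem_apply)
qed

lemma mpar_mid_left_0:
  assumes "g \<in> mhom sX m sX p"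
  shows "mpar sX 0 (mid sX 0) g = g"
  using tcat_tpure_Nil(1)[OF mhomD(2)[OF assms] mhomD(4)[OF assms]]
  by (simp add: mpar_def mid_def fun_eq_iff)

lemma mpar_mid_right_0:
  assumes "g \<in> mhom sX m sX p"
  shows "mpar sX m g (mid sX 0) = g"
proof
  fix w
  have "mpar sX m g (mid sX 0) w = 0" "g w = 0" if "length w \<noteq> m"
    using mhomD(5)[OF assms that] mhomD(5)[OF mpar_mhom[OF assms mid_mhom[OF mhomD(1)[OF assms]] refl refl], of w] that
    by simp_all
  then show "mpar sX m g (mid sX 0) w = g w"
    using tcat_tpure_Nil(2)[OF mhomD(2)[OF assms] mhomD(4)[OF assms]]
    by (cases "length w = m") (simp_all add: mpar_def mid_def)
qed

lemma ins_map_1_mpar: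
  assumes D: "D \<in> mhom sX 1 sX 2" and t: "t \<in> tpow sX 1"
  shows "ins_map sX 1 (elem D) t = tlift D t"
  using ins_map_mpar[OF D t, of 0 0] mpar_mid_left_0[OF D] mpar_mid_right_0[OF D] by simp

lemma ins_map_2_mpar:
  assumes D: "D \<in> mhom sX 1 sX 2" and t: "t \<in> tpow sX 2"
  shows "ins_map sX 1 (elem D) t = tlift (mpar sX 1 D (mid sX 1)) t"
    and "ins_map sX 2 (elem D) t = tlift (mpar sX 1 (mid sX 1) D) t"
proof -
  note I = mid_mhom[OF mhomD(1)[OF D], of 1]
  show "ins_map sX 1 (elem D) t = tlift (mpar sX 1 D (mid sX 1)) t"
    using ins_map_mpar[OF D t, of 0 1] mpar_mid_left_0[OF mpar_mhom[OF D I refl refl]] by simp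
  show "ins_map sX 2 (elem D) t = tlift (mpar sX 1 (mid sX 1) D) t"
    using ins_map_mpar[OF D t, of 1 0] mpar_mid_right_0[OF D] by (simp add: numeral_2_eq_2)
qed

text \<open>Empty identity blocks are dropped and a block of two is split, which yields literally
  the operators of \<open>bianchi_curv_coeff\<close>.\<close>

lemma ins_map_3_mpar:
  fixes sX :: "'k::field \<Rightarrow> 'x::ab_group_add \<Rightarrow> 'x"
  assumes D: "D \<in> mhom sX 1 sX 2" and t: "t \<in> tpow sX 3"
  defines "I \<equiv> mid sX 1" and "p \<equiv> mpar sX 1"
  shows "ins_map sX 1 (elem D) t = tlift (p D (p I I)) t"
    and "ins_map sX 2 (elem D) t = tlift (p I (p D I)) t"
    and "ins_map sX 3 (elem D) t = tlift (p I (p I D)) t"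
proof -
  have X: "vector_space sX" by (rule mhomD(1)[OF D])
  have I: "I \<in> mhom sX 1 sX 1" unfolding I_def by (rule mid_mhom[OF X])
  have II: "p I I = mid sX 2" using mpar_mid[OF X, of 1 1] by (simp add: p_def I_def numeral_2_eq_2)
  have IID: "mpar sX 2 (mid sX 2) D = p I (p I D)"
    using mpar_assoc[OF I I D] unfolding II[symmetric] p_def by (simp add: numeral_2_eq_2)
  show "ins_map sX 1 (elem D) t = tlift (p D (p I I)) t"
    using ins_map_mpar[OF D t, of 0 2] mpar_mid_left_0[OF mpar_mhom[OF D mid_mhom[OF X, of 2] refl refl]]
    unfolding II by (simp add: p_def)
  show "ins_map sX 2 (elem D) t = tlift (p I (p D I)) t"
    using ins_map_mpar[OF D t, of 1 1] by (simp add: p_def I_def numeral_2_eq_2)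
  show "ins_map sX 3 (elem D) t = tlift (p I (p I D)) t"
    using ins_map_mpar[OF D t, of 2 0] mpar_mid_right_0[OF D] IID by (simp add: numeral_3_eq_3)
qed

lemma tpow_2_cases: "length w = 2 \<Longrightarrow> \<exists>x y. w = [x, y]"
  by (cases w; cases "tl w") auto

text \<open>These are the outer terms of the Hochschild differential for the bicomodule structure
  given by \<open>f\<close>; \<open>g\<close> is \<open>f\<close> with values in the first tensor
  power. The case \<open>f = id\<close> covers a coalgebra over itself.\<close>

lemma id_tensor_mpar:
  fixes sX :: "'k::field \<Rightarrow> 'x::ab_group_add \<Rightarrow> 'x" and sM :: "'k \<Rightarrow> 'm::ab_group_add \<Rightarrow> 'm"
  assumes f: "Vector_Spaces.linear sM sX f" and g: "g \<in> mhom sM 1 sX 1" "\<And>x. g [x] = tpure sX [f x]"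
    and \<sigma>: "\<sigma> \<in> mhom sM 1 sX n" and t: "t \<in> tpow sM 2"
  shows "id_tensor sX (elem \<sigma>) (pair_map sX sM f id (as_pair sM t)) = tlift (mpar sX 1 g \<sigma>) t"
    and "tensor_id sX (elem \<sigma>) (pair_map sM sX id f (as_pair sM t)) = tlift (mpar sX 1 \<sigma> g) t"
proof -
  have X: "vector_space sX" and M: "vector_space sM" using mhomD[OF \<sigma>] by auto
  note H = elem_Hom[OF \<sigma>]
  have id: "Vector_Spaces.linear sM sM id" using linear_id'[OF M] by (simp add: id_def)
  have l: "Vector_Spaces.linear tscale tscale (\<lambda>t. id_tensor sX (elem \<sigma>) (pair_map sX sM f id (as_pair sM t)))"
    "Vector_Spaces.linear tscale tscale (\<lambda>t. tensor_id sX (elem \<sigma>) (pair_map sM sX id f (as_pair sM t)))"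
    unfolding id_tensor_def tensor_id_def pair_map_def as_pair_def
    by (rule linear_comp[OF linear_comp[OF linear_tlift linear_tlift] linear_tlift])+
  have P: "mpar sX 1 g \<sigma> \<in> mhom sM 2 sX (1 + n)" "mpar sX 1 \<sigma> g \<in> mhom sM 2 sX (n + 1)"
    by (intro mpar_mhom[OF g(1) \<sigma>] mpar_mhom[OF \<sigma> g(1)]; simp)+
  show "id_tensor sX (elem \<sigma>) (pair_map sX sM f id (as_pair sM t)) = tlift (mpar sX 1 g \<sigma>) t"
  proof (rule tpow_unique[OF l(1) linear_tlift _ t])
    fix w :: "'m list" assume w: "length w = 2"
    then obtain x y where "w = [x, y]" using tpow_2_cases by blast
    then show "id_tensor sX (elem \<sigma>) (pair_map sX sM f id (as_pair sM (tpure sM w))) = tlift (mpar sX 1 g \<sigma>) (tpure sM w)"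
      using tlift_tpure_length[OF mhomD(3)[OF P(1)] w]
      by (simp add: as_pair_tpure[OF M] pair_map_tpair[OF X M f id] id_tensor_tpair[OF X M H] mpar_def g(2)
        tcat_tpure_left[OF X mhomD(4)[OF \<sigma>]] elem_apply)
  qed
  show "tensor_id sX (elem \<sigma>) (pair_map sM sX id f (as_pair sM t)) = tlift (mpar sX 1 \<sigma> g) t"
  proof (rule tpow_unique[OF l(2) linear_tlift _ t])
    fix w :: "'m list" assume w: "length w = 2"
    then obtain x y where "w = [x, y]" using tpow_2_cases by blast
    then show "tensor_id sX (elem \<sigma>) (pair_map sM sX id f (as_pair sM (tpure sM w))) = tlift (mpar sX 1 \<sigma> g) (tpure sM w)"
      using tlift_tpure_length[OF mhomD(3)[OF P(2)] w]
      by (simp add: as_pair_tpure[OF M] pair_map_tpair[OF M X id f] tensor_id_tpair[OF X M H] mpar_def g(2)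
        tcat_tpure_right[OF X mhomD(4)[OF \<sigma>]] elem_apply)
  qed
qed

lemma pair_map_id:
  fixes sX :: "'k::field \<Rightarrow> 'x::ab_group_add \<Rightarrow> 'x"
  assumes X: "vector_space sX" and t: "t \<in> tpow sX 2"
  shows "pair_map sX sX id id (as_pair sX t) = as_pair sX t"
proof (rule tpow_unique[OF _ _ _ t])
  show "Vector_Spaces.linear tscale tscale (\<lambda>t. pair_map sX sX id id (as_pair sX t))"
    "Vector_Spaces.linear tscale tscale (as_pair sX)"
    unfolding pair_map_def as_pair_def by (rule linear_comp[OF linear_tlift linear_tlift] linear_tlift)+
  fix w :: "'x list" assume w: "length w = 2"
  then obtain x y where "w = [x, y]" using tpow_2_cases by blast
  moreover have id: "Vector_Spaces.linear sX sX id" using linear_id'[OF X] by (simp add: id_def)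
  ultimately show "pair_map sX sX id id (as_pair sX (tpure sX w)) = as_pair sX (tpure sX w)"
    by (simp add: as_pair_tpure[OF X] pair_map_tpair[OF X X id id])
qed

lemma tmaps_mpar:
  fixes sX :: "'k::field \<Rightarrow> 'x::ab_group_add \<Rightarrow> 'x" and sY :: "'k \<Rightarrow> 'y::ab_group_add \<Rightarrow> 'y"
  assumes f: "Vector_Spaces.linear sX sY f" and f': "f' \<in> mhom sX 1 sY 1" "\<And>x. f' [x] = tpure sY [f x]"
    and g: "Vector_Spaces.linear sX sY g" and g': "g' \<in> mhom sX 1 sY 1" "\<And>x. g' [x] = tpure sY [g x]"
    and t: "t \<in> tpow sX 2"
  shows "tmaps sY [f, g] t = tlift (mpar sY 1 f' g') t"
proof (rule tpow_unique[OF _ linear_tlift _ t])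
  have X: "vector_space sX" and Y: "vector_space sY" using mhomD[OF f'(1)] by auto
  show "Vector_Spaces.linear tscale tscale (tmaps sY [f, g])"
    unfolding tmaps_def by (rule linear_tlift)
  have P: "mpar sY 1 f' g' \<in> mhom sX 2 sY 2" by (rule mpar_mhom[OF f'(1) g'(1)]) simp_all
  fix w :: "'x list" assume w: "length w = 2"
  then obtain x y where "w = [x, y]" using tpow_2_cases by blast
  then show "tmaps sY [f, g] (tpure sX w) = tlift (mpar sY 1 f' g') (tpure sX w)"
    using tlift_tpure_length[OF mhomD(3)[OF P] w] f g
    by (simp add: tmaps_tpure[OF X Y] mpar_def f' g' tcat_tpure[OF Y])
qed

lemma tmaps_3_mpar:
  fixes sX :: "'k::field \<Rightarrow> 'x::ab_group_add \<Rightarrow> 'x" and sY :: "'k \<Rightarrow> 'y::ab_group_add \<Rightarrow> 'y"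
  assumes f: "Vector_Spaces.linear sX sY f" and f': "f' \<in> mhom sX 1 sY 1" "\<And>x. f' [x] = tpure sY [f x]"
    and t: "t \<in> tpow sX 3"
  shows "tmaps sY (replicate 3 f) t = tlift (mpar sY 1 f' (mpar sY 1 f' f')) t"
proof (rule tpow_unique[OF _ linear_tlift _ t])
  have X: "vector_space sX" and Y: "vector_space sY" using mhomD[OF f'(1)] by auto
  show "Vector_Spaces.linear tscale tscale (tmaps sY (replicate 3 f))"
    unfolding tmaps_def by (rule linear_tlift)
  have P: "mpar sY 1 f' (mpar sY 1 f' f') \<in> mhom sX 3 sY 3"
    by (rule mpar_mhom[OF f'(1) mpar_mhom[OF f'(1) f'(1) refl refl]]) simp_all
  fix w :: "'x list" assume w: "length w = 3"
  then obtain x y z where "w = [x, y, z]" by (cases w; cases "tl w"; cases "tl (tl w)") auto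
  then show "tmaps sY (replicate 3 f) (tpure sX w) = tlift (mpar sY 1 f' (mpar sY 1 f' f')) (tpure sX w)"
    using tlift_tpure_length[OF mhomD(3)[OF P] w] f
    by (simp add: tmaps_tpure[OF X Y] mpar_def f' tcat_tpure[OF Y] numeral_3_eq_3)
qed

section \<open>The differentials in low degrees\<close>

lemma elem_diff: "elem (g - h) = elem g - elem h"
  and elem_zero: "elem 0 = 0"
  by (simp_all add: elem_def fun_eq_iff)

lemma tscale_one: "tscale 1 t = t"
  by (simp add: tscale_def)

lemma morph_diff_elem:
  assumes f: "Vector_Spaces.linear sX sY f" and g: "g \<in> mhom sX 1 sY 1" "\<And>x. g [x] = tpure sY [f x]"
    and d: "d \<in> mhom sX 1 sX 2" and \<sigma>: "\<sigma> \<in> mhom sX 1 sY n"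
  shows "morph_diff sX (elem d) sY (elem e) f n (elem \<sigma>) x =
    mcomp (mpar sY 1 g \<sigma>) d [x] + (\<Sum>i = 1..n. tscale ((-1) ^ i) (ins_map sY i (elem e) (\<sigma> [x])))
    + tscale ((-1) ^ (n + 1)) (mcomp (mpar sY 1 \<sigma> g) d [x])"
  using id_tensor_mpar[OF f g \<sigma> mhomD(4)[OF d]]
  by (simp add: morph_diff_def hoch_diff_def elem_apply mcomp_def del: One_nat_def)

lemma morph_diff_1:
  assumes f: "Vector_Spaces.linear sX sY f" and g: "g \<in> mhom sX 1 sY 1" "\<And>x. g [x] = tpure sY [f x]"
    and d: "d \<in> mhom sX 1 sX 2" and e: "e \<in> mhom sY 1 sY 2" and \<sigma>: "\<sigma> \<in> mhom sX 1 sY 1"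
  shows "morph_diff sX (elem d) sY (elem e) f 1 (elem \<sigma>) =
    elem (mcomp (mpar sY 1 g \<sigma>) d - mcomp e \<sigma> + mcomp (mpar sY 1 \<sigma> g) d)"
proof
  fix x
  have "ins_map sY 1 (elem e) (\<sigma> [x]) = mcomp e \<sigma> [x]"
    using ins_map_1_mpar[OF e mhomD(4)[OF \<sigma>]] by (simp add: mcomp_def)
  then show "morph_diff sX (elem d) sY (elem e) f 1 (elem \<sigma>) x =
      elem (mcomp (mpar sY 1 g \<sigma>) d - mcomp e \<sigma> + mcomp (mpar sY 1 \<sigma> g) d) x"
    unfolding morph_diff_elem[OF f g d \<sigma>] by (simp add: elem_apply tscale_one tscale_minus_one fun_eq_iff)
qed

lemma morph_diff_2:
  assumes f: "Vector_Spaces.linear sX sY f" and g: "g \<in> mhom sX 1 sY 1" "\<And>x. g [x] = tpure sY [f x]"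
    and d: "d \<in> mhom sX 1 sX 2" and e: "e \<in> mhom sY 1 sY 2" and \<sigma>: "\<sigma> \<in> mhom sX 1 sY 2"
  defines "I \<equiv> mid sY 1" and "p \<equiv> mpar sY 1" and "q \<equiv> mpar sY 1"
  shows "morph_diff sX (elem d) sY (elem e) f 2 (elem \<sigma>) =
    elem (mcomp (q g \<sigma>) d - mcomp (p e I) \<sigma> + mcomp (p I e) \<sigma> - mcomp (q \<sigma> g) d)"
proof
  fix x
  have "ins_map sY 1 (elem e) (\<sigma> [x]) = mcomp (p e I) \<sigma> [x]"
    "ins_map sY 2 (elem e) (\<sigma> [x]) = mcomp (p I e) \<sigma> [x]"
    using ins_map_2_mpar[OF e mhomD(4)[OF \<sigma>]] by (simp_all add: mcomp_def p_def I_def)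
  moreover have "{1..2::nat} = {1, 2}" by auto
  ultimately show "morph_diff sX (elem d) sY (elem e) f 2 (elem \<sigma>) x =
      elem (mcomp (q g \<sigma>) d - mcomp (p e I) \<sigma> + mcomp (p I e) \<sigma> - mcomp (q \<sigma> g) d) x"
    unfolding morph_diff_elem[OF f g d \<sigma>] q_def by (simp add: elem_apply tscale_one tscale_minus_one fun_eq_iff)
qed

lemma morph_diff_3:
  assumes f: "Vector_Spaces.linear sX sY f" and g: "g \<in> mhom sX 1 sY 1" "\<And>x. g [x] = tpure sY [f x]"
    and d: "d \<in> mhom sX 1 sX 2" and e: "e \<in> mhom sY 1 sY 2" and \<sigma>: "\<sigma> \<in> mhom sX 1 sY 3"
  defines "I \<equiv> mid sY 1" and "p \<equiv> mpar sY 1" and "q \<equiv> mpar sY 1"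
  shows "morph_diff sX (elem d) sY (elem e) f 3 (elem \<sigma>) =
    elem (mcomp (q g \<sigma>) d - mcomp (p e (p I I)) \<sigma> + mcomp (p I (p e I)) \<sigma> - mcomp (p I (p I e)) \<sigma>
      + mcomp (q \<sigma> g) d)"
proof
  fix x
  have "ins_map sY 1 (elem e) (\<sigma> [x]) = mcomp (p e (p I I)) \<sigma> [x]"
    "ins_map sY 2 (elem e) (\<sigma> [x]) = mcomp (p I (p e I)) \<sigma> [x]"
    "ins_map sY 3 (elem e) (\<sigma> [x]) = mcomp (p I (p I e)) \<sigma> [x]"
    using ins_map_3_mpar[OF e mhomD(4)[OF \<sigma>]] by (simp_all add: mcomp_def p_def I_def)
  moreover have "{1..3::nat} = {1, 2, 3}" by auto
  ultimately show "morph_diff sX (elem d) sY (elem e) f 3 (elem \<sigma>) x =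
      elem (mcomp (q g \<sigma>) d - mcomp (p e (p I I)) \<sigma> + mcomp (p I (p e I)) \<sigma> - mcomp (p I (p I e)) \<sigma>
      + mcomp (q \<sigma> g) d) x"
    unfolding morph_diff_elem[OF f g d \<sigma>] q_def by (simp add: elem_apply tscale_one tscale_minus_one fun_eq_iff)
qed

text \<open>A coalgebra is its own bicomodule through the identity morphism, so one computation
  serves all three components.\<close>

lemma self_diff_morph_diff:
  assumes d: "d \<in> mhom sX 1 sX 2"
  shows "self_diff sX (elem d) = morph_diff sX (elem d) sX (elem d) id"
proof -
  have "as_pair sX \<circ> elem d = pair_map sX sX id id \<circ> as_pair sX \<circ> elem d"
    using pair_map_id[OF mhomD(1)[OF d] mhomD(4)[OF d]] by (simp add: fun_eq_iff elem_apply)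
  from arg_cong[OF this, of "\<lambda>\<psi>. hoch_diff sX (elem d) \<psi> \<psi>"] show ?thesis
    by (simp add: self_diff_def morph_diff_def)
qed

lemma def_diff_2:
  fixes sA :: "'k::field \<Rightarrow> 'a::ab_group_add \<Rightarrow> 'a" and sB :: "'k \<Rightarrow> 'b::ab_group_add \<Rightarrow> 'b"
  assumes f: "Vector_Spaces.linear sA sB f" and g: "g \<in> mhom sA 1 sB 1" "\<And>x. g [x] = tpure sB [f x]"
    and d: "d \<in> mhom sA 1 sA 2" and e: "e \<in> mhom sB 1 sB 2"
    and z: "z \<in> mhom sA 1 sA 2" and y: "y \<in> mhom sB 1 sB 2" and x: "x \<in> mhom sA 1 sB 1"
  defines "I \<equiv> mid sA 1" and "p \<equiv> mpar sA 1" and "J \<equiv> mid sB 1" and "q \<equiv> mpar sB 1" and "r \<equiv> mpar sB 1"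
  shows "def_diff sA (elem d) sB (elem e) f 2 (elem z, elem y, elem x) =
    (elem (mcomp (p I z) d - mcomp (p d I) z + mcomp (p I d) z - mcomp (p z I) d),
     elem (mcomp (q J y) e - mcomp (q e J) y + mcomp (q J e) y - mcomp (q y J) e),
     elem (mcomp y g - mcomp (r g g) z - (mcomp (r g x) d - mcomp e x + mcomp (r x g) d)))"
proof -
  have A: "vector_space sA" and B: "vector_space sB" using mhomD[OF g(1)] by auto
  have iA: "Vector_Spaces.linear sA sA id" and iB: "Vector_Spaces.linear sB sB id"
    using linear_id'[OF A] linear_id'[OF B] by (simp_all add: id_def)
  have mA: "mid sA 1 [x] = tpure sA [id x]" and mB: "mid sB 1 [y] = tpure sB [id y]" for x y
    by (simp_all add: mid_def)
  have deg: "(2::nat) - 1 = 1" "(3::nat) - 1 = 2" by simp_all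
  have "elem y \<circ> f = elem (mcomp y g)"
    using tlift_tpure_length[OF mhomD(3)[OF y]] by (simp add: fun_eq_iff elem_apply mcomp_def g(2))
  moreover have "tmaps sB (replicate 2 f) \<circ> elem z = elem (mcomp (r g g) z)"
    using tmaps_mpar[OF f g f g mhomD(4)[OF z]] by (simp add: fun_eq_iff elem_apply mcomp_def r_def numeral_2_eq_2)
  ultimately show ?thesis
    unfolding def_diff_def self_diff_morph_diff[OF d] self_diff_morph_diff[OF e] prod.case deg
      morph_diff_2[OF iA mid_mhom[OF A] mA d d z] morph_diff_2[OF iB mid_mhom[OF B] mB e e y]
      morph_diff_1[OF f g d e x] p_def q_def r_def I_def J_def elem_diff
    by simp
qed

lemma def_diff_3:
  fixes sA :: "'k::field \<Rightarrow> 'a::ab_group_add \<Rightarrow> 'a" and sB :: "'k \<Rightarrow> 'b::ab_group_add \<Rightarrow> 'b"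
  assumes f: "Vector_Spaces.linear sA sB f" and g: "g \<in> mhom sA 1 sB 1" "\<And>x. g [x] = tpure sB [f x]"
    and d: "d \<in> mhom sA 1 sA 2" and e: "e \<in> mhom sB 1 sB 2"
    and z: "z \<in> mhom sA 1 sA 3" and y: "y \<in> mhom sB 1 sB 3" and x: "x \<in> mhom sA 1 sB 2"
  defines "I \<equiv> mid sA 1" and "p \<equiv> mpar sA 1" and "J \<equiv> mid sB 1" and "q \<equiv> mpar sB 1" and "r \<equiv> mpar sB 1"
  shows "def_diff sA (elem d) sB (elem e) f 3 (elem z, elem y, elem x) =
    (elem (mcomp (p I z) d - mcomp (p d (p I I)) z + mcomp (p I (p d I)) z - mcomp (p I (p I d)) z + mcomp (p z I) d),
     elem (mcomp (q J y) e - mcomp (q e (q J J)) y + mcomp (q J (q e J)) y - mcomp (q J (q J e)) y + mcomp (q y J) e),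
     elem (mcomp y g - mcomp (r g (r g g)) z -
       (mcomp (r g x) d - mcomp (q e J) x + mcomp (q J e) x - mcomp (r x g) d)))"
proof -
  have A: "vector_space sA" and B: "vector_space sB" using mhomD[OF g(1)] by auto
  have iA: "Vector_Spaces.linear sA sA id" and iB: "Vector_Spaces.linear sB sB id"
    using linear_id'[OF A] linear_id'[OF B] by (simp_all add: id_def)
  have mA: "mid sA 1 [x] = tpure sA [id x]" and mB: "mid sB 1 [y] = tpure sB [id y]" for x y
    by (simp_all add: mid_def)
  have deg: "(2::nat) - 1 = 1" "(3::nat) - 1 = 2" by simp_all
  have "elem y \<circ> f = elem (mcomp y g)"
    using tlift_tpure_length[OF mhomD(3)[OF y]] by (simp add: fun_eq_iff elem_apply mcomp_def g(2))
  moreover have "tmaps sB (replicate 3 f) \<circ> elem z = elem (mcomp (r g (r g g)) z)"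
    using tmaps_3_mpar[OF f g mhomD(4)[OF z]] by (simp add: fun_eq_iff elem_apply mcomp_def r_def)
  ultimately show ?thesis
    unfolding def_diff_def self_diff_morph_diff[OF d] self_diff_morph_diff[OF e] prod.case deg
      morph_diff_3[OF iA mid_mhom[OF A] mA d d z] morph_diff_3[OF iB mid_mhom[OF B] mB e e y]
      morph_diff_2[OF f g d e x] p_def q_def r_def I_def J_def elem_diff
    by simp
qed

section \<open>The leading curvature coefficients form a 3-cocycle\<close>

text \<open>The curvature starts in degree \<open>n\<close>, so in that degree all other factors of
  \<open>bianchi_curv\<close> contribute their constant terms. The result is the shape of the first
  two components in \<open>def_diff_3\<close>.\<close>

lemma bianchi_curv_coeff:
  fixes sX :: "'k::field \<Rightarrow> 'x::ab_group_add \<Rightarrow> 'x"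
  assumes D: "D \<in> chom sX 1 sX 2" and low: "\<And>i. i < n \<Longrightarrow> curv sX D i = 0"
  defines "I \<equiv> mid sX 1" and "p \<equiv> mpar sX 1" and "d \<equiv> D 0" and "z \<equiv> curv sX D n"
  shows "mcomp (p I z) d - mcomp (p d (p I I)) z + mcomp (p I (p d I)) z - mcomp (p I (p I d)) z + mcomp (p z I) d = 0"
proof -
  have X: "vector_space sX" by (rule mhomD(1)[OF chomD[OF D]])
  \<comment> \<open>In the three middle terms the curvature is the right factor of the composition;
    in the two outer ones it sits inside the left factor.\<close>
  have hi: "ccomp U (curv sX D) n = mcomp (U 0) z" for U :: "nat \<Rightarrow> 'x list \<Rightarrow> ('x list, 'k) tensor"
    using ccomp_high[OF low order_refl, where S = U] by (simp add: z_def)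
  have I0: "mid sX 1 \<in> mhom sX 1 sX 1" by (rule mid_mhom[OF X])
  have "ccomp (cpar sX 1 (cid sX 1) (curv sX D)) D n = mcomp (p I z) d"
    using ccomp_low[where S = "cpar sX 1 (cid sX 1) (curv sX D)" and n = n and k = n, OF _ order_refl D]
    by (simp add: cpar_cid_left[OF X] low mpar_zero_right[OF I0] p_def I_def z_def d_def del: One_nat_def)
  moreover have "ccomp (cpar sX 1 (curv sX D) (cid sX 1)) D n = mcomp (p z I) d"
    using ccomp_low[where S = "cpar sX 1 (curv sX D) (cid sX 1)" and n = n and k = n, OF _ order_refl D]
    by (simp add: cpar_cid_right[OF curv_chom[OF D]] low mpar_zero_left p_def I_def z_def d_def del: One_nat_def)
  ultimately show ?thesis
    using fun_cong[OF bianchi_curv[OF D], of n]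
    by (simp add: hi cpar_0 cid_def p_def I_def d_def)
qed

text \<open>The same leading-term argument for \<open>bianchi_mcurv\<close>. All three curvatures
  occur in that identity, so all must vanish below \<open>n\<close>; the result is the third
  component in \<open>def_diff_3\<close>.\<close>

lemma bianchi_mcurv_coeff:
  fixes sX :: "'k::field \<Rightarrow> 'x::ab_group_add \<Rightarrow> 'x" and sY :: "'k \<Rightarrow> 'y::ab_group_add \<Rightarrow> 'y"
  assumes D: "D \<in> chom sX 1 sX 2" and E: "E \<in> chom sY 1 sY 2" and F: "F \<in> chom sX 1 sY 1"
    and low: "\<And>i. i < n \<Longrightarrow> curv sX D i = 0" "\<And>i. i < n \<Longrightarrow> curv sY E i = 0"
      "\<And>i. i < n \<Longrightarrow> mcurv sY D E F i = 0"
  defines "J \<equiv> mid sY 1" and "q \<equiv> mpar sY 1" and "r \<equiv> mpar sY 1" and "d \<equiv> D 0" and "e \<equiv> E 0" and "g \<equiv> F 0"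
    and "z \<equiv> curv sX D n" and "y \<equiv> curv sY E n" and "x \<equiv> mcurv sY D E F n"
  shows "mcomp y g - mcomp (r g (r g g)) z -
       (mcomp (r g x) d - mcomp (q e J) x + mcomp (q J e) x - mcomp (r x g) d) = 0"
proof -
  let ?M = "mcurv sY D E F"
  have M: "?M \<in> chom sX 1 sY 2" by (rule mcurv_chom[OF D E F])
  have hiz: "ccomp U (curv sX D) n = mcomp (U 0) z" for U :: "nat \<Rightarrow> 'x list \<Rightarrow> ('y list, 'k) tensor"
    using ccomp_high[OF low(1) order_refl, where S = U] by (simp add: z_def)
  have hix: "ccomp U ?M n = mcomp (U 0) x" for U :: "nat \<Rightarrow> 'y list \<Rightarrow> ('y list, 'k) tensor"
    using ccomp_high[OF low(3) order_refl, where S = U] by (simp add: x_def)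
  have "ccomp (curv sY E) F n = mcomp y g"
    using ccomp_low[OF low(2) order_refl F] by (simp add: y_def g_def)
  moreover have "ccomp (cpar sY 1 F ?M) D n = mcomp (r g x) d"
    using ccomp_low[where S = "cpar sY 1 F ?M" and n = n and k = n, OF _ order_refl D]
      cpar_high[OF low(3) _ F] 
    by (simp add: low mpar_zero_right[OF chomD[OF F]] r_def g_def x_def d_def del: One_nat_def)
  moreover have "ccomp (cpar sY 1 ?M F) D n = mcomp (r x g) d"
    using ccomp_low[where S = "cpar sY 1 ?M F" and n = n and k = n, OF _ order_refl D]
      cpar_low[OF low(3)] 
    by (simp add: low mpar_zero_left r_def g_def x_def d_def del: One_nat_def)
  ultimately show ?thesis
    using fun_cong[OF bianchi_mcurv[OF D E F], of n]
    by (simp add: hiz hix cpar_0 cid_def q_def r_def J_def d_def e_def g_def)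
qed

section \<open>One correction step\<close>

lemma chom_upd: "S \<in> chom sX m sY n \<Longrightarrow> z \<in> mhom sX m sY n \<Longrightarrow> S(k := z) \<in> chom sX m sY n"
  by (simp add: chom_def)

lemma Hom_tpow_elemE:
  assumes "\<sigma> \<in> Hom_tpow sM sX n" "vector_space sX"
  obtains g where "g \<in> mhom sM 1 sX n" "\<sigma> = elem g"
  by (rule that[OF unary_mhom[OF assms]]) simp

definition flat ::
  "('k::field \<Rightarrow> 'a::ab_group_add \<Rightarrow> 'a) \<Rightarrow> ('k \<Rightarrow> 'b::ab_group_add \<Rightarrow> 'b) \<Rightarrow>
   (nat \<Rightarrow> 'a list \<Rightarrow> ('a list, 'k) tensor) \<Rightarrow> (nat \<Rightarrow> 'b list \<Rightarrow> ('b list, 'k) tensor) \<Rightarrow>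
   (nat \<Rightarrow> 'a list \<Rightarrow> ('b list, 'k) tensor) \<Rightarrow> nat \<Rightarrow> bool" where
  "flat sA sB D E F n \<longleftrightarrow> curv sA D n = 0 \<and> curv sB E n = 0 \<and> mcurv sB D E F n = 0"

lemma flat_cong:
  assumes "\<And>i. i \<le> n \<Longrightarrow> D i = D' i" "\<And>i. i \<le> n \<Longrightarrow> E i = E' i" "\<And>i. i \<le> n \<Longrightarrow> F i = F' i"
  shows "flat sA sB D E F n \<longleftrightarrow> flat sA sB D' E' F' n"
  using curv_cong[OF assms(1)] curv_cong[OF assms(2)] mcurv_cong[OF assms] by (simp add: flat_def)

text \<open>To first order in the update, the curvatures change by minus the differential of the
  cochain that is added.\<close>

lemma flat_update:
  fixes sA :: "'k::field \<Rightarrow> 'a::ab_group_add \<Rightarrow> 'a" and sB :: "'k \<Rightarrow> 'b::ab_group_add \<Rightarrow> 'b"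
  assumes f: "Vector_Spaces.linear sA sB f" and F0: "\<And>x. F 0 [x] = tpure sB [f x]"
    and D: "D \<in> chom sA 1 sA 2" and E: "E \<in> chom sB 1 sB 2" and F: "F \<in> chom sA 1 sB 1"
    and z: "z \<in> mhom sA 1 sA 2" and y: "y \<in> mhom sB 1 sB 2" and x: "x \<in> mhom sA 1 sB 1"
    and n: "0 < n"
    and eq: "def_diff sA (elem (D 0)) sB (elem (E 0)) f 2 (elem z, elem y, elem x) =
      (elem (curv sA D n), elem (curv sB E n), elem (mcurv sB D E F n))"
  shows "flat sA sB (D(n := D n + z)) (E(n := E n + y)) (F(n := F n + x)) n"
proof -
  let ?D = "D(n := D n + z)" and ?E = "E(n := E n + y)" and ?F = "F(n := F n + x)"
  have A: "vector_space sA" and B: "vector_space sB" using mhomD[OF x] by auto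
  have D': "?D \<in> chom sA 1 sA 2" and E': "?E \<in> chom sB 1 sB 2" and F': "?F \<in> chom sA 1 sB 1"
    using chom_upd[OF D mhom_add[OF chomD[OF D] z]] chom_upd[OF E mhom_add[OF chomD[OF E] y]]
      chom_upd[OF F mhom_add[OF chomD[OF F] x]] by auto
  note eqs = eq[unfolded def_diff_2[OF f chomD[OF F] F0 chomD[OF D] chomD[OF E] z y x] prod.inject]
  have "curv sA ?D n = 0"
  proof (rule mhom_eqI[OF chomD[OF curv_chom[OF D']] mhom_zero[OF A A]])
    fix a
    show "curv sA ?D n [a] = 0 [a]"
      using fun_cong[OF eqs[THEN conjunct1], of a, unfolded elem_apply, symmetric]
        curv_first_order[OF n D z, of ?D]
      by (simp add: fun_eq_iff)
  qed
  moreover have "curv sB ?E n = 0"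
  proof (rule mhom_eqI[OF chomD[OF curv_chom[OF E']] mhom_zero[OF B B]])
    fix a
    show "curv sB ?E n [a] = 0 [a]"
      using fun_cong[OF eqs[THEN conjunct2, THEN conjunct1], of a, unfolded elem_apply, symmetric]
        curv_first_order[OF n E y, of ?E]
      by (simp add: fun_eq_iff)
  qed
  moreover have "mcurv sB ?D ?E ?F n = 0"
  proof (rule mhom_eqI[OF chomD[OF mcurv_chom[OF D' E' F']] mhom_zero[OF A B]])
    fix a
    show "mcurv sB ?D ?E ?F n [a] = 0 [a]"
      using fun_cong[OF eqs[THEN conjunct2, THEN conjunct2], of a, unfolded elem_apply, symmetric]
        mcurv_first_order[OF n D E F z y x, of ?D ?E ?F]
      by (simp add: fun_eq_iff)
  qed
  ultimately show ?thesis by (simp add: flat_def)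
qed

text \<open>The coset of \<open>z\<close> is the set of coboundaries itself, and it contains
  \<open>z + 0\<close>.\<close>

lemma coboundaries_if_cohomology_trivial:
  assumes H: "def_cohomology sA dA sB dB f 3 = {def_coboundaries sA dA sB dB f 3}"
    and zero: "0 \<in> def_coboundaries sA dA sB dB f 3" and z: "z \<in> def_cocycles sA dA sB dB f 3"
  shows "z \<in> def_coboundaries sA dA sB dB f 3"
proof -
  have "(+) z ` def_coboundaries sA dA sB dB f 3 = def_coboundaries sA dA sB dB f 3"
    using H z unfolding def_cohomology_def by blast
  then have "z + 0 \<in> def_coboundaries sA dA sB dB f 3" using zero by blast
  then show ?thesis by simp
qed

text \<open>The cohomology is formed with \<open>D 0\<close> and \<open>E 0\<close>, which an update
  in positive degree leaves alone; so \<open>H\<close> stays available for every later step.\<close>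

lemma flat_extend:
  fixes sA :: "'k::field \<Rightarrow> 'a::ab_group_add \<Rightarrow> 'a" and sB :: "'k \<Rightarrow> 'b::ab_group_add \<Rightarrow> 'b"
  assumes f: "Vector_Spaces.linear sA sB f" and F0: "\<And>x. F 0 [x] = tpure sB [f x]"
    and D: "D \<in> chom sA 1 sA 2" and E: "E \<in> chom sB 1 sB 2" and F: "F \<in> chom sA 1 sB 1"
    and H: "def_cohomology sA (elem (D 0)) sB (elem (E 0)) f 3 = {def_coboundaries sA (elem (D 0)) sB (elem (E 0)) f 3}"
    and n: "0 < n" and low: "\<And>i. i < n \<Longrightarrow> flat sA sB D E F i"
  obtains z y x where "z \<in> mhom sA 1 sA 2" "y \<in> mhom sB 1 sB 2" "x \<in> mhom sA 1 sB 1"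
    "flat sA sB (D(n := z)) (E(n := y)) (F(n := x)) n"
proof -
  have A: "vector_space sA" and B: "vector_space sB" using mhomD[OF chomD[OF F]] by auto
  let ?K = "(elem (curv sA D n), elem (curv sB E n), elem (mcurv sB D E F n))"
  note cD = chomD[OF curv_chom[OF D], of n] and cE = chomD[OF curv_chom[OF E], of n]
    and cF = chomD[OF mcurv_chom[OF D E F], of n]
  have low': "\<And>i. i < n \<Longrightarrow> curv sA D i = 0" "\<And>i. i < n \<Longrightarrow> curv sB E i = 0"
    "\<And>i. i < n \<Longrightarrow> mcurv sB D E F i = 0"
    using low by (auto simp: flat_def)
  have "def_diff sA (elem (D 0)) sB (elem (E 0)) f 3 ?K = 0"
    by (simp add: def_diff_3[OF f chomD[OF F] F0 chomD[OF D] chomD[OF E] cD cE cF]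
      bianchi_curv_coeff[OF D] bianchi_curv_coeff[OF E] bianchi_mcurv_coeff[OF D E F] low'
      elem_zero zero_prod_def del: One_nat_def zero_fun_apply)
  then have K: "?K \<in> def_cocycles sA (elem (D 0)) sB (elem (E 0)) f 3"
    using elem_Hom[OF cD] elem_Hom[OF cE] elem_Hom[OF cF]
    by (simp add: def_cocycles_def def_cochains_def cochains_def)
  \<comment> \<open>Zero is exhibited as the differential of the zero triple, so no general
    linearity of \<open>def_diff\<close> has to be established.\<close>
  have zero: "0 \<in> def_coboundaries sA (elem (D 0)) sB (elem (E 0)) f 3"
  proof -
    note zA = mhom_zero[OF A A, of 1 2] and zB = mhom_zero[OF B B, of 1 2] and zF = mhom_zero[OF A B, of 1 1]
    have "(elem 0, elem 0, elem 0) \<in> def_cochains sA sB 2"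
      using elem_Hom[OF zA] elem_Hom[OF zB] elem_Hom[OF zF] by (simp add: def_cochains_def cochains_def)
    moreover have "def_diff sA (elem (D 0)) sB (elem (E 0)) f 2 (elem 0, elem 0, elem 0) = 0"
      unfolding def_diff_2[OF f chomD[OF F] F0 chomD[OF D] chomD[OF E] zA zB zF]
      by (simp add: mpar_zero_left mcomp_zero_right mcomp_zero_left[OF chomD[OF F]]
        mcomp_zero_left[OF chomD[OF D]] mcomp_zero_left[OF chomD[OF E]] mpar_zero_right[OF mid_mhom[OF A]] mpar_zero_right[OF mid_mhom[OF B]]
         mpar_zero_right[OF chomD[OF F]] elem_zero zero_prod_def del: One_nat_def zero_fun_apply)
    ultimately show ?thesis by (force simp: def_coboundaries_def)
  qed
  obtain \<xi> \<pi> \<psi> where c: "(\<xi>, \<pi>, \<psi>) \<in> def_cochains sA sB 2"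
      and eq: "def_diff sA (elem (D 0)) sB (elem (E 0)) f 2 (\<xi>, \<pi>, \<psi>) = ?K"
    using coboundaries_if_cohomology_trivial[OF H zero K] by (auto simp: def_coboundaries_def)
  have "\<xi> \<in> Hom_tpow sA sA 2" "\<pi> \<in> Hom_tpow sB sB 2" "\<psi> \<in> Hom_tpow sA sB 1"
    using c by (auto simp: def_cochains_def cochains_def)
  then obtain z y x where z: "z \<in> mhom sA 1 sA 2" "\<xi> = elem z" and y: "y \<in> mhom sB 1 sB 2" "\<pi> = elem y"
    and x: "x \<in> mhom sA 1 sB 1" "\<psi> = elem x"
    using A B by (elim Hom_tpow_elemE) auto
  show ?thesis
    by (rule that[OF mhom_add[OF chomD[OF D] z(1)] mhom_add[OF chomD[OF E] y(1)] mhom_add[OF chomD[OF F] x(1)]])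
      (rule flat_update[OF f F0 D E F z(1) y(1) x(1) n eq[unfolded z y x]])
qed

section \<open>Deformations as flat series\<close>

lemma sum_fun_apply: "(\<Sum>i\<in>I. g i) x = (\<Sum>i\<in>I. g i x)"
  by (induction I rule: infinite_finite_induct) auto

lemma coassociativity_coeff:
  assumes D: "D \<in> chom sX 1 sX 2"
  shows "(\<Sum>i\<le>n. ins_map sX 1 (elem (D i)) \<circ> elem (D (n - i))) = elem (ccomp (cpar sX 1 D (cid sX 1)) D n)"
    and "(\<Sum>i\<le>n. ins_map sX 2 (elem (D i)) \<circ> elem (D (n - i))) = elem (ccomp (cpar sX 1 (cid sX 1) D) D n)"
proof -
  have X: "vector_space sX" by (rule mhomD(1)[OF chomD[OF D]])
  have "(ins_map sX 1 (elem (D i)) \<circ> elem (D j)) x = mcomp (mpar sX 1 (D i) (mid sX 1)) (D j) [x]"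
    "(ins_map sX 2 (elem (D i)) \<circ> elem (D j)) x = mcomp (mpar sX 1 (mid sX 1) (D i)) (D j) [x]" for i j x
    using ins_map_2_mpar[OF chomD[OF D] mhomD(4)[OF chomD[OF D]]] by (simp_all add: elem_apply mcomp_def)
  then show "(\<Sum>i\<le>n. ins_map sX 1 (elem (D i)) \<circ> elem (D (n - i))) = elem (ccomp (cpar sX 1 D (cid sX 1)) D n)"
    "(\<Sum>i\<le>n. ins_map sX 2 (elem (D i)) \<circ> elem (D (n - i))) = elem (ccomp (cpar sX 1 (cid sX 1) D) D n)"
    unfolding elem_def ccomp_def cpar_cid_right[OF D] cpar_cid_left[OF X]
    by (auto simp only: sum_fun_apply)
qed

lemma curv_eq_0_iff:
  assumes D: "D \<in> chom sX 1 sX 2"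
  shows "curv sX D n = 0 \<longleftrightarrow> (\<Sum>i\<le>n. ins_map sX 2 (elem (D i)) \<circ> elem (D (n - i))) =
    (\<Sum>i\<le>n. ins_map sX 1 (elem (D i)) \<circ> elem (D (n - i)))"
proof -
  have X: "vector_space sX" by (rule mhomD(1)[OF chomD[OF D]])
  have "curv sX D n = 0 \<longleftrightarrow> elem (curv sX D n) = 0"
    using mhom_eqI[OF chomD[OF curv_chom[OF D]] mhom_zero[OF X X]]
    by (auto simp: elem_zero) (simp add: elem_def fun_eq_iff)
  also have "\<dots> \<longleftrightarrow> elem (ccomp (cpar sX 1 (cid sX 1) D) D n) = elem (ccomp (cpar sX 1 D (cid sX 1)) D n)"
    by (auto simp: curv_def elem_diff)
  finally show ?thesis unfolding coassociativity_coeff[OF D] .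
qed

text \<open>Deformations speak of maps \<open>G i\<close> into the target itself, the calculus of
  their encodings \<open>F i\<close> with values in the first tensor power.\<close>

lemma mcurv_eq_0_iff:
  fixes sX :: "'k::field \<Rightarrow> 'x::ab_group_add \<Rightarrow> 'x" and sY :: "'k \<Rightarrow> 'y::ab_group_add \<Rightarrow> 'y"
  assumes D: "D \<in> chom sX 1 sX 2" and E: "E \<in> chom sY 1 sY 2" and F: "F \<in> chom sX 1 sY 1"
    and G: "\<And>i. Vector_Spaces.linear sX sY (G i)" "\<And>i x. F i [x] = tpure sY [G i x]"
  shows "mcurv sY D E F n = 0 \<longleftrightarrow> (\<Sum>i\<le>n. elem (E i) \<circ> G (n - i)) =
    (\<Sum>(i, j, k)\<in>{(i, j, k). i + j + k = n}. tmaps sY [G i, G j] \<circ> elem (D k))"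
proof -
  have X: "vector_space sX" and Y: "vector_space sY" using mhomD[OF chomD[OF F]] by auto
  have "elem (ccomp E F n) x = (\<Sum>i\<le>n. elem (E i) \<circ> G (n - i)) x" for x
    using tlift_tpure_length[OF mhomD(3)[OF chomD[OF E]]]
    by (simp add: elem_apply ccomp_def sum_fun_apply mcomp_def G(2) fun_eq_iff)
  then have 1: "elem (ccomp E F n) = (\<Sum>i\<le>n. elem (E i) \<circ> G (n - i))" by blast
  let ?t = "\<lambda>i j k. tmaps sY [G i, G j] \<circ> elem (D k)"
  have "mcomp (mpar sY 1 (F i) (F j)) (D k) [x] = ?t i j k x" for i j k x
    using tmaps_mpar[OF G(1) chomD[OF F] G(2) G(1) chomD[OF F] G(2) mhomD(4)[OF chomD[OF D]], of i j k "[x]"]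
    by (simp add: mcomp_def elem_apply)
  note term_eq = this
  have FF: "mpar sY 1 (F i) (F j) \<in> mhom sX 2 sY 2" for i j
    by (rule mpar_mhom[OF chomD[OF F] chomD[OF F]]) simp_all
  have "elem (ccomp (cpar sY 1 F F) D n) x = (\<Sum>p\<le>n. \<Sum>i\<le>p. ?t i (p - i) (n - p)) x" for x
    unfolding elem_apply[of "ccomp (cpar sY 1 F F) D n"] ccomp_def cpar_def mcomp_sum_left[OF FF chomD[OF D]]
    by (simp only: elem_apply[of "sum _ _"] sum_fun_apply[where x = "[x]"] sum_fun_apply[where x = x] term_eq)
  then have "elem (ccomp (cpar sY 1 F F) D n) = (\<Sum>p\<le>n. \<Sum>i\<le>p. ?t i (p - i) (n - p))" by blast
  \<comment> \<open>A triple is recovered from its first entry and the partial sum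
    \<open>p = i + j\<close>.\<close>
  also have "\<dots> = (\<Sum>(i, j, k)\<in>{(i, j, k). i + j + k = n}. ?t i j k)"
    unfolding sum.Sigma[OF finite_atMost ballI[OF finite_atMost]]
    by (rule sum.reindex_bij_witness[where i = "\<lambda>(i, j, k). (i + j, i)" and j = "\<lambda>(p, i). (i, p - i, n - p)"]) auto
  finally have 2: "elem (ccomp (cpar sY 1 F F) D n) = (\<Sum>(i, j, k)\<in>{(i, j, k). i + j + k = n}. ?t i j k)" .
  have "mcurv sY D E F n = 0 \<longleftrightarrow> elem (mcurv sY D E F n) = 0"
    using mhom_eqI[OF chomD[OF mcurv_chom[OF D E F]] mhom_zero[OF X Y]]
    by (auto simp: elem_zero) (simp add: elem_def fun_eq_iff)
  also have "\<dots> \<longleftrightarrow> elem (ccomp E F n) = elem (ccomp (cpar sY 1 F F) D n)"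
    by (auto simp: mcurv_def elem_diff)
  finally show ?thesis unfolding 1 2 .
qed

lemma linear_as_tensor: "vector_space sX \<Longrightarrow> Vector_Spaces.linear sX tscale (as_tensor sX)"
  using linear_ctx[OF _ refl linear_id', of sX "[]" "[]"] by (simp add: as_tensor_def[abs_def])

text \<open>Third components of cochains take values in the first tensor power, whereas a
  deformation asks for maps into the space. \<open>h\<close> is the linear map that the universal
  property assigns to \<open>hd\<close>.\<close>

lemma as_tensor_inverse:
  fixes sX :: "'k::field \<Rightarrow> 'x::ab_group_add \<Rightarrow> 'x"
  assumes X: "vector_space sX"
  obtains h where "Vector_Spaces.linear tscale sX h" "\<And>x. h (as_tensor sX x) = x"
    "\<And>t. t \<in> tpow sX 1 \<Longrightarrow> as_tensor sX (h t) = t"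
proof -
  have "multilinear sX sX 1 hd" by (simp add: multilinear_def linear_id'[OF X])
  from tpow_universal[OF X this] obtain h where h: "Vector_Spaces.linear tscale sX h"
    "\<And>w. length w = 1 \<Longrightarrow> h (tpure sX w) = hd w" by auto
  have "as_tensor sX (h t) = t" if "t \<in> tpow sX 1" for t
  proof (rule tpow_unique[OF linear_comp[OF h(1) linear_as_tensor[OF X]] linear_id'[OF vector_space_tscale] _ that])
    fix w :: "'x list" assume w: "length w = 1"
    then obtain x where "w = [x]" by (cases w) auto
    with h(2)[OF w] show "as_tensor sX (h (tpure sX w)) = tpure sX w" by (simp add: as_tensor_def)
  qed
  with h show ?thesis by (intro that) (auto simp: as_tensor_def)
qed

lemma flat_series_deformation:
  fixes sA :: "'k::field \<Rightarrow> 'a::ab_group_add \<Rightarrow> 'a" and sB :: "'k \<Rightarrow> 'b::ab_group_add \<Rightarrow> 'b"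
  assumes D: "D \<in> chom sA 1 sA 2" and E: "E \<in> chom sB 1 sB 2" and F: "F \<in> chom sA 1 sB 1"
    and F0: "\<And>x. F 0 [x] = tpure sB [f x]" and flat: "\<And>n. flat sA sB D E F n"
  shows "morphism_deformation sA (elem (D 0)) sB (elem (E 0)) f (\<lambda>n. (elem (D n), elem (E n), elem (F n)))"
proof -
  have B: "vector_space sB" by (rule mhomD(2)[OF chomD[OF F]])
  obtain h where h: "Vector_Spaces.linear tscale sB h" "\<And>x. h (as_tensor sB x) = x"
    "\<And>t. t \<in> tpow sB 1 \<Longrightarrow> as_tensor sB (h t) = t"
    using as_tensor_inverse[OF B] by blast
  define G where "G n x = h (F n [x])" for n x
  have FG: "F n [x] = tpure sB [G n x]" for n x
    using h(3)[OF mhomD(4)[OF chomD[OF F]], of n "[x]"] by (simp add: G_def as_tensor_def)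
  have "Vector_Spaces.linear sA tscale (\<lambda>x. F n [x])" for n
    using elem_Hom[OF chomD[OF F], of n] by (simp add: Hom_tpow_def elem_def)
  then have G: "Vector_Spaces.linear sA sB (G n)" for n
    unfolding G_def by (rule linear_comp[OF _ h(1)])
  have "G 0 x = f x" for x using h(2)[of "f x"] F0[of x] by (simp add: G_def as_tensor_def)
  then have G0: "G 0 = f" by blast
  have hom: "elem (D n) \<in> Hom_tpow sA sA 2" "elem (E n) \<in> Hom_tpow sB sB 2" "elem (F n) \<in> Hom_tpow sA sB 1" for n
    using elem_Hom[OF chomD[OF D]] elem_Hom[OF chomD[OF E]] elem_Hom[OF chomD[OF F]] by auto
  have zero: "curv sA D n = 0" "curv sB E n = 0" "mcurv sB D E F n = 0" for n
    using flat[of n] by (auto simp: flat_def)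
  have "coalgebra_deformation sA (elem (D 0)) (\<lambda>n. elem (D n))" "coalgebra_deformation sB (elem (E 0)) (\<lambda>n. elem (E n))"
    using zero hom curv_eq_0_iff[OF D] curv_eq_0_iff[OF E] by (simp_all add: coalgebra_deformation_def)
  moreover have "(\<Sum>i\<le>n. elem (E i) \<circ> G (n - i)) =
    (\<Sum>(i, j, k)\<in>{(i, j, k). i + j + k = n}. tmaps sB [G i, G j] \<circ> elem (D k))" for n
    using zero(3) mcurv_eq_0_iff[OF D E F G FG] by blast
  moreover have "elem (F n) = as_tensor sB \<circ> G n" for n
    by (simp add: fun_eq_iff elem_apply FG as_tensor_def)
  ultimately show ?thesis
    using hom G G0 unfolding morphism_deformation_def def_cochains_def cochains_def
    by (intro conjI exI[of _ "\<lambda>n. elem (D n)"] exI[of _ "\<lambda>n. elem (E n)"] exI[of _ G]) auto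
qed

section \<open>Passage to the limit\<close>

text \<open>Dependent choice on whole triples of series: stage \<open>n\<close> is flat up to degree
  \<open>m + n\<close>, and the next stage agrees with it up to there. The diagonal takes each
  coefficient from a stage where it is final. Degrees up to \<open>m\<close> stay as given.\<close>

lemma flat_series_exists:
  fixes sA :: "'k::field \<Rightarrow> 'a::ab_group_add \<Rightarrow> 'a" and sB :: "'k \<Rightarrow> 'b::ab_group_add \<Rightarrow> 'b"
  assumes f: "Vector_Spaces.linear sA sB f" and g: "\<And>x. F 0 [x] = tpure sB [f x]"
    and D: "D \<in> chom sA 1 sA 2" and E: "E \<in> chom sB 1 sB 2" and F: "F \<in> chom sA 1 sB 1"
    and H: "def_cohomology sA (elem (D 0)) sB (elem (E 0)) f 3 = {def_coboundaries sA (elem (D 0)) sB (elem (E 0)) f 3}"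
    and base: "\<And>i. i \<le> m \<Longrightarrow> flat sA sB D E F i"
  obtains D' E' F' where "D' \<in> chom sA 1 sA 2" "E' \<in> chom sB 1 sB 2" "F' \<in> chom sA 1 sB 1"
    "\<And>n. flat sA sB D' E' F' n" "\<And>i. i \<le> m \<Longrightarrow> D' i = D i \<and> E' i = E i \<and> F' i = F i"
proof -
  define P where "P n s \<longleftrightarrow> (case s of (U, V, W) \<Rightarrow>
    U \<in> chom sA 1 sA 2 \<and> V \<in> chom sB 1 sB 2 \<and> W \<in> chom sA 1 sB 1 \<and>
    (\<forall>i\<le>m. U i = D i \<and> V i = E i \<and> W i = F i) \<and> (\<forall>i\<le>m + n. flat sA sB U V W i))" for n s
  define Q where "Q n s s' \<longleftrightarrow> (case s of (U, V, W) \<Rightarrow> case s' of (U', V', W') \<Rightarrow>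
    \<forall>i\<le>m + n. U' i = U i \<and> V' i = V i \<and> W' i = W i)"
    for n and s s' :: "(nat \<Rightarrow> 'a list \<Rightarrow> ('a list, 'k) tensor) \<times> (nat \<Rightarrow> 'b list \<Rightarrow> ('b list, 'k) tensor)
      \<times> (nat \<Rightarrow> 'a list \<Rightarrow> ('b list, 'k) tensor)"
  have "\<exists>s. P 0 s" using D E F base by (intro exI[of _ "(D, E, F)"]) (simp add: P_def)
  moreover have "\<exists>s'. P (Suc n) s' \<and> Q n s s'" if "P n s" for s n
  proof -
    obtain U V W where s: "s = (U, V, W)" by (cases s)
    have U: "U \<in> chom sA 1 sA 2" and V: "V \<in> chom sB 1 sB 2" and W: "W \<in> chom sA 1 sB 1"
      and eq: "\<And>i. i \<le> m \<Longrightarrow> U i = D i \<and> V i = E i \<and> W i = F i"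
      and flat: "\<And>i. i < Suc (m + n) \<Longrightarrow> flat sA sB U V W i"
      using that by (simp_all add: P_def s)
    have W0: "W 0 [x] = tpure sB [f x]" for x using eq[of 0] g by simp
    have H': "def_cohomology sA (elem (U 0)) sB (elem (V 0)) f 3 = {def_coboundaries sA (elem (U 0)) sB (elem (V 0)) f 3}"
      using eq[of 0] H by simp
    obtain z y x where z: "z \<in> mhom sA 1 sA 2" and y: "y \<in> mhom sB 1 sB 2" and x: "x \<in> mhom sA 1 sB 1"
      and new: "flat sA sB (U(Suc (m + n) := z)) (V(Suc (m + n) := y)) (W(Suc (m + n) := x)) (Suc (m + n))"
      using flat_extend[OF f W0 U V W H' zero_less_Suc flat] .
    let ?s = "(U(Suc (m + n) := z), V(Suc (m + n) := y), W(Suc (m + n) := x))"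
    have "flat sA sB (U(Suc (m + n) := z)) (V(Suc (m + n) := y)) (W(Suc (m + n) := x)) i" if "i \<le> m + Suc n" for i
    proof (cases "i = Suc (m + n)")
      case False
      then have "i < Suc (m + n)" using that by simp
      moreover from this have "flat sA sB (U(Suc (m + n) := z)) (V(Suc (m + n) := y)) (W(Suc (m + n) := x)) i
          \<longleftrightarrow> flat sA sB U V W i"
        by (intro flat_cong) simp_all
      ultimately show ?thesis using flat by blast
    qed (simp add: new)
    then have "P (Suc n) ?s"
      using eq chom_upd[OF U z] chom_upd[OF V y] chom_upd[OF W x] by (simp add: P_def)
    moreover have "Q n s ?s" by (simp add: Q_def s)
    ultimately show ?thesis by blast
  qed
  ultimately have "\<exists>s. \<forall>n. P n (s n) \<and> Q n (s n) (s (Suc n))"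
    by (intro dependent_nat_choice) auto
  then obtain s where s: "\<And>n. P n (s n)" "\<And>n. Q n (s n) (s (Suc n))" by blast
  define U V W where "U n = fst (s n)" and "V n = fst (snd (s n))" and "W n = snd (snd (s n))" for n
  have s_eq: "s n = (U n, V n, W n)" for n by (simp add: U_def V_def W_def)
  have P: "U n \<in> chom sA 1 sA 2" "V n \<in> chom sB 1 sB 2" "W n \<in> chom sA 1 sB 1"
    "i \<le> m \<Longrightarrow> U n i = D i \<and> V n i = E i \<and> W n i = F i"
    "i \<le> m + n \<Longrightarrow> flat sA sB (U n) (V n) (W n) i" for n i
    using s(1)[of n, unfolded P_def s_eq] by simp_all
  have Q: "i \<le> m + n \<Longrightarrow> U (Suc n) i = U n i \<and> V (Suc n) i = V n i \<and> W (Suc n) i = W n i" for n i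
    using s(2)[of n, unfolded Q_def s_eq] by simp
  have stable: "U (k + n) i = U n i \<and> V (k + n) i = V n i \<and> W (k + n) i = W n i" if "i \<le> n" for k n i
    by (induction k) (use that Q[of i] in auto)
  \<comment> \<open>Coefficient \<open>i\<close> no longer changes from stage \<open>i\<close>
    on.\<close>
  have lim: "U n i = U i i" "V n i = V i i" "W n i = W i i" if "i \<le> n" for n i
    using stable[of i i "n - i"] that by auto
  show ?thesis
  proof (rule that[of "\<lambda>i. U i i" "\<lambda>i. V i i" "\<lambda>i. W i i"])
    show "(\<lambda>i. U i i) \<in> chom sA 1 sA 2" "(\<lambda>i. V i i) \<in> chom sB 1 sB 2" "(\<lambda>i. W i i) \<in> chom sA 1 sB 1"
      using P(1-3) by (auto simp: chom_def)
    show "flat sA sB (\<lambda>i. U i i) (\<lambda>i. V i i) (\<lambda>i. W i i) n" for n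
    proof -
      \<comment> \<open>Flatness in degree \<open>n\<close> sees only coefficients up to
        \<open>n\<close>, where the diagonal agrees with stage \<open>n\<close>.\<close>
      have "flat sA sB (U n) (V n) (W n) n" by (rule P(5)) simp
      also have "flat sA sB (U n) (V n) (W n) n \<longleftrightarrow> flat sA sB (\<lambda>i. U i i) (\<lambda>i. V i i) (\<lambda>i. W i i) n"
        by (intro flat_cong lim)
      finally show ?thesis .
    qed
    show "U i i = D i \<and> V i i = E i \<and> W i i = F i" if "i \<le> m" for i using P(4)[OF that] .
  qed
qed

theorem corollary4p3:
  fixes sA :: "'k::field \<Rightarrow> 'a::ab_group_add \<Rightarrow> 'a"
    and sB :: "'k \<Rightarrow> 'b::ab_group_add \<Rightarrow> 'b"
    and \<Delta>A :: "'a \<Rightarrow> ('a list, 'k) tensor"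
    and \<Delta>B :: "'b \<Rightarrow> ('b list, 'k) tensor"
    and f :: "'a \<Rightarrow> 'b"
  assumes "coalgebra sA \<Delta>A"
    and "coalgebra sB \<Delta>B"
    and "coalgebra_morphism sA \<Delta>A sB \<Delta>B f"
    and "def_cohomology sA \<Delta>A sB \<Delta>B f 3 = {def_coboundaries sA \<Delta>A sB \<Delta>B f 3}"
  shows "\<forall>\<omega> \<in> def_cocycles sA \<Delta>A sB \<Delta>B f 2. integrable sA \<Delta>A sB \<Delta>B f \<omega>"
proof
  fix \<omega> assume \<omega>: "\<omega> \<in> def_cocycles sA \<Delta>A sB \<Delta>B f 2"
  have A: "vector_space sA" and B: "vector_space sB" and f: "Vector_Spaces.linear sA sB f"
    using assms(1-3) by (auto simp: coalgebra_def coalgebra_morphism_def)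
  obtain d e where d: "d \<in> mhom sA 1 sA 2" "\<Delta>A = elem d" and e: "e \<in> mhom sB 1 sB 2" "\<Delta>B = elem e"
    using assms(1,2) A B unfolding coalgebra_def by (elim conjE Hom_tpow_elemE) auto
  obtain z y x where z: "z \<in> mhom sA 1 sA 2" and y: "y \<in> mhom sB 1 sB 2" and x: "x \<in> mhom sA 1 sB 1"
    and \<omega>_eq: "\<omega> = (elem z, elem y, elem x)"
  proof -
    obtain \<xi> \<pi> \<phi> where "\<omega> = (\<xi>, \<pi>, \<phi>)" "\<xi> \<in> Hom_tpow sA sA 2" "\<pi> \<in> Hom_tpow sB sB 2" "\<phi> \<in> Hom_tpow sA sB 1"
      using \<omega> by (auto simp: def_cocycles_def def_cochains_def cochains_def)
    with A B show ?thesis by (elim Hom_tpow_elemE) (auto intro: that)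
  qed
  have "as_tensor sB \<circ> f \<in> Hom_tpow sA sB 1"
    using linear_comp[OF f linear_as_tensor[OF B]]
    by (auto simp: Hom_tpow_def comp_def as_tensor_def intro: tpure_in_tpow)
  then obtain g where g: "g \<in> mhom sA 1 sB 1" "as_tensor sB \<circ> f = elem g"
    using B by (elim Hom_tpow_elemE) auto
  have g': "g [a] = tpure sB [f a]" for a
    using fun_cong[OF g(2), of a] by (simp add: elem_apply as_tensor_def)
  \<comment> \<open>The undeformed structures as constant series; the cocycle is added in degree 1
    afterwards.\<close>
  define D where "D i = (if i = 0 then d else 0)" for i :: nat
  define E where "E i = (if i = 0 then e else 0)" for i :: nat
  define F where "F i = (if i = 0 then g else 0)" for i :: nat
  have D: "D \<in> chom sA 1 sA 2" and E: "E \<in> chom sB 1 sB 2" and F: "F \<in> chom sA 1 sB 1"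
    using d(1) e(1) g(1) mhom_zero[OF A A] mhom_zero[OF B B] mhom_zero[OF A B] 
    by (simp_all add: chom_def D_def E_def F_def)
  have F0: "F 0 [a] = tpure sB [f a]" for a using g' by (simp add: F_def)
  \<comment> \<open>Degree 0 expresses coassociativity of both coalgebras and the morphism
    equation.\<close>
  have flat: "flat sA sB D E F i" for i
  proof (cases "i = 0")
    case True
    have "mcurv sB D E F 0 = 0"
    proof (rule mhom_eqI[OF chomD[OF mcurv_chom[OF D E F]] mhom_zero[OF A B]])
      fix a
      have "\<Delta>B (f a) = tmaps sB [f, f] (\<Delta>A a)"
        using assms(3) by (simp add: coalgebra_morphism_def fun_eq_iff)
      then show "mcurv sB D E F 0 [a] = 0 [a]"
        using tmaps_mpar[OF f g(1) g' f g(1) g' mhomD(4)[OF d(1)]]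
          tlift_tpure_length[OF mhomD(3)[OF e(1)], of "[f a]"]
        by (simp add: mcurv_def ccomp_def cpar_def D_def E_def F_def mcomp_def g' d(2) e(2) elem_apply)
    qed
    moreover have "curv sA D 0 = 0" "curv sB E 0 = 0"
      using assms(1,2) by (simp_all add: curv_eq_0_iff[OF D] curv_eq_0_iff[OF E] coalgebra_def D_def E_def d(2) e(2))
    ultimately show ?thesis using True by (simp add: flat_def)
  next
    case False
    then have "0 < i" by simp
    then show ?thesis
      using curv_concentrated[OF D] curv_concentrated[OF E] mcurv_concentrated[OF D F]
      by (simp add: flat_def D_def E_def F_def)
  qed
  let ?D = "D(1 := D 1 + z)" and ?E = "E(1 := E 1 + y)" and ?F = "F(1 := F 1 + x)"
  \<comment> \<open>The constant series have zero curvature in degree 1, so the cocycle condition is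
    exactly the equation that \<open>flat_update\<close> asks for.\<close>
  have "def_diff sA (elem (D 0)) sB (elem (E 0)) f 2 (elem z, elem y, elem x) =
      (elem (curv sA D 1), elem (curv sB E 1), elem (mcurv sB D E F 1))"
    using \<omega> flat[of 1] by (simp add: def_cocycles_def \<omega>_eq D_def E_def d(2) e(2) flat_def elem_zero zero_prod_def)
  then have "flat sA sB ?D ?E ?F 1"
    by (rule flat_update[OF f F0 D E F z y x zero_less_one])
  moreover have "flat sA sB ?D ?E ?F 0"
    using flat_cong[where D = ?D and D' = D and E = ?E and E' = E and F = ?F and F' = F and n = 0] flat[of 0] by simp
  ultimately have base: "flat sA sB ?D ?E ?F i" if "i \<le> 1" for i
    using that by (cases "i = 0") (auto simp: le_Suc_eq)
  have D1: "?D \<in> chom sA 1 sA 2" "?E \<in> chom sB 1 sB 2" "?F \<in> chom sA 1 sB 1"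
    using chom_upd[OF D mhom_add[OF chomD[OF D] z]] chom_upd[OF E mhom_add[OF chomD[OF E] y]]
      chom_upd[OF F mhom_add[OF chomD[OF F] x]] by auto
  have H: "def_cohomology sA (elem (?D 0)) sB (elem (?E 0)) f 3 = {def_coboundaries sA (elem (?D 0)) sB (elem (?E 0)) f 3}"
    using assms(4) by (simp add: D_def E_def d(2) e(2))
  have F1: "?F 0 [a] = tpure sB [f a]" for a using F0 by simp
  \<comment> \<open>Taking \<open>m = 1\<close> freezes degrees 0 and 1, which keeps the given
    structures and the prescribed infinitesimal.\<close>
  obtain D' E' F' where *: "D' \<in> chom sA 1 sA 2" "E' \<in> chom sB 1 sB 2" "F' \<in> chom sA 1 sB 1"
    "\<And>n. flat sA sB D' E' F' n" and eq: "\<And>i. i \<le> 1 \<Longrightarrow> D' i = ?D i \<and> E' i = ?E i \<and> F' i = ?F i"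
    using flat_series_exists[OF f F1 D1 H base] by blast
  have "F' 0 [a] = tpure sB [f a]" for a using eq[of 0] F0 by simp
  from flat_series_deformation[OF *(1-3) this *(4)]
  have "morphism_deformation sA \<Delta>A sB \<Delta>B f (\<lambda>n. (elem (D' n), elem (E' n), elem (F' n)))"
    using eq[of 0] by (simp add: D_def E_def d(2) e(2))
  moreover have "(elem (D' 1), elem (E' 1), elem (F' 1)) = \<omega>"
    using eq[of 1] by (simp add: D_def E_def F_def \<omega>_eq)
  ultimately show "integrable sA \<Delta>A sB \<Delta>B f \<omega>" unfolding integrable_def by blast
qed

end
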